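(* Let $n,q$ be integers with $0\le q<n$ and $q$ prime to $n$, and let $(W_i,p_i)$, $i=1,2$, be two quasi-ordinary complex surface germs whose associated links $L_{W_i}$, $i=1,2$, are both (orientation-preservingly) homeomorphic to the lens space $L(n,q)$. Let $\phi_i:(W_i,p_i)\to(\mathbb{C}^2,0)$, $i=1,2$, be two finite analytic morphisms with normal-crossing discriminant contained in $\{uv=0\}$, the coordinates $(u,v)$ of $\mathbb{C}^2$ being ordered as in the context, and let $(W_i^c,p_i)$ be the corresponding good compact representative of $(W_i,p_i)$. Suppose that $\phi_1$ and $\phi_2$ determine the same degrees $a$ and $b$ on the two ordered irreducible components of their ramification locus, that is: for both $i=1,2$, the restriction of $\phi_i$ to $\phi_i^{-1}(S\times\{0\})$ has degree $a$ over $S\times\{0\}$ and the restriction of $\phi_i$ to $\phi_i^{-1}(\{0\}\times S)$ has degree $b$ over $\{0\}\times S$. Then there exists a homeomorphism $f:(W_1^c,p_1)\to(W_2^c,p_2)$ such that $\phi_1=\phi_2\circ f$. Moreover, let $\mathring{W}_i=W_i^c\setminus L_{W_i}$ be the interior of $W_i^c$ and let $\mathcal{W}_i=\mathring{W}_i\setminus\phi_i^{-1}(\{uv=0\})$ be the complement of the ramification locus. Then the homeomorphism $f$ restricted to $\mathcal{W}_1$ is an analytic isomorphism onto $\mathcal{W}_2$.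
   Context: Discriminant and quasi-ordinary germs. For a finite analytic morphism $\phi:(W,p)\to(\mathbb{C}^2,0)$ from a complex surface germ (not necessarily normal), the discriminant is the image of the set of points where $\phi$ is not a local analytic isomorphism. It is normal-crossing if, in suitable analytic coordinates $(u,v)$ of $(\mathbb{C}^2,0)$, it is contained in $\{uv=0\}$; such coordinates are always used. $(W,p)$ is quasi-ordinary if such a finite $\phi$ with normal-crossing discriminant exists. The two components of the ramification locus are the components of $\phi^{-1}(\{uv=0\})$, namely $\phi^{-1}(\{v=0\})$ and $\phi^{-1}(\{u=0\})$, in this order. Compact representative and link. Let $D=\{z\in\mathbb{C}:|z|\le1\}$ and $S=\{z\in\mathbb{C}:|z|=1\}$. After rescaling $u$ and $v$, $W^c=\phi^{-1}(D\times D)$ (inside a small ball around $p$ in an embedding of the germ) is a good compact representative of $(W,p)$, and its boundary $L_W=\phi^{-1}((S\times D)\cup(D\times S))$ is the link of $(W,p)$, oriented as the boundary of $W^c$. Lens spaces $L(n,q)$. A lens space is an oriented compact $3$-manifold $L=T_1\cup T_2$ that is the union of two solid tori glued along their boundaries. Put $\tau=T_1\cap T_2$, oriented as the boundary of $T_2$. A meridian $m_i$ of $T_i$ is an oriented essential simple closed curve on $\tau$ bounding a disc in $T_i$; a parallel $l_2$ of $T_2$ is an oriented simple closed curve on $\tau$ with intersection number $m_2\cdot l_2=+1$. $L(n,q)$ is the lens space for which $m_1=nl_2-qm_2$ in $\pi_1(\tau)$ for a suitable orientation of $m_1$ and a suitable choice of $l_2$. Ordering of coordinates. When $L_W$ is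 homeomorphic to $L(n,q)$, $T_1=\phi^{-1}(S\times D)$ and $T_2=\phi^{-1}(D\times S)$ (taken in $L_W$) are the two solid tori of a Heegaard decomposition $L_W=T_1\cup T_2$, and the coordinates $(u,v)$ are ordered so that, for a suitable orientation of the meridian $m_1$ of $T_1$ and a suitable parallel $l_2$ of $T_2$, the relation $m_1=nl_2-qm_2$ holds with this same $q$. *)

theory Defs
  imports "HOL-Complex_Analysis.Complex_Analysis"
begin

section \<open>Reduced complex analytic sets in complex Euclidean space\<close>

text \<open>Several-variable holomorphy: real Frechet differentiable with complex-linear derivative at
  every point of an open set.\<close>

definition holomorphic_several :: "(complex^'n) set \<Rightarrow> (complex^'n \<Rightarrow> complex) \<Rightarrow> bool" where
  "holomorphic_several U f \<longleftrightarrow> open U \<and>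
     (\<forall>x\<in>U. \<exists>f'. (f has_derivative f') (at x) \<and> (\<forall>c v. f' (c *s v) = c * f' v))"

definition analytic_subset :: "(complex^'n) set \<Rightarrow> (complex^'n) set \<Rightarrow> bool" where
  "analytic_subset U A \<longleftrightarrow> open U \<and> A \<subseteq> U \<and>
     (\<forall>x\<in>U. \<exists>V F. open V \<and> x \<in> V \<and> V \<subseteq> U \<and> finite F \<and>
        (\<forall>f\<in>F. holomorphic_several V f) \<and> A \<inter> V = {z\<in>V. \<forall>f\<in>F. f z = 0})"

text \<open>Morphisms of reduced analytic sets are the maps that are locally restrictions of holomorphic
  maps of the ambient spaces.\<close>

definition analytic_map_on :: "(complex^'n) set \<Rightarrow> (complex^'n \<Rightarrow> complex^'m) \<Rightarrow> bool" where
  "analytic_map_on A f \<longleftrightarrow>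
     (\<forall>x\<in>A. \<exists>V F. x \<in> V \<and> (\<forall>i. holomorphic_several V (\<lambda>z. F z $ i)) \<and> (\<forall>z\<in>A \<inter> V. f z = F z))"

definition analytic_iso ::
  "(complex^'n) set \<Rightarrow> (complex^'m) set \<Rightarrow> (complex^'n \<Rightarrow> complex^'m) \<Rightarrow> bool" where
  "analytic_iso A B f \<longleftrightarrow>
     bij_betw f A B \<and> analytic_map_on A f \<and> analytic_map_on B (inv_into A f)"

definition local_analytic_iso_at ::
  "(complex^'n) set \<Rightarrow> (complex^'n \<Rightarrow> complex^2) \<Rightarrow> complex^'n \<Rightarrow> bool" where
  "local_analytic_iso_at X f x \<longleftrightarrow>
     (\<exists>V Q. open V \<and> x \<in> V \<and> open Q \<and> analytic_iso (X \<inter> V) Q f)"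

text \<open>A reduced, not necessarily normal, analytic set is of pure dimension 2 iff the points at which
  it is a 2-dimensional complex manifold are dense in it.\<close>

definition pure_dimension_two :: "(complex^'n) set \<Rightarrow> bool" where
  "pure_dimension_two X \<longleftrightarrow> X \<subseteq> closure {x\<in>X. \<exists>\<psi>. local_analytic_iso_at X \<psi> x}"

text \<open>\<open>X\<close> represents the germ at \<open>p\<close>, embedded in the ball of radius \<open>\<epsilon>\<close> about \<open>p\<close>.\<close>

definition surface_germ :: "complex^'n \<Rightarrow> real \<Rightarrow> (complex^'n) set \<Rightarrow> bool" where
  "surface_germ p \<epsilon> X \<longleftrightarrow>
     0 < \<epsilon> \<and> analytic_subset (ball p \<epsilon>) X \<and> p \<in> X \<and> pure_dimension_two X"


section \<open>Finite morphisms with normal-crossing discriminant and their compact representatives\<close>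

definition bidisc :: "complex set \<Rightarrow> complex set \<Rightarrow> (complex^2) set" where
  "bidisc A B = {w. w $ 1 \<in> A \<and> w $ 2 \<in> B}"

abbreviation unit_disc :: "complex set" (\<open>\<D>\<close>) where "\<D> \<equiv> cball 0 1"
abbreviation unit_circle :: "complex set" (\<open>\<S>\<close>) where "\<S> \<equiv> sphere 0 1"

definition coordinate_cross :: "(complex^2) set" where
  "coordinate_cross = {w. w $ 1 * w $ 2 = 0}"

definition discriminant :: "(complex^'n) set \<Rightarrow> (complex^'n \<Rightarrow> complex^2) \<Rightarrow> (complex^2) set" where
  "discriminant X \<phi> = \<phi> ` {x\<in>X. \<not> local_analytic_iso_at X \<phi> x}"

definition compact_rep :: "(complex^'n) set \<Rightarrow> (complex^'n \<Rightarrow> complex^2) \<Rightarrow> (complex^'n) set" where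
  "compact_rep X \<phi> = X \<inter> \<phi> -` bidisc \<D> \<D>"

definition link :: "(complex^'n) set \<Rightarrow> (complex^'n \<Rightarrow> complex^2) \<Rightarrow> (complex^'n) set" where
  "link X \<phi> = X \<inter> \<phi> -` (bidisc \<S> \<D> \<union> bidisc \<D> \<S>)"

definition unramified_interior ::
  "(complex^'n) set \<Rightarrow> (complex^'n \<Rightarrow> complex^2) \<Rightarrow> (complex^'n) set" where
  "unramified_interior X \<phi> = (compact_rep X \<phi> - link X \<phi>) - \<phi> -` coordinate_cross"

text \<open>For compact \<open>K\<close>: \<open>K\<close> is the cone over \<open>L\<close> with vertex \<open>p\<close>, the base of the cone being \<open>L\<close>
  itself.\<close>

definition cone_over :: "'a::topological_space \<Rightarrow> 'a set \<Rightarrow> 'a set \<Rightarrow> bool" where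
  "cone_over p L K \<longleftrightarrow>
     (\<exists>H. continuous_on (L \<times> {0..1::real}) H \<and> H ` (L \<times> {0..1}) = K \<and>
        (\<forall>x\<in>L. H (x, 0) = p \<and> H (x, 1) = x) \<and>
        inj_on H (L \<times> {0<..1}) \<and> p \<notin> H ` (L \<times> {0<..1}))"

text \<open>A finite morphism germ with discriminant in \<open>uv = 0\<close>, represented on \<open>X\<close>.  The ball
  carrying \<open>X\<close> is so small that the germ conditions hold on all of \<open>X\<close>.\<close>

definition quasi_ordinary_morphism ::
  "complex^'n \<Rightarrow> real \<Rightarrow> (complex^'n) set \<Rightarrow> (complex^'n \<Rightarrow> complex^2) \<Rightarrow> bool" where
  "quasi_ordinary_morphism p \<epsilon> X \<phi> \<longleftrightarrow>
     surface_germ p \<epsilon> X \<and> analytic_map_on X \<phi> \<and>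
     {x\<in>X. \<phi> x = 0} = {p} \<and> (\<forall>w. finite {x\<in>X. \<phi> x = w}) \<and>
     discriminant X \<phi> \<subseteq> coordinate_cross"

text \<open>The coordinates of the target have already been rescaled, so that the polydisc is the unit one.
  ``Good'' is the usual requirement on the size of a compact representative: it lies inside the open
  ball and has the conic structure of the germ, that is, it is a cone over the link with vertex \<open>p\<close>.\<close>

definition good_compact_rep ::
  "complex^'n \<Rightarrow> real \<Rightarrow> (complex^'n) set \<Rightarrow> (complex^'n \<Rightarrow> complex^2) \<Rightarrow> bool" where
  "good_compact_rep p \<epsilon> X \<phi> \<longleftrightarrow>
     quasi_ordinary_morphism p \<epsilon> X \<phi> \<and> compact (compact_rep X \<phi>) \<and>
     cone_over p (link X \<phi>) (compact_rep X \<phi>)"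

definition has_covering_degree ::
  "('a::topological_space \<Rightarrow> 'b::topological_space) \<Rightarrow> 'a set \<Rightarrow> 'b set \<Rightarrow> nat \<Rightarrow> bool" where
  "has_covering_degree f A B d \<longleftrightarrow>
     covering_space A f B \<and> (\<forall>y\<in>B. finite {x\<in>A. f x = y} \<and> card {x\<in>A. f x = y} = d)"


section \<open>Lens spaces\<close>

definition solid_torus_with_boundary :: "'a::topological_space set \<Rightarrow> 'a set \<Rightarrow> bool" where
  "solid_torus_with_boundary T \<tau> \<longleftrightarrow>
     (\<exists>g g'. homeomorphism (bidisc \<D> \<S>) T g g' \<and> g ` bidisc \<S> \<S> = \<tau>)"

definition simple_closed_curve_on :: "'a::topological_space set \<Rightarrow> (real \<Rightarrow> 'a) \<Rightarrow> bool" where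
  "simple_closed_curve_on \<tau> \<gamma> \<longleftrightarrow>
     simple_path \<gamma> \<and> pathfinish \<gamma> = pathstart \<gamma> \<and> path_image \<gamma> \<subseteq> \<tau>"

definition meridian :: "'a::topological_space set \<Rightarrow> 'a set \<Rightarrow> (real \<Rightarrow> 'a) \<Rightarrow> bool" where
  "meridian T \<tau> m \<longleftrightarrow>
     simple_closed_curve_on \<tau> m \<and>
     \<not> (\<exists>c. homotopic_loops \<tau> m (\<lambda>_. c)) \<and>
     (\<exists>\<Delta> g g'. \<Delta> \<subseteq> T \<and> homeomorphism \<D> \<Delta> g g' \<and> g ` \<S> = path_image m)"

primrec loop_power :: "(real \<Rightarrow> 'a::topological_space) \<Rightarrow> nat \<Rightarrow> real \<Rightarrow> 'a" where
  "loop_power \<gamma> 0 = (\<lambda>_. pathstart \<gamma>)"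
| "loop_power \<gamma> (Suc k) = \<gamma> +++ loop_power \<gamma> k"

text \<open>The intersection number of two closed curves on the torus \<open>bidisc \<S> \<S>\<close> with its product
  orientation is the determinant of their classes in the first homology group; it is normalised so
  that the first factor circle meets the second one with sign +1.\<close>

definition std_torus_intersection :: "(real \<Rightarrow> complex^2) \<Rightarrow> (real \<Rightarrow> complex^2) \<Rightarrow> complex" where
  "std_torus_intersection \<alpha> \<beta> =
     winding_number (\<lambda>t. \<alpha> t $ 1) 0 * winding_number (\<lambda>t. \<beta> t $ 2) 0 -
     winding_number (\<lambda>t. \<alpha> t $ 2) 0 * winding_number (\<lambda>t. \<beta> t $ 1) 0"

text \<open>\<open>P\<close> is an orientation of the torus \<open>\<tau> = T1 \<inter> T2\<close> (as the boundary of \<open>T2\<close>), given by its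
  orientation-preserving parametrisations by \<open>bidisc \<S> \<S>\<close>; on a lens space \<open>L = T1 \<union> T2\<close> this is the
  same thing as an orientation of \<open>L\<close>.  The fundamental group of \<open>\<tau>\<close> is abelian, so the relation
  \<open>m1 = n l2 - q m2\<close> in it may be read off from free homotopy classes of loops.  Since \<open>m2\<close> and \<open>l2\<close>
  have intersection number 1 they meet, and are parametrised from a common point.\<close>

definition lens_space ::
  "nat \<Rightarrow> nat \<Rightarrow> 'a::topological_space set \<Rightarrow> 'a set \<Rightarrow> 'a set \<Rightarrow> (complex^2 \<Rightarrow> 'a) set \<Rightarrow> bool"
  where
  "lens_space n q L T1 T2 P \<longleftrightarrow>
     L = T1 \<union> T2 \<and>
     solid_torus_with_boundary T1 (T1 \<inter> T2) \<and> solid_torus_with_boundary T2 (T1 \<inter> T2) \<and>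
     (\<exists>m1 m2 l2.
        meridian T1 (T1 \<inter> T2) m1 \<and> meridian T2 (T1 \<inter> T2) m2 \<and>
        simple_closed_curve_on (T1 \<inter> T2) l2 \<and> pathstart l2 = pathstart m2 \<and>
        (\<exists>h\<in>P. \<exists>h'. homeomorphism (bidisc \<S> \<S>) (T1 \<inter> T2) h h' \<and>
           std_torus_intersection (h' \<circ> m2) (h' \<circ> l2) = 1) \<and>
        homotopic_loops (T1 \<inter> T2) m1 (loop_power l2 n +++ reversepath (loop_power m2 q)))"

text \<open>The link is oriented as the boundary of the compact representative with its complex
  orientation, and \<open>\<tau>\<close> is then oriented as the boundary of \<open>T2 = \<phi>\<^sup>-\<^sup>1(D \<times> S)\<close>.  Off the ramification
  locus \<open>\<phi>\<close> is a local analytic isomorphism, hence preserves orientations, so \<open>\<tau>\<close> carries the pullback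
  of the orientation of \<open>S \<times> S\<close> as the boundary of \<open>D \<times> S\<close>, the latter being part of the boundary of
  \<open>D \<times> D\<close>.  With the outward normal first this is the product orientation of \<open>S \<times> S\<close> (an outward
  normal in the \<open>v\<close>-factor moves past the 2-dimensional \<open>u\<close>-factor without a sign).  Therefore a
  parametrisation \<open>h\<close> of \<open>\<tau>\<close> is orientation-preserving iff the covering \<open>\<phi> \<circ> h\<close> of \<open>S \<times> S\<close> by itself
  has positive degree, the degree being the determinant of the induced map on first homology.\<close>

definition link_orientation ::
  "(complex^'n) set \<Rightarrow> (complex^'n \<Rightarrow> complex^2) \<Rightarrow> (complex^2 \<Rightarrow> complex^'n) set" where
  "link_orientation X \<phi> =
     {h. (\<exists>h'. homeomorphism (bidisc \<S> \<S>) (X \<inter> \<phi> -` bidisc \<S> \<S>) h h') \<and>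
         0 < Re (std_torus_intersection
                   (\<lambda>t. \<phi> (h (vector [circlepath 0 1 t, 1])))
                   (\<lambda>t. \<phi> (h (vector [1, circlepath 0 1 t]))))}"

end

theory Submission
  imports Defs
begin

text \<open>
  Over the punctured bidisc \<open>(D - 0) \<times> (D - 0)\<close> the map \<open>\<phi>\<close> is a connected covering, hence the quotient of
  the product of two half planes (with covering map \<open>exp\<close> in both coordinates) by the lattice \<open>H\<close> of
  pairs of winding numbers of loops in the covering.  Meridians and parallels of the two solid tori show
  that \<open>H\<close> is spanned by \<open>(n \<alpha>, 0)\<close> and \<open>(q \<alpha>, \<beta>)\<close> for some positive \<open>\<alpha>\<close> and \<open>\<beta>\<close>.

  A punctured disc \<open>{s} \<times> (D - 0)\<close> lifts to \<open>\<alpha>\<close> sheets, each of which closes up in one point, its center,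
  so the degree \<open>a\<close> is at most \<open>\<alpha>\<close>; every loop of a solid torus is homotopic to one of its boundary,
  so \<open>\<alpha>\<close> divides the winding number of every core loop, and \<open>a = \<alpha>\<close>.  Hence over \<open>S \<times> {0}\<close> different
  sheets have different centers.  The centers depend holomorphically on \<open>s\<close>, so over the interior they
  can only coincide at isolated points; such a point would locally disconnect the cone over the link, which
  has no local cut points away from its vertex.  The same holds for \<open>b\<close> and the other axis.

  Hence \<open>a\<close> and \<open>b\<close> determine the covering, and the closure of the graph of the isomorphism of the two coverings
  is the graph of a homeomorphism.
\<close>

no_notation fps_nth (infixl \<open>$\<close> 75)

section \<open>Proper local homeomorphisms\<close>

text \<open>The obstacle is that the surface need not be normal. The covering off the axes does not
  say how the discs filling its punctures are glued along the axes, so different surfaces may share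
  one covering. The equality of the degree with \<alpha> excludes gluing over the boundary circle
  only; inside, analysis leaves isolated coincidences, and these need the conic structure.

  Purity of dimension two enters as density: \<phi> has finite fibres, so no two-dimensional piece
  can lie over an axis, and every point of the compact representative is a limit of points of the
  covering.

  The orientation decides one sign: a lattice spanned by \<open>(n \<alpha>, 0)\<close> and
  \<open>(- q \<alpha>, \<beta>)\<close> would belong to L(n, -q).

  Recording the covering by a set \<open>H\<close> of integer pairs turns "the same covering" into
  an equality of sets. The isomorphism is then the pairing of \<open>\<Psi>1 s t\<close> with
  \<open>\<Psi>2 s t\<close>, which needs no choice of base points or lifts.\<close>

lemma finite_set_separated:
  fixes F :: "'a::metric_space set"
  assumes "finite F"
  obtains r where "r > 0" "\<And>x y. x \<in> F \<Longrightarrow> y \<in> F \<Longrightarrow> x \<noteq> y \<Longrightarrow> disjnt (ball x r) (ball y r)"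
proof -
  \<comment> \<open>The added 1 keeps \<open>R\<close> nonempty when \<open>F\<close> has at most
    one point, so that \<open>Min R\<close> makes sense.\<close>
  define R where "R = insert 1 ((\<lambda>(x, y). dist x y) ` (F \<times> F) - {0})"
  have "finite R" using assms by (simp add: R_def)
  moreover have "\<forall>d\<in>R. d > 0" unfolding R_def by auto
  ultimately have M: "Min R > 0" "\<And>d. d \<in> R \<Longrightarrow> Min R \<le> d"
    using R_def by auto
  show ?thesis
  proof
    show "Min R / 2 > 0" using M by simp
    fix x y assume "x \<in> F" "y \<in> F" "x \<noteq> y"
    then have "dist x y \<in> R" unfolding R_def by force
    then have "Min R \<le> dist x y" by (rule M(2))
    then show "disjnt (ball x (Min R / 2)) (ball y (Min R / 2))"
      unfolding disjnt_iff mem_ball by (metis add.commute dist_commute dist_triangle_half_l not_less)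
  qed
qed

lemma closedin_image_restrict_compact:
  fixes f :: "'a::t2_space \<Rightarrow> 'b::t2_space"
  assumes "compact K" "continuous_on K f" "closedin (top_of_set (K \<inter> f -` S)) Z"
  shows "closedin (top_of_set S) (f ` Z)"
proof -
  obtain Z' where Z': "closed Z'" "Z = K \<inter> f -` S \<inter> Z'"
    using assms(3) closedin_closed by metis
  have "compact (f ` (K \<inter> Z'))"
    using assms Z' by (intro compact_continuous_image) (auto intro: continuous_on_subset)
  moreover have "f ` Z = S \<inter> f ` (K \<inter> Z')"
    using Z' by auto
  ultimately show ?thesis
    by (metis closedin_closed_Int compact_imp_closed)
qed

text \<open>The map is open by the local charts and closed by compactness of \<open>K\<close>, so
  its image is clopen in the connected \<open>S\<close>. Finiteness of the fibres then yields evenly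
  covered neighbourhoods in the usual way. \<open>S\<close> itself need not be compact, which
  matters for the punctured bidisc.\<close>

lemma covering_space_proper_local_homeomorphism:
  fixes f :: "'a::metric_space \<Rightarrow> 'b::t2_space"
  assumes K: "compact K" and cont: "continuous_on K f" and C: "C = K \<inter> f -` S"
    and S: "connected S" and ne: "C \<noteq> {}"
    and fin: "\<And>y. y \<in> S \<Longrightarrow> finite {x \<in> K. f x = y}"
    and loc: "\<And>x. x \<in> C \<Longrightarrow>
      \<exists>U V g. x \<in> U \<and> openin (top_of_set C) U \<and> openin (top_of_set S) V \<and> homeomorphism U V f g"
  shows "covering_space C f S"
proof -
  have contC: "continuous_on C f"
    using cont C continuous_on_subset by blast
  have fC: "f ` C \<subseteq> S"
    using C by auto
  have opn: "openin (top_of_set S) (f ` U)" if U: "openin (top_of_set C) U" for U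
  proof (subst openin_subopen, clarify)
    fix x assume x: "x \<in> U"
    then have "x \<in> C" using U openin_imp_subset by blast
    then obtain U' V g where *: "x \<in> U'" "openin (top_of_set C) U'"
        "openin (top_of_set S) V" "homeomorphism U' V f g"
      using loc by meson
    have "openin (top_of_set U') (U' \<inter> U)"
      using * U by (metis inf_le1 openin_Int openin_imp_subset openin_subset_trans)
    then have "openin (top_of_set V) (f ` (U' \<inter> U))"
      using *(4) homeomorphism_imp_open_map by blast
    then have "openin (top_of_set S) (f ` (U' \<inter> U))"
      using *(3) openin_trans by blast
    then show "\<exists>T. openin (top_of_set S) T \<and> f x \<in> T \<and> T \<subseteq> f ` U"
      using x * by blast
  qed
  have cls: "closedin (top_of_set S) (f ` Z)" if "closedin (top_of_set C) Z" for Z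
    using closedin_image_restrict_compact K cont that C by blast
  have surj: "f ` C = S"
    using S opn[of C] cls[of C] ne unfolding connected_clopen by auto
  show ?thesis
  proof
    show "continuous_on C f" "f ` C = S" by fact+
    fix y assume y: "y \<in> S"
    define F where "F = {x \<in> C. f x = y}"
    have finF: "finite F"
      using fin[OF y] by (rule rev_finite_subset) (auto simp: F_def C)
    obtain r where r: "r > 0" "\<And>x x'. x \<in> F \<Longrightarrow> x' \<in> F \<Longrightarrow> x \<noteq> x' \<Longrightarrow> disjnt (ball x r) (ball x' r)"
      using finite_set_separated[OF finF] by blast
    have "\<forall>x\<in>F. \<exists>U V g. x \<in> U \<and> openin (top_of_set C) U \<and> openin (top_of_set S) V \<and> homeomorphism U V f g"
      using loc F_def by blast
    then obtain U V g where UV: "\<And>x. x \<in> F \<Longrightarrow> x \<in> U x" "\<And>x. x \<in> F \<Longrightarrow> openin (top_of_set C) (U x)"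
      "\<And>x. x \<in> F \<Longrightarrow> openin (top_of_set S) (V x)" "\<And>x. x \<in> F \<Longrightarrow> homeomorphism (U x) (V x) f (g x)"
      by metis
    define U' where "U' x = U x \<inter> ball x r" for x
    have U': "openin (top_of_set C) (U' x)" "x \<in> U' x" if "x \<in> F" for x
      using UV[OF that] r unfolding U'_def by (auto simp: openin_Int_open)
    have disj: "disjnt (U' x) (U' x')" if "x \<in> F" "x' \<in> F" "x \<noteq> x'" for x x'
      using r(2)[OF that] unfolding U'_def disjnt_def by auto
    have inj: "inj_on f (U' x)" if "x \<in> F" for x
      using UV(4)[OF that] unfolding U'_def by (metis homeomorphism_def inf_le1 inj_on_inverseI inj_on_subset)
    \<comment> \<open>Besides meeting the image of every chosen sheet, \<open>T\<close> avoids the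
      image of everything outside the sheets. That image is closed and misses \<open>y\<close>, and
      removing it ensures that the sheets exhaust the preimage of \<open>T\<close>.\<close>
    define T where "T = S \<inter> \<Inter> ((\<lambda>x. f ` U' x) ` F) \<inter> (S - f ` (C - \<Union> (U' ` F)))"
    have T: "openin (top_of_set S) T"
    proof -
      have "openin (top_of_set S) (\<Inter> (insert S ((\<lambda>x. f ` U' x) ` F)))"
        using finF U' opn by (intro openin_Inter) auto
      moreover have "closedin (top_of_set S) (f ` (C - \<Union> (U' ` F)))"
        using U' by (intro cls closedin_diff) auto
      then have "openin (top_of_set S) (S - f ` (C - \<Union> (U' ` F)))"
        by (metis openin_diff openin_subtopology_self)
      ultimately show ?thesis
        unfolding T_def by (metis Inter_insert openin_Int)
    qed
    have yT: "y \<in> T"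
    proof -
      have "y \<in> f ` U' x" if "x \<in> F" for x
        using U'[OF that] that F_def by force
      moreover have "y \<notin> f ` (C - \<Union> (U' ` F))"
        using U' unfolding F_def by auto
      ultimately show ?thesis using y T_def by auto
    qed
    define v where "v = (\<lambda>x. U' x \<inter> f -` T) ` F"
    have v1: "\<Union>v = C \<inter> f -` T"
    proof
      show "\<Union>v \<subseteq> C \<inter> f -` T"
        using U' openin_imp_subset unfolding v_def by fastforce
      show "C \<inter> f -` T \<subseteq> \<Union>v"
        unfolding v_def T_def by auto
    qed
    have Uc: "U' x \<subseteq> C" if "x \<in> F" for x using U'[OF that] openin_imp_subset by blast
    have opv: "openin (top_of_set C) (U' x \<inter> f -` T)" if "x \<in> F" for x
    proof -
      have "openin (top_of_set C) (C \<inter> f -` T)"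
        by (rule continuous_openin_preimage[OF contC _ T]) (use fC in auto)
      then have "openin (top_of_set C) (U' x \<inter> (C \<inter> f -` T))"
        using U'[OF that] by blast
      then show ?thesis using Uc[OF that] by (simp add: Int_absorb2 Int_assoc[symmetric])
    qed
    have v2: "\<exists>q. homeomorphism (U' x \<inter> f -` T) T f q" if x: "x \<in> F" for x
    proof -
      let ?A = "U' x \<inter> f -` T"
      have im: "f ` ?A = T"
      proof -
        have "T \<subseteq> f ` U' x" using x unfolding T_def by auto
        then show ?thesis by blast
      qed
      obtain q where "homeomorphism ?A T f q"
      proof (rule homeomorphism_injective_open_map[where f = f and S = ?A and T = T])
        show "continuous_on ?A f"
          using contC Uc[OF x] by (meson continuous_on_subset inf.coboundedI1)
        show "f ` ?A = T" by fact
        show "inj_on f ?A" using inj[OF x] by (meson inf_le1 inj_on_subset)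
        fix W assume "openin (top_of_set ?A) W"
        then have "openin (top_of_set C) W" using opv[OF x] openin_trans by blast
        then have "openin (top_of_set S) (f ` W)" by (rule opn)
        moreover have "f ` W \<subseteq> T" using im openin_imp_subset \<open>openin (top_of_set ?A) W\<close> by blast
        ultimately show "openin (top_of_set T) (f ` W)"
          using T openin_imp_subset by (metis openin_subset_trans)
      qed
      then show ?thesis by blast
    qed
    have "(\<forall>u\<in>v. openin (top_of_set C) u) \<and> pairwise disjnt v \<and> (\<forall>u\<in>v. \<exists>q. homeomorphism u T f q)"
    proof (intro conjI)
      show "\<forall>u\<in>v. openin (top_of_set C) u" using opv v_def by auto
      show "pairwise disjnt v"
        unfolding v_def pairwise_def using disj by (auto simp: disjnt_iff)
      show "\<forall>u\<in>v. \<exists>q. homeomorphism u T f q" using v2 v_def by auto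
    qed
    then show "\<exists>T. y \<in> T \<and> openin (top_of_set S) T \<and> (\<exists>v. \<Union>v = C \<inter> f -` T \<and>
          (\<forall>u\<in>v. openin (top_of_set C) u) \<and> pairwise disjnt v \<and> (\<forall>u\<in>v. \<exists>q. homeomorphism u T f q))"
      using yT T v1 by blast
  qed
qed

section \<open>Coverings of the punctured bidisc\<close>

definition period :: "int \<Rightarrow> complex" where
  "period j = 2 * of_real pi * \<i> * of_int j"

lemma period_0 [simp]: "period 0 = 0"
  and period_add: "period (j + k) = period j + period k"
  and period_diff: "period (j - k) = period j - period k"
  and period_uminus: "period (- j) = - period j"
  and Re_period [simp]: "Re (period j) = 0"
  and Im_period: "Im (period j) = 2 * pi * of_int j"
  by (simp_all add: period_def algebra_simps)

lemma period_inject [simp]: "period j = period k \<longleftrightarrow> j = k"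
  by (simp add: period_def)

lemma period_eq_0_iff [simp]: "period j = 0 \<longleftrightarrow> j = 0"
  by (simp add: period_def)

lemma exp_period [simp]: "exp (period j) = 1"
  by (simp add: period_def exp_eq_1)

lemma exp_add_period [simp]: "exp (z + period j) = exp z"
  by (simp add: exp_add)

lemma exp_eq_period: "exp w = exp z \<longleftrightarrow> (\<exists>j. w = z + period j)"
  unfolding period_def by (simp add: exp_eq mult_ac)

text \<open>All winding numbers along explicit paths are read off in this way, as the increment of a
  logarithm.\<close>

lemma winding_number_exp_path:
  assumes "path s" "\<And>t. t \<in> {0..1} \<Longrightarrow> \<gamma> t = exp (s t)" "s 1 = s 0 + period j"
  shows "winding_number \<gamma> 0 = of_int j"
proof -
  have "winding_number \<gamma> 0 = winding_number (exp \<circ> s) 0"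
    using assms by (intro winding_number_cong) auto
  also have "\<dots> = of_int j"
    using assms by (simp add: winding_number_compose_exp pathfinish_def pathstart_def period_def)
  finally show ?thesis .
qed

text \<open>Closed, so that its image under \<open>exp\<close> contains the unit circle and the link
  is covered too; convex, so that products of two copies are simply connected.\<close>

abbreviation closed_lhp :: "complex set" where "closed_lhp \<equiv> {s. Re s \<le> 0}"

lemma convex_closed_lhp: "convex closed_lhp"
  by (rule convex_halfspace_Re_le)

text \<open>A uniformised compact representative: \<open>u\<close> and \<open>v\<close> are the
  coordinates of the finite map, \<open>\<Psi>\<close> is the universal covering of the part off the
  axes, and \<open>H\<close> is the group of its deck translations. Nothing here is analytic.
  \<open>finite_fibre\<close> also covers the axes, and \<open>dense\<close> is the only assumption
  that ties points on the axes to the covering.\<close>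

locale bidisc_cover =
  fixes K :: "'a::euclidean_space set" and u v :: "'a \<Rightarrow> complex"
    and \<Psi> :: "complex \<Rightarrow> complex \<Rightarrow> 'a" and H :: "(int \<times> int) set"
  assumes compact_K: "compact K"
    and cont_u: "continuous_on K u" and cont_v: "continuous_on K v"
    and finite_fibre: "finite {x \<in> K. u x = y \<and> v x = z}"
    and dense: "K \<subseteq> closure {x \<in> K. u x \<noteq> 0 \<and> v x \<noteq> 0}"
    and Psi_cont: "continuous_on (closed_lhp \<times> closed_lhp) (\<lambda>(s, t). \<Psi> s t)"
    and Psi_K: "Re s \<le> 0 \<Longrightarrow> Re t \<le> 0 \<Longrightarrow> \<Psi> s t \<in> K"
    and u_Psi: "Re s \<le> 0 \<Longrightarrow> Re t \<le> 0 \<Longrightarrow> u (\<Psi> s t) = exp s"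
    and v_Psi: "Re s \<le> 0 \<Longrightarrow> Re t \<le> 0 \<Longrightarrow> v (\<Psi> s t) = exp t"
    and Psi_surj: "x \<in> K \<Longrightarrow> u x \<noteq> 0 \<Longrightarrow> v x \<noteq> 0 \<Longrightarrow> \<exists>s t. Re s \<le> 0 \<and> Re t \<le> 0 \<and> \<Psi> s t = x"
    and Psi_eq: "Re s \<le> 0 \<Longrightarrow> Re t \<le> 0 \<Longrightarrow> Re s' \<le> 0 \<Longrightarrow> Re t' \<le> 0 \<Longrightarrow>
      \<Psi> s t = \<Psi> s' t' \<longleftrightarrow> (\<exists>j k. (j, k) \<in> H \<and> s' = s + period j \<and> t' = t + period k)"
    and loop_H: "path \<gamma> \<Longrightarrow> pathfinish \<gamma> = pathstart \<gamma> \<Longrightarrow>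
      path_image \<gamma> \<subseteq> {x \<in> K. u x \<noteq> 0 \<and> v x \<noteq> 0} \<Longrightarrow>
      \<exists>j k. (j, k) \<in> H \<and> winding_number (u \<circ> \<gamma>) 0 = of_int j \<and> winding_number (v \<circ> \<gamma>) 0 = of_int k"

lemma mem_swap_image [simp]: "(j, k) \<in> prod.swap ` H \<longleftrightarrow> (k, j) \<in> H"
  by force

text \<open>By this symmetry only the axis \<open>v = 0\<close> has to be studied; the other one is
  the same axis of the swapped cover.\<close>

lemma bidisc_cover_swap:
  assumes "bidisc_cover K u v \<Psi> H"
  shows "bidisc_cover K v u (\<lambda>t s. \<Psi> s t) (prod.swap ` H)"
proof -
  interpret bidisc_cover K u v \<Psi> H by fact
  show ?thesis
  proof
    show "finite {x \<in> K. v x = y \<and> u x = z}" for y z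
      using finite_fibre[of z y] by (simp add: conj_commute)
    show "K \<subseteq> closure {x \<in> K. v x \<noteq> 0 \<and> u x \<noteq> 0}"
      using dense by (simp add: conj_commute)
    show "continuous_on (closed_lhp \<times> closed_lhp) (\<lambda>(t, s). \<Psi> s t)"
      using continuous_on_compose[OF continuous_on_swap[of "closed_lhp \<times> closed_lhp"], of "\<lambda>(s, t). \<Psi> s t"]
        Psi_cont by (simp add: o_def case_prod_unfold product_swap)
    show "\<exists>s t. Re s \<le> 0 \<and> Re t \<le> 0 \<and> \<Psi> t s = x" if "x \<in> K" "v x \<noteq> 0" "u x \<noteq> 0" for x
      using Psi_surj that by blast
    show "\<Psi> t s = \<Psi> t' s' \<longleftrightarrow> (\<exists>j k. (j, k) \<in> prod.swap ` H \<and> s' = s + period j \<and> t' = t + period k)"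
      if "Re s \<le> 0" "Re t \<le> 0" "Re s' \<le> 0" "Re t' \<le> 0" for s t s' t'
      using that by (subst Psi_eq) auto
    show "\<exists>j k. (j, k) \<in> prod.swap ` H \<and> winding_number (v \<circ> \<gamma>) 0 = of_int j \<and> winding_number (u \<circ> \<gamma>) 0 = of_int k"
      if "path \<gamma>" "pathfinish \<gamma> = pathstart \<gamma>" "path_image \<gamma> \<subseteq> {x \<in> K. v x \<noteq> 0 \<and> u x \<noteq> 0}" for \<gamma>
      using loop_H[OF that(1,2)] that(3) by (auto simp: conj_commute)
  qed (use compact_K cont_u cont_v Psi_K u_Psi v_Psi in auto)
qed

lemma image_exp_closed_lhp: "exp ` closed_lhp = cball 0 1 - {0}"
proof
  show "cball 0 1 - {0} \<subseteq> exp ` closed_lhp"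
  proof
    fix w :: complex assume "w \<in> cball 0 1 - {0}"
    then have "w = exp (Ln w)" "Re (Ln w) \<le> 0"
      by (auto simp: exp_Ln ln_le_zero_iff)
    then show "w \<in> exp ` closed_lhp" by blast
  qed
qed (auto simp: norm_exp_eq_Re)

text \<open>\<open>\<Psi>\<close> is a lift of the product of two exponentials through the covering.
  It is onto because the covering is connected: each of its points can be pushed radially to the
  torus over \<open>\<S> \<times> \<S>\<close>, and that torus is path connected by
  assumption.\<close>

proposition bidisc_cover_exists:
  fixes K :: "'a::euclidean_space set" and u v :: "'a \<Rightarrow> complex"
  defines "C \<equiv> {x \<in> K. u x \<noteq> 0 \<and> v x \<noteq> 0}"
  assumes K: "compact K"
    and cont: "continuous_on K u" "continuous_on K v"
    and le1: "\<And>x. x \<in> K \<Longrightarrow> norm (u x) \<le> 1 \<and> norm (v x) \<le> 1"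
    and fin: "\<And>y z. finite {x \<in> K. u x = y \<and> v x = z}"
    and dense: "K \<subseteq> closure C"
    and loc: "\<And>x. x \<in> C \<Longrightarrow> \<exists>U V g. x \<in> U \<and> openin (top_of_set C) U \<and>
       openin (top_of_set ((cball 0 1 - {0}) \<times> (cball 0 1 - {0}))) V \<and>
       homeomorphism U V (\<lambda>x. (u x, v x)) g"
    and torus: "path_connected {x \<in> K. norm (u x) = 1 \<and> norm (v x) = 1}"
      "{x \<in> K. norm (u x) = 1 \<and> norm (v x) = 1} \<noteq> {}"
  obtains \<Psi> H where "bidisc_cover K u v \<Psi> H"
proof -
  define S :: "(complex \<times> complex) set" where "S = (cball 0 1 - {0}) \<times> (cball 0 1 - {0})"
  define f where "f x = (u x, v x)" for x
  define E :: "complex \<times> complex \<Rightarrow> complex \<times> complex" where "E = (\<lambda>(s, t). (exp s, exp t))"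
  define L where "L = closed_lhp \<times> closed_lhp"
  have contE: "continuous_on A E" for A
    unfolding E_def case_prod_unfold by (intro continuous_intros)
  have EL: "E ` L = S"
    unfolding E_def L_def S_def by (simp only: image_paired_Times image_exp_closed_lhp)
  have convL: "convex L"
    unfolding L_def by (intro convex_Times convex_closed_lhp)
  have contf: "continuous_on K f"
    unfolding f_def using cont by (intro continuous_intros)
  have cov: "covering_space C f S"
  proof (rule covering_space_proper_local_homeomorphism[OF K contf])
    show "C = K \<inter> f -` S"
      using le1 unfolding C_def f_def S_def by auto
    show "connected S"
      using EL contE convL convex_connected connected_continuous_image by metis
    show "C \<noteq> {}" using torus(2) unfolding C_def by auto
    show "finite {x \<in> K. f x = y}" for y
      using fin[of "fst y" "snd y"] by (simp add: f_def prod_eq_iff)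
    show "\<exists>U V g. x \<in> U \<and> openin (top_of_set C) U \<and> openin (top_of_set S) V \<and> homeomorphism U V f g"
      if "x \<in> C" for x
      using loc[OF that] unfolding S_def f_def .
  qed
  obtain P where P: "continuous_on L P" "P \<in> L \<rightarrow> C" "\<And>y. y \<in> L \<Longrightarrow> f (P y) = E y"
  proof (rule covering_space_lift[OF cov, of L E])
    show "simply_connected L" "locally path_connected L"
      using convL convex_imp_simply_connected convex_imp_locally_path_connected by blast+
  qed (use EL contE in auto)
  define \<Psi> where "\<Psi> s t = P (s, t)" for s t
  define H where "H = {(j, k). P (period j, period k) = P (0, 0)}"
  \<comment> \<open>Both sides lift the same map \<open>E\<close>, so they agree everywhere once
    they agree at one point. Hence \<open>H\<close>, defined at the base point, describes the
    identifications at all points.\<close>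
  have trans: "P (s + period j, t + period k) = P (s, t)"
    if "P (s0 + period j, t0 + period k) = P (s0, t0)" "(s0, t0) \<in> L" "(s, t) \<in> L" for s t s0 t0 j k
  proof -
    let ?T = "\<lambda>z. z + (period j, period k)"
    have TL: "?T z \<in> L" if "z \<in> L" for z using that by (auto simp: L_def)
    have "(P \<circ> ?T) (s, t) = P (s, t)"
    proof (rule covering_space_lift_unique[OF cov, of _ "(s0, t0)" _ L E])
      show "continuous_on L (P \<circ> ?T)"
        by (intro continuous_on_compose continuous_intros continuous_on_subset[OF P(1)]) (use TL in auto)
      show "(P \<circ> ?T) \<in> L \<rightarrow> C" using TL P by auto
      show "E x = f ((P \<circ> ?T) x)" if "x \<in> L" for x
        using TL[OF that] P(3) by (cases x) (auto simp: E_def)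
    qed (use that contE EL P convL convex_connected in \<open>auto simp: add_ac\<close>)
    then show ?thesis by simp
  qed
  \<comment> \<open>A path in the covering is \<open>P\<close> applied to continuous logarithms of
    its two coordinates; uniqueness of lifts compares the two.\<close>
  have lift: "\<exists>s t. path s \<and> path t \<and> s 0 = s0 \<and> t 0 = t0 \<and>
      (\<forall>x\<in>{0..1}. Re (s x) \<le> 0 \<and> Re (t x) \<le> 0 \<and> P (s x, t x) = \<gamma> x)"
    if g: "path \<gamma>" "path_image \<gamma> \<subseteq> C" and st: "(s0, t0) \<in> L" "P (s0, t0) = \<gamma> 0" for \<gamma> s0 t0
  proof -
    have gC: "\<gamma> x \<in> C" if "x \<in> {0..1}" for x using g that by (auto simp: path_image_def)
    have f0: "f (\<gamma> 0) = E (s0, t0)" using P(3)[OF st(1)] st(2) by simp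
    have pu: "path (u \<circ> \<gamma>)" "path (v \<circ> \<gamma>)"
      using g cont by (auto intro!: path_continuous_image continuous_on_subset[of K] simp: C_def)
    obtain s where s: "path s" "s 0 = s0" "\<And>x. x \<in> {0..1} \<Longrightarrow> exp (s x) = (u \<circ> \<gamma>) x"
    proof (rule covering_space_lift_path_strong[OF covering_space_exp_punctured_plane, of s0 "u \<circ> \<gamma>"])
      show "path_image (u \<circ> \<gamma>) \<subseteq> - {0}" using gC by (auto simp: path_image_def C_def)
    qed (use pu f0 in \<open>auto simp: pathstart_def f_def E_def\<close>)
    obtain t where t: "path t" "t 0 = t0" "\<And>x. x \<in> {0..1} \<Longrightarrow> exp (t x) = (v \<circ> \<gamma>) x"
    proof (rule covering_space_lift_path_strong[OF covering_space_exp_punctured_plane, of t0 "v \<circ> \<gamma>"])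
      show "path_image (v \<circ> \<gamma>) \<subseteq> - {0}" using gC by (auto simp: path_image_def C_def)
    qed (use pu f0 in \<open>auto simp: pathstart_def f_def E_def\<close>)
    have Re: "Re (s x) \<le> 0 \<and> Re (t x) \<le> 0" if "x \<in> {0..1}" for x
    proof -
      have "norm (exp (s x)) \<le> 1" "norm (exp (t x)) \<le> 1"
        using s(3) t(3) gC le1 that unfolding C_def by auto
      then show ?thesis by (simp add: norm_exp_eq_Re)
    qed
    have inL: "(s x, t x) \<in> L" if "x \<in> {0..1}" for x using Re[OF that] by (simp add: L_def)
    have "(P \<circ> (\<lambda>x. (s x, t x))) x = \<gamma> x" if "x \<in> {0..1}" for x
    proof (rule covering_space_lift_unique[OF cov, of _ 0 _ "{0..1::real}" "f \<circ> \<gamma>"])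
      show "continuous_on {0..1} (P \<circ> (\<lambda>x. (s x, t x)))"
        using s t inL by (intro continuous_on_compose continuous_intros continuous_on_subset[OF P(1)]) (auto simp: path_def)
      show "continuous_on {0..1} (f \<circ> \<gamma>)"
        using g gC contf by (intro continuous_on_compose continuous_on_subset[OF contf]) (auto simp: path_def C_def)
      show "P \<circ> (\<lambda>x. (s x, t x)) \<in> {0..1} \<rightarrow> C" using inL P(2) by auto
      show "(f \<circ> \<gamma>) x = f ((P \<circ> (\<lambda>x. (s x, t x))) x)" if "x \<in> {0..1}" for x
        using P(3)[OF inL[OF that]] s(3)[OF that] t(3)[OF that] by (simp add: E_def f_def)
      show "f \<circ> \<gamma> \<in> {0..1} \<rightarrow> S" using gC covering_space_imp_surjective[OF cov] by fastforce
    qed (use s t st g gC that in \<open>auto simp: path_def\<close>)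
    then show ?thesis using s t Re by (intro exI[of _ s] exI[of _ t]) auto
  qed
  have surj: "\<exists>s t. (s, t) \<in> L \<and> P (s, t) = x" if x: "x \<in> C" for x
  proof -
    have "f x \<in> E ` L" using EL x covering_space_imp_surjective[OF cov] by auto
    then obtain s t where st: "(s, t) \<in> L" "f x = E (s, t)" by force
    \<comment> \<open>The real parts shrink linearly to 0, so both coordinates move radially to
      modulus 1.\<close>
    let ?g = "\<lambda>r. E (s - of_real (r * Re s), t - of_real (r * Re t))"
    have rL: "(s - of_real (r * Re s), t - of_real (r * Re t)) \<in> L" if "r \<in> {0..1}" for r
    proof -
      have "(1 - r) * Re s \<le> 0" "(1 - r) * Re t \<le> 0"
        using st that by (auto simp: L_def mult_nonneg_nonpos)
      then show ?thesis by (simp add: L_def algebra_simps)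
    qed
    obtain h where h: "path h" "path_image h \<subseteq> C" "pathstart h = x" "\<And>r. r \<in> {0..1} \<Longrightarrow> f (h r) = ?g r"
    proof (rule covering_space_lift_path_strong[OF cov x, of ?g])
      show "path ?g"
        unfolding path_def E_def case_prod_conv by (intro continuous_intros)
      show "path_image ?g \<subseteq> S"
        using rL EL unfolding path_image_def by blast
      show "pathstart ?g = f x" by (simp add: pathstart_def st)
    qed (blast intro: that)
    have tor: "{x \<in> K. norm (u x) = 1 \<and> norm (v x) = 1} \<subseteq> C" by (auto simp: C_def)
    have "f (h 1) = ?g 1" using h(4) by simp
    then have "norm (u (h 1)) = 1" "norm (v (h 1)) = 1"
      by (auto simp: f_def E_def norm_exp_eq_Re)
    moreover have "h 1 \<in> C" using h by (auto simp: path_image_def)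
    ultimately have h1: "h 1 \<in> {x \<in> K. norm (u x) = 1 \<and> norm (v x) = 1}" by (simp add: C_def)
    have "f (P (0, 0)) = E (0, 0)" "P (0, 0) \<in> C" using P by (auto simp: L_def)
    then have p0: "P (0, 0) \<in> {x \<in> K. norm (u x) = 1 \<and> norm (v x) = 1}"
      by (simp add: f_def E_def C_def)
    obtain k where k: "path k" "path_image k \<subseteq> {x \<in> K. norm (u x) = 1 \<and> norm (v x) = 1}"
        "pathstart k = P (0, 0)" "pathfinish k = h 1"
      using torus(1) h1 p0 unfolding path_connected_def by blast
    \<comment> \<open>From the base point through the torus and back along the radial path: the
      logarithms of this path end at a preimage of \<open>x\<close>.\<close>
    let ?w = "k +++ reversepath h"
    have w: "path ?w" "path_image ?w \<subseteq> C" "pathstart ?w = P (0, 0)" "pathfinish ?w = x"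
      using k h tor by (auto simp: path_image_join pathfinish_def[of h])
    then have "P (0, 0) = ?w 0" by (simp add: pathstart_def)
    then obtain s' t' where "\<forall>x\<in>{0..1}. Re (s' x) \<le> 0 \<and> Re (t' x) \<le> 0 \<and> P (s' x, t' x) = ?w x"
      using lift[OF w(1,2), of 0 0] by (auto simp: L_def)
    then have "(s' 1, t' 1) \<in> L \<and> P (s' 1, t' 1) = x"
      using w(4) by (auto simp: L_def pathfinish_def)
    then show ?thesis by blast
  qed
  have "bidisc_cover K u v \<Psi> H"
  proof
    show "compact K" "continuous_on K u" "continuous_on K v" "finite {x \<in> K. u x = y \<and> v x = z}" for y z
      using K cont fin by auto
    show "K \<subseteq> closure {x \<in> K. u x \<noteq> 0 \<and> v x \<noteq> 0}" using dense C_def by simp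
    show "continuous_on (closed_lhp \<times> closed_lhp) (\<lambda>(s, t). \<Psi> s t)"
      using P(1) by (simp add: \<Psi>_def L_def case_prod_unfold)
    show "\<Psi> s t \<in> K" "u (\<Psi> s t) = exp s" "v (\<Psi> s t) = exp t" if "Re s \<le> 0" "Re t \<le> 0" for s t
    proof -
      have "(s, t) \<in> L" using that by (simp add: L_def)
      then have "P (s, t) \<in> C" "f (P (s, t)) = E (s, t)" using P by auto
      then show "\<Psi> s t \<in> K" "u (\<Psi> s t) = exp s" "v (\<Psi> s t) = exp t"
        by (auto simp: \<Psi>_def C_def f_def E_def)
    qed
    show "\<exists>s t. Re s \<le> 0 \<and> Re t \<le> 0 \<and> \<Psi> s t = x" if "x \<in> K" "u x \<noteq> 0" "v x \<noteq> 0" for x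
      using surj[of x] that by (auto simp: C_def L_def \<Psi>_def)
    show "\<Psi> s t = \<Psi> s' t' \<longleftrightarrow> (\<exists>j k. (j, k) \<in> H \<and> s' = s + period j \<and> t' = t + period k)"
      if "Re s \<le> 0" "Re t \<le> 0" "Re s' \<le> 0" "Re t' \<le> 0" for s t s' t'
    proof
      have L: "(s, t) \<in> L" "(s', t') \<in> L" "(0, 0) \<in> L" using that by (auto simp: L_def)
      assume eq: "\<Psi> s t = \<Psi> s' t'"
      then have "E (s, t) = E (s', t')" using P(3) L by (metis \<Psi>_def)
      then obtain j k where jk: "s' = s + period j" "t' = t + period k"
        unfolding E_def using exp_eq_period by (metis case_prod_conv prod.inject)
      then have "P (period j, period k) = P (0, 0)"
        using trans[of s j t k 0 0] L eq by (simp add: \<Psi>_def)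
      then show "\<exists>j k. (j, k) \<in> H \<and> s' = s + period j \<and> t' = t + period k"
        using jk by (auto simp: H_def)
    next
      assume "\<exists>j k. (j, k) \<in> H \<and> s' = s + period j \<and> t' = t + period k"
      then show "\<Psi> s t = \<Psi> s' t'"
        using trans[of 0 _ 0 _ s t] that by (auto simp: \<Psi>_def L_def H_def)
    qed
    show "\<exists>j k. (j, k) \<in> H \<and> winding_number (u \<circ> \<gamma>) 0 = of_int j \<and> winding_number (v \<circ> \<gamma>) 0 = of_int k"
      if g: "path \<gamma>" "pathfinish \<gamma> = pathstart \<gamma>" "path_image \<gamma> \<subseteq> {x \<in> K. u x \<noteq> 0 \<and> v x \<noteq> 0}" for \<gamma>
    proof -
      have gC: "path_image \<gamma> \<subseteq> C" using g by (simp add: C_def)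
      then have "\<gamma> 0 \<in> C" by (auto simp: path_image_def)
      then obtain s0 t0 where "(s0, t0) \<in> L" "P (s0, t0) = \<gamma> 0" using surj by blast
      then obtain s t where st: "path s" "path t" "\<forall>x\<in>{0..1}. Re (s x) \<le> 0 \<and> Re (t x) \<le> 0 \<and> P (s x, t x) = \<gamma> x"
        using lift[OF g(1) gC] by blast
      have uv: "(u \<circ> \<gamma>) x = exp (s x)" "(v \<circ> \<gamma>) x = exp (t x)" if "x \<in> {0..1}" for x
      proof -
        have "(s x, t x) \<in> L" "P (s x, t x) = \<gamma> x" using st(3) that by (auto simp: L_def)
        then have "f (\<gamma> x) = E (s x, t x)" using P(3) by metis
        then show "(u \<circ> \<gamma>) x = exp (s x)" "(v \<circ> \<gamma>) x = exp (t x)" by (auto simp: f_def E_def)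
      qed
      have "\<gamma> 0 = \<gamma> 1" using g by (simp add: pathfinish_def pathstart_def)
      then have "exp (s 1) = exp (s 0)" "exp (t 1) = exp (t 0)"
        using uv[of 0] uv[of 1] by auto
      then obtain j k where jk: "s 1 = s 0 + period j" "t 1 = t 0 + period k"
        unfolding exp_eq_period by blast
      have "P (s 0 + period j, t 0 + period k) = P (s 0, t 0)"
      proof -
        have "P (s 1, t 1) = \<gamma> 1" "P (s 0, t 0) = \<gamma> 0" using st(3) by auto
        then show ?thesis using jk \<open>\<gamma> 0 = \<gamma> 1\<close> by simp
      qed
      moreover have "(s 0, t 0) \<in> L" "(0, 0) \<in> L" using st(3) by (auto simp: L_def)
      ultimately have "P (period j, period k) = P (0, 0)"
        using trans[of "s 0" j "t 0" k 0 0] by simp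
      then have "(j, k) \<in> H" by (simp add: H_def)
      then show ?thesis
        using winding_number_exp_path[OF st(1) uv(1) jk(1)] winding_number_exp_path[OF st(2) uv(2) jk(2)] by blast
    qed
  qed
  then show ?thesis using that by blast
qed

section \<open>Logarithms of convergent sequences\<close>

lemma compact_subseqE:
  fixes f :: "nat \<Rightarrow> 'a::metric_space"
  assumes "compact S" "\<And>n. f n \<in> S"
  obtains l r where "l \<in> S" "strict_mono r" "(\<lambda>n. f (r n)) \<longlonglongrightarrow> l"
  using assms unfolding compact_def o_def by blast

text \<open>Convergence of \<open>exp (s n)\<close> to a nonzero limit bounds the real parts of
  \<open>s n\<close> but not the imaginary ones. These are corrected by multiples of
  \<open>period m\<close> only, because in the applications \<open>m\<close> is a period of the
  covering and such corrections do not move the point.\<close>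

lemma exp_tendsto_nonzero_subseq:
  assumes lim: "(\<lambda>n::nat. exp (s n)) \<longlonglongrightarrow> w" and "w \<noteq> 0" and m: "(m::int) > 0"
  obtains r l s0 where "strict_mono r" "(\<lambda>n. s (r n) + period (m * l n)) \<longlonglongrightarrow> s0" "exp s0 = w"
proof -
  \<comment> \<open>The floor brings the imaginary part into the interval from 0 to
    \<open>2 * pi * m\<close>.\<close>
  define l :: "nat \<Rightarrow> int" where "l n = - \<lfloor>Im (s n) / (2 * pi * m)\<rfloor>" for n
  define z where "z n = s n + period (m * l n)" for n
  have Imz: "\<bar>Im (z n)\<bar> \<le> 2 * pi * m" for n
  proof -
    define q where "q = Im (s n) / (2 * pi * m)"
    have "Im (s n) = q * (2 * pi * m)" using m by (simp add: q_def)
    then have "Im (z n) = (q - of_int \<lfloor>q\<rfloor>) * (2 * pi * m)"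
      by (simp add: z_def l_def Im_period q_def[symmetric] algebra_simps)
    moreover have "0 \<le> q - of_int \<lfloor>q\<rfloor>" "q - of_int \<lfloor>q\<rfloor> \<le> 1" by linarith+
    ultimately show ?thesis
      using m by (simp add: abs_mult mult_left_le_one_le)
  qed
  have expz: "exp (z n) = exp (s n)" for n by (simp add: z_def)
  have "(\<lambda>n. norm (exp (z n))) \<longlonglongrightarrow> norm w"
    using tendsto_norm[OF lim] by (simp add: expz)
  then have "(\<lambda>n. ln (norm (exp (z n)))) \<longlonglongrightarrow> ln (norm w)"
    using \<open>w \<noteq> 0\<close> by (intro tendsto_ln) auto
  then have "(\<lambda>n. Re (z n)) \<longlonglongrightarrow> ln (norm w)" by (simp add: norm_exp_eq_Re)
  then have "Bseq (\<lambda>n. Re (z n))" by (rule convergentI[THEN convergent_imp_Bseq])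
  then obtain B where B: "\<And>n. \<bar>Re (z n)\<bar> \<le> B" by (metis BseqE real_norm_def)
  have "norm (z n) \<le> B + 2 * pi * m" for n
    using cmod_le[of "z n"] B[of n] Imz[of n] by linarith
  then have "z n \<in> cball 0 (B + 2 * pi * m)" for n by simp
  then obtain s0 r where r: "strict_mono r" "(z \<circ> r) \<longlonglongrightarrow> s0"
    using compact_subseqE[OF compact_cball, of z] unfolding o_def by blast
  have "(\<lambda>n. exp ((z \<circ> r) n)) \<longlonglongrightarrow> exp s0" using r(2) by (rule tendsto_exp)
  moreover have "(\<lambda>n. exp ((z \<circ> r) n)) \<longlonglongrightarrow> w"
    using LIMSEQ_subseq_LIMSEQ[OF lim r(1)] by (simp add: o_def expz)
  ultimately have "exp s0 = w" by (rule LIMSEQ_unique)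
  then show ?thesis
    using that[of r "l \<circ> r" s0] r by (simp add: o_def z_def)
qed

lemma filterlim_Re_at_bot_of_exp_tendsto_0:
  assumes "((\<lambda>n. exp (t n)) \<longlongrightarrow> (0::complex)) F"
  shows "filterlim (\<lambda>n. Re (t n)) at_bot F"
proof -
  have "((\<lambda>n. exp (Re (t n))) \<longlongrightarrow> 0) F"
    using tendsto_norm[OF assms] by (simp add: norm_exp_eq_Re)
  then have "filterlim (\<lambda>n. exp (Re (t n))) (at_right 0) F"
    unfolding filterlim_at by (simp add: always_eventually)
  then have "filterlim (\<lambda>n. ln (exp (Re (t n)))) at_bot F"
    by (rule filterlim_compose[OF ln_at_0])
  then show ?thesis by simp
qed

lemma Re_limit_le_0:
  assumes "s \<longlonglongrightarrow> s0" "\<And>n::nat. Re (s n) \<le> 0"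
  shows "Re s0 \<le> 0"
  using assms(2) by (intro tendsto_upperbound[OF tendsto_Re[OF assms(1)]]) auto

section \<open>The group of deck translations and limits of sheets\<close>

context bidisc_cover
begin

lemma H_iff: "(j, k) \<in> H \<longleftrightarrow> \<Psi> 0 0 = \<Psi> (period j) (period k)"
  using Psi_eq[of 0 0 "period j" "period k"] by simp

lemma H_zero: "(0, 0) \<in> H"
  by (simp add: H_iff)

lemma H_add:
  assumes "(j, k) \<in> H" "(j', k') \<in> H"
  shows "(j + j', k + k') \<in> H"
proof -
  have "\<Psi> (period j) (period k) = \<Psi> (period (j + j')) (period (k + k'))"
    using assms(2) by (subst Psi_eq) (auto simp: period_add)
  then show ?thesis using assms(1) by (simp add: H_iff)
qed

lemma H_uminus:
  assumes "(j, k) \<in> H"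
  shows "(- j, - k) \<in> H"
proof -
  have "\<Psi> (period (- j)) (period (- k)) = \<Psi> 0 0"
    using assms by (subst Psi_eq) (auto simp: period_uminus intro!: exI[of _ j] exI[of _ k])
  then show ?thesis by (simp add: H_iff)
qed

lemma H_mult: "(j, k) \<in> H \<Longrightarrow> (l * j, l * k) \<in> H"
proof -
  assume jk: "(j, k) \<in> H"
  have n: "(int n * j, int n * k) \<in> H" for n
  proof (induction n)
    case (Suc n)
    then show ?case using H_add[OF jk Suc] by (simp add: algebra_simps)
  qed (use H_zero in auto)
  show ?thesis
    using n[of "nat l"] H_uminus[OF n[of "nat (- l)"]] by (cases "l \<ge> 0") auto
qed

lemma Psi_shift:
  "Re s \<le> 0 \<Longrightarrow> Re t \<le> 0 \<Longrightarrow> (j, k) \<in> H \<Longrightarrow> \<Psi> (s + period j) (t + period k) = \<Psi> s t"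
  using Psi_eq[of s t "s + period j" "t + period k"] by simp

lemma Psi_tendsto:
  assumes "s \<longlonglongrightarrow> s0" "t \<longlonglongrightarrow> t0" "\<And>n. Re (s n) \<le> 0" "\<And>n. Re (t n) \<le> 0"
  shows "(\<lambda>n. \<Psi> (s n) (t n)) \<longlonglongrightarrow> \<Psi> s0 t0" "Re s0 \<le> 0" "Re t0 \<le> 0"
proof -
  show Re: "Re s0 \<le> 0" "Re t0 \<le> 0"
    using Re_limit_le_0[OF assms(1,3)] Re_limit_le_0[OF assms(2,4)] by auto
  have "(\<lambda>n. (\<lambda>(s, t). \<Psi> s t) (s n, t n)) \<longlonglongrightarrow> (\<lambda>(s, t). \<Psi> s t) (s0, t0)"
    using assms Re by (intro continuous_on_tendsto_compose[OF Psi_cont] tendsto_Pair) auto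
  then show "(\<lambda>n. \<Psi> (s n) (t n)) \<longlonglongrightarrow> \<Psi> s0 t0" by simp
qed

lemma K_limit:
  assumes "y \<longlonglongrightarrow> x" "\<And>n. y n \<in> K"
  shows "x \<in> K" "(\<lambda>n. u (y n)) \<longlonglongrightarrow> u x" "(\<lambda>n. v (y n)) \<longlonglongrightarrow> v x"
proof -
  show x: "x \<in> K"
    using assms closed_sequentially[OF compact_imp_closed[OF compact_K]] by blast
  show "(\<lambda>n. u (y n)) \<longlonglongrightarrow> u x"
    using assms x by (intro continuous_on_tendsto_compose[OF cont_u]) auto
  show "(\<lambda>n. v (y n)) \<longlonglongrightarrow> v x"
    using assms x by (intro continuous_on_tendsto_compose[OF cont_v]) auto
qed

text \<open>Pigeonhole: the points \<open>\<Psi> (period j) 0\<close> for natural numbers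
  \<open>j\<close> all lie in the finite fibre over (1, 1), and the difference of two colliding
  indices is a period.\<close>

lemma ex_H_first: "\<exists>m>0. (m, 0) \<in> H"
proof -
  let ?g = "\<lambda>j::nat. \<Psi> (period (int j)) 0"
  have "range ?g \<subseteq> {x \<in> K. u x = 1 \<and> v x = 1}"
    using Psi_K u_Psi v_Psi by auto
  then have "finite (range ?g)" using finite_fibre finite_subset by blast
  then have "\<not> inj ?g" using finite_imageD by blast
  then obtain i j where "i \<noteq> j" "?g i = ?g j" by (auto simp: inj_def)
  then obtain i j where ij: "i < j" "?g i = ?g j" by (metis linorder_neqE_nat)
  then obtain j' k' where H: "(j', k') \<in> H" "period (int j) = period (int i) + period j'" "0 = 0 + period k'"
    using Psi_eq[of "period (int i)" 0 "period (int j)" 0] by (metis Re_period order_refl zero_complex.simps(1))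
  then have "k' = 0" by (metis add.left_neutral period_0 period_inject)
  moreover have "j' = int j - int i"
    using H(2) by (metis add_diff_cancel_left' period_diff period_inject)
  ultimately show ?thesis using H ij by (intro exI[of _ j']) auto
qed

text \<open>As \<open>Re t'\<close> tends to minus infinity and \<open>s'\<close> to
  \<open>s\<close>, every accumulation point of \<open>\<Psi> s' t'\<close> lies in the finite fibre
  over \<open>(exp s, 0)\<close>. The parameter region is convex, so its image is connected and
  cannot visit two of the disjoint balls about the fibre; hence one point of the fibre attracts all
  of it.\<close>

lemma center_exists:
  assumes s: "Re s \<le> 0"
  shows "\<exists>c\<in>{x \<in> K. u x = exp s \<and> v x = 0}. \<forall>e>0. \<exists>d>0. \<exists>M. \<forall>s' t'.
     Re s' \<le> 0 \<and> Re t' \<le> 0 \<and> dist s' s < d \<and> Re t' < M \<longrightarrow> dist (\<Psi> s' t') c < e"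
proof -
  define F where "F = {x \<in> K. u x = exp s \<and> v x = 0}"
  define N where "N d M = ({s'. Re s' \<le> 0} \<inter> ball s d) \<times> ({t'. Re t' \<le> 0} \<inter> {t'. Re t' < M})" for d M
  have N_iff: "(s', t') \<in> N d M \<longleftrightarrow> Re s' \<le> 0 \<and> Re t' \<le> 0 \<and> dist s' s < d \<and> Re t' < M" for s' t' d M
    by (auto simp: N_def dist_commute)
  have near: "\<exists>d>0. \<exists>M. \<forall>(s', t')\<in>N d M. \<exists>c\<in>F. dist (\<Psi> s' t') c < e" if "e > 0" for e
  proof (rule ccontr)
    assume neg: "\<not> ?thesis"
    have "\<exists>s' t'. (s', t') \<in> N (inverse (Suc n)) (- real n) \<and> (\<forall>c\<in>F. \<not> dist (\<Psi> s' t') c < e)" for n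
      using neg by (metis (mono_tags, lifting) case_prodI2 inverse_positive_iff_positive of_nat_0_less_iff zero_less_Suc)
    then obtain s' t' where st: "\<And>n. (s' n, t' n) \<in> N (inverse (Suc n)) (- real n)"
      "\<And>n c. c \<in> F \<Longrightarrow> \<not> dist (\<Psi> (s' n) (t' n)) c < e" by metis
    have Re: "Re (s' n) \<le> 0" "Re (t' n) \<le> 0" for n using st(1)[of n] by (auto simp: N_iff)
    have "(\<lambda>n. dist (s' n) s) \<longlonglongrightarrow> 0"
      by (rule tendsto_sandwich[OF _ _ tendsto_const LIMSEQ_inverse_real_of_nat])
         (use st(1) in \<open>auto simp: N_iff less_imp_le intro!: always_eventually\<close>)
    then have s': "s' \<longlonglongrightarrow> s" by (rule tendsto_dist_iff[THEN iffD2])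
    have "Re (t' n) < - real n" for n using st(1)[of n] unfolding N_iff by blast
    then have le: "exp (Re (t' n)) \<le> exp (- real n)" for n by (simp add: less_imp_le)
    have "(\<lambda>n. exp (- real n)) \<longlonglongrightarrow> 0" by real_asymp
    then have t': "(\<lambda>n. exp (t' n)) \<longlonglongrightarrow> 0"
      by (rule Lim_null_comparison[rotated]) (intro always_eventually allI, simp only: norm_exp_eq_Re le)
    have PK: "\<Psi> (s' n) (t' n) \<in> K" for n using Psi_K Re by auto
    then obtain r x where r: "strict_mono r" "(\<lambda>n. \<Psi> (s' (r n)) (t' (r n))) \<longlonglongrightarrow> x"
      using compact_subseqE[OF compact_K, of "\<lambda>n. \<Psi> (s' n) (t' n)", OF PK] by blast
    have lim: "x \<in> K" "(\<lambda>n. exp (s' (r n))) \<longlonglongrightarrow> u x" "(\<lambda>n. exp (t' (r n))) \<longlonglongrightarrow> v x"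
      using K_limit[OF r(2)] PK Re by (auto simp: u_Psi v_Psi)
    have "(\<lambda>n. exp (s' (r n))) \<longlonglongrightarrow> exp s" "(\<lambda>n. exp (t' (r n))) \<longlonglongrightarrow> 0"
      using LIMSEQ_subseq_LIMSEQ[OF tendsto_exp[OF s'] r(1)] LIMSEQ_subseq_LIMSEQ[OF t' r(1)]
      by (simp_all add: o_def)
    with lim have "x \<in> F" unfolding F_def using LIMSEQ_unique by blast
    moreover have "\<exists>n. dist (\<Psi> (s' (r n)) (t' (r n))) x < e"
      using r(2) \<open>e > 0\<close> unfolding lim_sequentially by auto
    ultimately show False using st(2) by blast
  qed
  obtain e0 where e0: "e0 > 0" "\<And>x y. x \<in> F \<Longrightarrow> y \<in> F \<Longrightarrow> x \<noteq> y \<Longrightarrow> disjnt (ball x e0) (ball y e0)"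
    using finite_set_separated[of F] finite_fibre unfolding F_def by blast
  obtain d0 M0 where d0: "d0 > 0" "\<And>s' t'. (s', t') \<in> N d0 M0 \<Longrightarrow> \<exists>c\<in>F. dist (\<Psi> s' t') c < e0"
    using near[OF e0(1)] by blast
  define P where "P = (\<lambda>(s, t). \<Psi> s t) ` N d0 M0"
  have "connected P"
    unfolding P_def
  proof (rule connected_continuous_image)
    show "continuous_on (N d0 M0) (\<lambda>(s, t). \<Psi> s t)"
      by (rule continuous_on_subset[OF Psi_cont]) (auto simp: N_def)
    show "connected (N d0 M0)"
      unfolding N_def
      by (intro convex_connected convex_Times convex_Int convex_ball convex_halfspace_Re_le convex_halfspace_Re_lt)
  qed
  \<comment> \<open>Any point of the parameter region would do; this one selects the ball, and
    thereby the candidate \<open>c\<close>.\<close>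
  have "(s, of_real (min 0 (M0 - 1))) \<in> N d0 M0" using s d0 by (auto simp: N_iff)
  then obtain c where c: "c \<in> F" "dist (\<Psi> s (of_real (min 0 (M0 - 1)))) c < e0" "\<Psi> s (of_real (min 0 (M0 - 1))) \<in> P"
    using d0(2) unfolding P_def by force
  have "P \<subseteq> ball c e0"
  proof (rule ccontr)
    assume "\<not> P \<subseteq> ball c e0"
    then obtain y where y: "y \<in> P" "y \<notin> ball c e0" by blast
    let ?B = "\<Union>x\<in>F - {c}. ball x e0"
    have cover: "P \<subseteq> ball c e0 \<union> ?B"
      using d0(2) unfolding P_def by (fastforce simp: dist_commute)
    have "ball c e0 \<inter> ?B \<inter> P = {}"
      using e0(2)[OF c(1)] unfolding disjnt_def by blast
    then have "ball c e0 \<inter> P = {} \<or> ?B \<inter> P = {}"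
      using connectedD[OF \<open>connected P\<close>, of "ball c e0" ?B] cover by auto
    moreover have "\<Psi> s (of_real (min 0 (M0 - 1))) \<in> ball c e0 \<inter> P"
      using c by (simp add: dist_commute)
    ultimately show False using y cover by blast
  qed
  then have "(\<lambda>(s, t). \<Psi> s t) z \<in> ball c e0" if "z \<in> N d0 M0" for z
    using imageI[OF that, of "\<lambda>(s, t). \<Psi> s t"] unfolding P_def by (rule subsetD)
  then have cP: "dist (\<Psi> s' t') c < e0" if "(s', t') \<in> N d0 M0" for s' t'
    using that by (metis case_prod_conv dist_commute mem_ball)
  show ?thesis
  proof (intro bexI[of _ c] allI impI)
    fix e :: real assume "e > 0"
    then obtain d M where d: "d > 0" "\<And>s' t'. (s', t') \<in> N d M \<Longrightarrow> \<exists>c\<in>F. dist (\<Psi> s' t') c < min e e0"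
      using near[of "min e e0"] e0(1) by fastforce
    have "dist (\<Psi> s' t') c < e"
      if "Re s' \<le> 0" "Re t' \<le> 0" "dist s' s < min d d0" "Re t' < min M M0" for s' t'
    proof -
      have "(s', t') \<in> N d M" "(s', t') \<in> N d0 M0" using that by (auto simp: N_iff)
      then obtain c' where c': "c' \<in> F" "dist (\<Psi> s' t') c' < min e e0" "dist (\<Psi> s' t') c < e0"
        using d(2) cP by blast
      then have "c' = c"
        using e0(2)[OF c'(1) c(1)] unfolding disjnt_iff mem_ball
        by (metis dist_commute min_less_iff_conj)
      then show ?thesis using c' by simp
    qed
    then show "\<exists>d>0. \<exists>M. \<forall>s' t'. Re s' \<le> 0 \<and> Re t' \<le> 0 \<and> dist s' s < d \<and> Re t' < M \<longrightarrow> dist (\<Psi> s' t') c < e"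
      using d(1) d0(1) by (intro exI[of _ "min d d0"] conjI exI[of _ "min M M0"]) auto
  qed (use c F_def in auto)
qed

definition center :: "complex \<Rightarrow> 'a" where
  "center s = (SOME c. c \<in> {x \<in> K. u x = exp s \<and> v x = 0} \<and> (\<forall>e>0. \<exists>d>0. \<exists>M. \<forall>s' t'.
     Re s' \<le> 0 \<and> Re t' \<le> 0 \<and> dist s' s < d \<and> Re t' < M \<longrightarrow> dist (\<Psi> s' t') c < e))"

lemma center_props:
  assumes "Re s \<le> 0"
  shows center_K: "center s \<in> K" and u_center: "u (center s) = exp s" and v_center: "v (center s) = 0"
    and center_near: "e > 0 \<Longrightarrow> \<exists>d>0. \<exists>M. \<forall>s' t'.
     Re s' \<le> 0 \<and> Re t' \<le> 0 \<and> dist s' s < d \<and> Re t' < M \<longrightarrow> dist (\<Psi> s' t') (center s) < e"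
  using someI_ex[OF center_exists[OF assms, unfolded Bex_def]] unfolding center_def[symmetric] by auto

lemma Psi_tendsto_center:
  assumes "Re s \<le> 0" "sq \<longlonglongrightarrow> s" "filterlim (\<lambda>n. Re (tq n)) at_bot sequentially"
    "\<And>n. Re (sq n) \<le> 0" "\<And>n. Re (tq n) \<le> 0"
  shows "(\<lambda>n. \<Psi> (sq n) (tq n)) \<longlonglongrightarrow> center s"
proof (rule tendstoI)
  fix e :: real assume "e > 0"
  then obtain d M where d: "d > 0" "\<And>s' t'. Re s' \<le> 0 \<Longrightarrow> Re t' \<le> 0 \<Longrightarrow> dist s' s < d \<Longrightarrow> Re t' < M
      \<Longrightarrow> dist (\<Psi> s' t') (center s) < e"
    using center_near[OF assms(1)] by metis
  have "eventually (\<lambda>n. dist (sq n) s < d) sequentially"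
    using assms(2) d(1) by (rule tendstoD)
  moreover have "eventually (\<lambda>n. Re (tq n) < M) sequentially"
    using assms(3) by (simp add: filterlim_at_bot_dense)
  ultimately show "eventually (\<lambda>n. dist (\<Psi> (sq n) (tq n)) (center s) < e) sequentially"
    by eventually_elim (use d assms in auto)
qed

lemma Psi_ray_tendsto_center:
  assumes "Re s \<le> 0"
  shows "(\<lambda>n. \<Psi> s (of_real (- real n))) \<longlonglongrightarrow> center s"
proof (rule Psi_tendsto_center[OF assms tendsto_const])
  show "filterlim (\<lambda>n. Re (of_real (- real n))) at_bot sequentially"
    unfolding Re_complex_of_real by real_asymp
qed (use assms in auto)

text \<open>The estimate for \<open>\<Psi> s' t'\<close> passes to the nearby centers along the rays
  \<open>t' = - n\<close>, at the price of a non-strict inequality. Both estimates share the same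
  \<open>d\<close>, as the arguments by sequences require.\<close>

lemma center_near_center:
  assumes s: "Re s \<le> 0" and "e > 0"
  shows "\<exists>d>0. \<exists>M. (\<forall>s' t'. Re s' \<le> 0 \<and> Re t' \<le> 0 \<and> dist s' s < d \<and> Re t' < M \<longrightarrow> dist (\<Psi> s' t') (center s) \<le> e)
    \<and> (\<forall>s'. Re s' \<le> 0 \<and> dist s' s < d \<longrightarrow> dist (center s') (center s) \<le> e)"
proof -
  obtain d M where d: "d > 0" "\<And>s' t'. Re s' \<le> 0 \<Longrightarrow> Re t' \<le> 0 \<Longrightarrow> dist s' s < d \<Longrightarrow> Re t' < M
      \<Longrightarrow> dist (\<Psi> s' t') (center s) < e"
    using center_near[OF s \<open>e > 0\<close>] by metis
  have "dist (center s') (center s) \<le> e" if s': "Re s' \<le> 0" "dist s' s < d" for s'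
  proof (subst dist_commute, rule Lim_dist_ubound[OF _ Psi_ray_tendsto_center[OF s'(1)]])
    have "eventually (\<lambda>n. - real n < M) sequentially" by real_asymp
    then show "\<forall>\<^sub>F n in sequentially. dist (center s) (\<Psi> s' (of_real (- real n))) \<le> e"
      by eventually_elim (use d(2)[of s'] s' in \<open>simp add: dist_commute less_imp_le\<close>)
  qed auto
  then show ?thesis using d by (meson less_imp_le)
qed

lemma center_tendsto:
  assumes "sq \<longlonglongrightarrow> s" "\<And>n. Re (sq n) \<le> 0"
  shows "(\<lambda>n. center (sq n)) \<longlonglongrightarrow> center s"
proof -
  have s: "Re s \<le> 0"
    using Re_limit_le_0[OF assms] .
  show ?thesis
  proof (rule tendstoI)
    fix e :: real assume "e > 0"
    then obtain d where d: "d > 0" "\<And>s'. Re s' \<le> 0 \<Longrightarrow> dist s' s < d \<Longrightarrow> dist (center s') (center s) \<le> e / 2"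
      using center_near_center[OF s, of "e / 2"] by (metis half_gt_zero)
    show "eventually (\<lambda>n. dist (center (sq n)) (center s) < e) sequentially"
      using tendstoD[OF assms(1) d(1)]
      by eventually_elim (use d(2)[OF assms(2)] \<open>e > 0\<close> in fastforce)
  qed
qed

lemma continuous_on_center: "continuous_on closed_lhp center"
  unfolding continuous_on_sequentially using center_tendsto by (auto simp: o_def)

text \<open>A shift of \<open>t\<close> by \<open>period k\<close> leaves its real part alone and
  disappears in the limit. For the axis \<open>v = 0\<close> only the first components of
  \<open>H\<close> therefore count.\<close>

lemma center_shift:
  assumes "Re s \<le> 0" "(j, k) \<in> H"
  shows "center (s + period j) = center s"
proof -
  have "(\<lambda>n. \<Psi> (s + period j) (of_real (- real n) + period k)) \<longlonglongrightarrow> center (s + period j)"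
  proof (rule Psi_tendsto_center)
    show "filterlim (\<lambda>n. Re (of_real (- real n) + period k)) at_bot sequentially"
      by simp real_asymp
  qed (use assms in auto)
  moreover have "\<Psi> (s + period j) (of_real (- real n) + period k) = \<Psi> s (of_real (- real n))" for n
    using assms by (intro Psi_shift) auto
  ultimately show ?thesis
    using Psi_ray_tendsto_center[OF assms(1)] LIMSEQ_unique by fastforce
qed

text \<open>\<open>over s y\<close>: the point \<open>y\<close> lies on the closed disc, transversal to \<open>v = 0\<close>, which is the closure
  of \<open>\<Psi> s ` closed_lhp\<close>.\<close>

definition over :: "complex \<Rightarrow> 'a \<Rightarrow> bool" where
  "over s y \<longleftrightarrow> Re s \<le> 0 \<and> ((\<exists>t. Re t \<le> 0 \<and> y = \<Psi> s t) \<or> y = center s)"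

lemma over_props:
  assumes "over s y"
  shows over_K: "y \<in> K" and over_u: "u y = exp s" and over_Re: "Re s \<le> 0"
  using assms Psi_K u_Psi center_K u_center by (auto simp: over_def)

lemma over_shift: "over s y \<Longrightarrow> (j, k) \<in> H \<Longrightarrow> over (s + period j) y"
  unfolding over_def using center_shift Psi_shift
  by (metis (no_types, lifting) Re_period add.right_neutral plus_complex.simps(1))

text \<open>If the limit lies on the axis, local uniformity of the centers identifies it. Otherwise
  the parameters \<open>t n\<close> are normalised by periods \<open>(0, m)\<close> of
  \<open>H\<close> and converge along a subsequence, so continuity of \<open>\<Psi>\<close>
  applies.\<close>

lemma over_closed:
  assumes over: "\<And>n. over (sq n) (yq n)" and s: "sq \<longlonglongrightarrow> s" and y: "yq \<longlonglongrightarrow> y"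
  shows "over s y"
proof -
  have Re: "Re (sq n) \<le> 0" for n using over over_Re by blast
  have Re0: "Re s \<le> 0"
    using Re_limit_le_0[OF s Re] .
  have lim: "y \<in> K" "(\<lambda>n. u (yq n)) \<longlonglongrightarrow> u y" "(\<lambda>n. v (yq n)) \<longlonglongrightarrow> v y"
    using K_limit[OF y] over over_K by auto
  show ?thesis
  proof (cases "v y = 0")
    case True
    have "yq \<longlonglongrightarrow> center s"
    proof (rule tendstoI)
      fix e :: real assume "e > 0"
      then obtain d M where d: "d > 0"
        "\<And>s' t'. Re s' \<le> 0 \<Longrightarrow> Re t' \<le> 0 \<Longrightarrow> dist s' s < d \<Longrightarrow> Re t' < M \<Longrightarrow> dist (\<Psi> s' t') (center s) \<le> e / 2"
        "\<And>s'. Re s' \<le> 0 \<Longrightarrow> dist s' s < d \<Longrightarrow> dist (center s') (center s) \<le> e / 2"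
        using center_near_center[OF Re0, of "e / 2"] by (metis half_gt_zero)
      have "eventually (\<lambda>n. norm (v (yq n)) < exp M) sequentially"
        using order_tendstoD(2)[OF tendsto_norm[OF lim(3)], of "exp M"] True by simp
      moreover have "eventually (\<lambda>n. dist (sq n) s < d) sequentially" using tendstoD[OF s d(1)] .
      ultimately show "eventually (\<lambda>n. dist (yq n) (center s) < e) sequentially"
      proof eventually_elim
        case (elim n)
        have "dist (yq n) (center s) \<le> e / 2"
          using over[of n] elim d v_Psi[OF Re[of n]] Re[of n] unfolding over_def by (auto simp: norm_exp_eq_Re)
        then show ?case using \<open>e > 0\<close> by simp
      qed
    qed
    then show ?thesis using y LIMSEQ_unique Re0 unfolding over_def by blast
  next
    case False
    have "eventually (\<lambda>n. v (yq n) \<noteq> 0) sequentially"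
      using tendsto_imp_eventually_ne[OF lim(3) False] .
    then obtain N where N: "\<And>n. n \<ge> N \<Longrightarrow> v (yq n) \<noteq> 0" unfolding eventually_sequentially by blast
    have "\<exists>t. Re t \<le> 0 \<and> yq (n + N) = \<Psi> (sq (n + N)) t" for n
      using over[of "n + N"] N[of "n + N"] v_center[OF Re] unfolding over_def by auto
    then obtain t where t: "\<And>n. Re (t n) \<le> 0" "\<And>n. yq (n + N) = \<Psi> (sq (n + N)) (t n)" by metis
    have "(\<lambda>n. v (yq (n + N))) \<longlonglongrightarrow> v y" using LIMSEQ_ignore_initial_segment[OF lim(3)] .
    then have "(\<lambda>n. exp (t n)) \<longlonglongrightarrow> v y" using t Re by (simp add: v_Psi)
    moreover obtain m where m: "m > 0" "(0, m) \<in> H"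
      using bidisc_cover.ex_H_first[OF bidisc_cover_swap[OF bidisc_cover_axioms]] by auto
    ultimately obtain r l t0 where r: "strict_mono r" "(\<lambda>n. t (r n) + period (m * l n)) \<longlonglongrightarrow> t0"
      using exp_tendsto_nonzero_subseq[OF _ False m(1)] by metis
    have "(\<lambda>n. sq (n + N)) \<longlonglongrightarrow> s" using LIMSEQ_ignore_initial_segment[OF s] .
    then have s': "(\<lambda>n. sq (r n + N)) \<longlonglongrightarrow> s" using LIMSEQ_subseq_LIMSEQ[OF _ r(1)] by (force simp: o_def)
    have "(\<lambda>n. \<Psi> (sq (r n + N)) (t (r n) + period (m * l n))) \<longlonglongrightarrow> \<Psi> s t0" "Re t0 \<le> 0"
      using Psi_tendsto[OF s' r(2)] Re t by auto
    moreover have "\<Psi> (sq (r n + N)) (t (r n) + period (m * l n)) = yq (r n + N)" for n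
      using Psi_shift[OF Re t(1), of 0 "m * l n"] H_mult[OF m(2), of "l n"] t(2) by (simp add: mult.commute)
    ultimately have "(\<lambda>n. yq (r n + N)) \<longlonglongrightarrow> \<Psi> s t0" by simp
    moreover have "(\<lambda>n. yq (r n + N)) \<longlonglongrightarrow> y"
      using LIMSEQ_subseq_LIMSEQ[OF LIMSEQ_ignore_initial_segment[OF y] r(1)] by (force simp: o_def)
    ultimately show ?thesis using LIMSEQ_unique Re0 \<open>Re t0 \<le> 0\<close> unfolding over_def by blast
  qed
qed

text \<open>Here density enters: a point with \<open>u y \<noteq> 0\<close> is a limit of points of
  the covering, and their parameters converge after normalisation by periods \<open>(m, 0)\<close>
  of \<open>H\<close>. In particular each such point on the axis \<open>v = 0\<close> is a
  center.\<close>

lemma over_exists: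
  assumes "y \<in> K" "u y \<noteq> 0"
  shows "\<exists>s. over s y"
proof -
  obtain yq where yq: "\<And>n. yq n \<in> {x \<in> K. u x \<noteq> 0 \<and> v x \<noteq> 0}" "yq \<longlonglongrightarrow> y"
    using dense assms(1) closure_sequential by blast
  then have "\<exists>s. over s (yq n)" for n
    using Psi_surj[of "yq n"] unfolding over_def by (metis (mono_tags, lifting) mem_Collect_eq)
  then obtain sq where sq: "\<And>n. over (sq n) (yq n)" by metis
  have "(\<lambda>n. u (yq n)) \<longlonglongrightarrow> u y" using K_limit[OF yq(2)] yq(1) by blast
  then have "(\<lambda>n. exp (sq n)) \<longlonglongrightarrow> u y" using over_u[OF sq] by simp
  moreover obtain m where m: "m > 0" "(m, 0) \<in> H" using ex_H_first by blast
  ultimately obtain r l s0 where r: "strict_mono r" "(\<lambda>n. sq (r n) + period (m * l n)) \<longlonglongrightarrow> s0"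
    using exp_tendsto_nonzero_subseq[OF _ assms(2) m(1)] by metis
  have "over (sq (r n) + period (m * l n)) (yq (r n))" for n
    using over_shift[OF sq, of "m * l n" 0] H_mult[OF m(2), of "l n"] by (simp add: mult.commute)
  then have "over s0 y"
    using over_closed[of _ "\<lambda>n. yq (r n)", OF _ r(2)] LIMSEQ_subseq_LIMSEQ[OF yq(2) r(1)]
    by (simp add: o_def)
  then show ?thesis by blast
qed

end

section \<open>Fibres over the axis and the degree of the core\<close>

lemma norm_period: "norm (period j) = 2 * pi * \<bar>real_of_int j\<bar>"
  by (simp add: period_def norm_mult)

context bidisc_cover
begin

lemma over_unique:
  assumes "over s y" "over s' y" "v y \<noteq> 0"
  shows "\<exists>j k. (j, k) \<in> H \<and> s' = s + period j"
proof -
  have Re: "Re s \<le> 0" "Re s' \<le> 0" using assms over_Re by auto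
  obtain t t' where t: "Re t \<le> 0" "y = \<Psi> s t" "Re t' \<le> 0" "y = \<Psi> s' t'"
    using assms v_center[OF Re(1)] v_center[OF Re(2)] unfolding over_def by auto
  then show ?thesis using Psi_eq[OF Re(1) t(1) Re(2) t(3)] by auto
qed

lemma over_center:
  assumes "over s y" "v y = 0"
  shows "y = center s"
  using assms v_Psi unfolding over_def by auto

text \<open>All points of the axis over \<open>exp s\<close> are centers of parameters
  \<open>s + period j\<close>, and \<open>j\<close> matters only modulo \<open>\<alpha>\<close>.
  Residues may still give equal centers, so this alone bounds the fibre from above only.\<close>

lemma fibre_center:
  assumes \<alpha>: "\<alpha> > 0" "fst ` H = range ((*) \<alpha>)" and s: "Re s \<le> 0"
  shows "{x \<in> K. u x = exp s \<and> v x = 0} = (\<lambda>j. center (s + period j)) ` {0..<\<alpha>}"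
proof
  show "(\<lambda>j. center (s + period j)) ` {0..<\<alpha>} \<subseteq> {x \<in> K. u x = exp s \<and> v x = 0}"
    using s by (auto simp: center_K u_center v_center)
  show "{x \<in> K. u x = exp s \<and> v x = 0} \<subseteq> (\<lambda>j. center (s + period j)) ` {0..<\<alpha>}"
  proof
    fix x assume x: "x \<in> {x \<in> K. u x = exp s \<and> v x = 0}"
    then obtain s' where s': "over s' x" using over_exists[of x] by auto
    then have "exp s' = exp s" "x = center s'" using x over_u over_center by auto
    then obtain j where j: "s' = s + period j" by (auto simp: exp_eq_period)
    have "\<alpha> * (j div \<alpha>) \<in> fst ` H" unfolding \<alpha>(2) by blast
    then obtain k where k: "(\<alpha> * (j div \<alpha>), k) \<in> H" by auto
    have "s' = (s + period (j mod \<alpha>)) + period (\<alpha> * (j div \<alpha>))"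
      by (simp add: j add.assoc flip: period_add)
    then have "center s' = center (s + period (j mod \<alpha>))"
      using center_shift[OF _ k] s by simp
    then show "x \<in> (\<lambda>j. center (s + period j)) ` {0..<\<alpha>}"
      using \<open>x = center s'\<close> \<alpha>(1) by auto
  qed
qed

lemma core_degree:
  assumes \<alpha>: "\<alpha> > 0" "fst ` H = range ((*) \<alpha>)"
    and card: "\<And>y. norm y = 1 \<Longrightarrow> card {x \<in> K. u x = y \<and> v x = 0} = a"
    and torus_loops: "\<And>\<gamma>. path \<gamma> \<Longrightarrow> pathfinish \<gamma> = pathstart \<gamma> \<Longrightarrow> path_image \<gamma> \<subseteq> {x \<in> K. norm (u x) = 1} \<Longrightarrow>
      \<exists>\<gamma>'. homotopic_loops {x \<in> K. norm (u x) = 1} \<gamma> \<gamma>' \<and> path_image \<gamma>' \<subseteq> {x \<in> K. norm (u x) = 1 \<and> norm (v x) = 1}"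
  shows "int a = \<alpha>"
proof (rule antisym)
  let ?F = "{x \<in> K. u x = exp 0 \<and> v x = 0}"
  have cF: "card ?F = a" using card[of 1] by simp
  show "int a \<le> \<alpha>"
    using card_image_le[of "{0..<\<alpha>}" "\<lambda>j. center (0 + period j)"] cF fibre_center[OF \<alpha>, of 0] \<alpha>(1) by simp
  \<comment> \<open>The other inequality: \<open>a + 1\<close> parameters have their centers in a
    fibre of \<open>a\<close> points, so two of these centers coincide.\<close>
  have "(\<lambda>j. center (period (int j))) ` {..a} \<subseteq> ?F"
    by (auto simp: center_K u_center v_center)
  then have "card ((\<lambda>j. center (period (int j))) ` {..a}) \<le> a"
    using card_mono[OF finite_fibre[of "exp 0" 0]] cF by simp
  then have "\<not> inj_on (\<lambda>j. center (period (int j))) {..a}"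
    using card_image[of "\<lambda>j. center (period (int j))" "{..a}"] by auto
  then obtain i j where "i \<le> a" "j \<le> a" "i \<noteq> j" "center (period (int i)) = center (period (int j))"
    by (auto simp: inj_on_def)
  then obtain i j where ij: "i < j" "j \<le> a" "center (period (int i)) = center (period (int j))"
    by (metis linorder_neqE_nat)
  define d where "d = int j - int i"
  \<comment> \<open>A segment of the imaginary axis between the two colliding parameters; its
    centers form a closed loop in the solid torus on which \<open>u\<close> winds \<open>d\<close>
    times, with \<open>0 < d\<close> and \<open>d\<close> at most \<open>a\<close>.\<close>
  define \<sigma> where "\<sigma> x = period (int i) + of_real x * period d" for x :: real
  have s01: "\<sigma> 0 = period (int i)" "\<sigma> 1 = period (int j)"
    by (simp_all add: \<sigma>_def d_def flip: period_add)
  have Res: "Re (\<sigma> x) = 0" for x by (simp add: \<sigma>_def)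
  have path\<sigma>: "path \<sigma>" unfolding path_def \<sigma>_def by (intro continuous_intros)
  define \<gamma> where "\<gamma> = center \<circ> \<sigma>"
  have \<gamma>: "path \<gamma>" "pathfinish \<gamma> = pathstart \<gamma>" "path_image \<gamma> \<subseteq> {x \<in> K. norm (u x) = 1}"
  proof -
    show "path \<gamma>" unfolding \<gamma>_def
      by (intro path_continuous_image path\<sigma> continuous_on_subset[OF continuous_on_center])
         (auto simp: path_image_def Res)
    show "pathfinish \<gamma> = pathstart \<gamma>"
      using ij s01 by (simp add: pathfinish_def pathstart_def \<gamma>_def)
    show "path_image \<gamma> \<subseteq> {x \<in> K. norm (u x) = 1}"
      using Res by (auto simp: path_image_def \<gamma>_def center_K u_center norm_exp_eq_Re)
  qed
  have w\<gamma>: "winding_number (u \<circ> \<gamma>) 0 = of_int d"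
  proof (rule winding_number_exp_path[OF path\<sigma>])
    show "(u \<circ> \<gamma>) t = exp (\<sigma> t)" for t using Res by (simp add: \<gamma>_def u_center)
    show "\<sigma> 1 = \<sigma> 0 + period d" by (simp add: \<sigma>_def)
  qed
  obtain \<gamma>' where \<gamma>': "homotopic_loops {x \<in> K. norm (u x) = 1} \<gamma> \<gamma>'"
    "path_image \<gamma>' \<subseteq> {x \<in> K. norm (u x) = 1 \<and> norm (v x) = 1}"
    using torus_loops[OF \<gamma>] by blast
  have "homotopic_loops (-{0}) (u \<circ> \<gamma>) (u \<circ> \<gamma>')"
    by (rule homotopic_loops_continuous_image[OF \<gamma>'(1)])
       (auto intro: continuous_on_subset[OF cont_u])
  then have "winding_number (u \<circ> \<gamma>') 0 = of_int d"
    using winding_number_homotopic_loops w\<gamma> by metis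
  moreover have "path_image \<gamma>' \<subseteq> {x \<in> K. u x \<noteq> 0 \<and> v x \<noteq> 0}" using \<gamma>'(2) by auto
  then obtain j' k' where "(j', k') \<in> H" "winding_number (u \<circ> \<gamma>') 0 = of_int j'"
    using loop_H homotopic_loops_imp_path[OF \<gamma>'(1)] homotopic_loops_imp_loop[OF \<gamma>'(1)] by blast
  ultimately have "d \<in> fst ` H" by force
  then have "\<alpha> dvd d" unfolding \<alpha>(2) by auto
  then have "\<alpha> \<le> d" using ij by (auto intro: zdvd_imp_le simp: d_def)
  then show "\<alpha> \<le> int a" using ij unfolding d_def by linarith
qed

text \<open>Compactness turns the local estimates into a uniform one, which lets holomorphy pass
  from the sheets to the centers. The depth \<open>- Suc n\<close> is strictly negative because the
  sheets are holomorphic in \<open>s\<close> only for \<open>Re t < 0\<close>.\<close>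

lemma center_uniform_limit:
  assumes C: "compact C" "C \<subseteq> closed_lhp"
  shows "uniform_limit C (\<lambda>n s. \<Psi> s (of_real (- real (Suc n)))) center sequentially"
  unfolding uniform_limit_iff
proof (intro allI impI)
  fix e :: real assume e: "e > 0"
  have "\<exists>d N. d > 0 \<and> (\<forall>s'\<in>C. dist s' s < d \<longrightarrow> dist (center s') (center s) \<le> e / 3 \<and>
      (\<forall>n\<ge>N. dist (\<Psi> s' (of_real (- real (Suc n)))) (center s) \<le> e / 3))" if "s \<in> C" for s
  proof -
    have "Re s \<le> 0" using C that by auto
    then obtain d M where d: "d > 0"
        "\<And>s' t'. Re s' \<le> 0 \<Longrightarrow> Re t' \<le> 0 \<Longrightarrow> dist s' s < d \<Longrightarrow> Re t' < M \<Longrightarrow> dist (\<Psi> s' t') (center s) \<le> e / 3"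
        "\<And>s'. Re s' \<le> 0 \<Longrightarrow> dist s' s < d \<Longrightarrow> dist (center s') (center s) \<le> e / 3"
      using center_near_center[of s "e / 3"] e by (metis zero_less_divide_iff zero_less_numeral)
    obtain N :: nat where "- real N < M" using reals_Archimedean2[of "- M"] by (metis minus_less_iff)
    then show ?thesis using d C(2)
      by (intro exI[of _ d] exI[of _ N]) (auto intro!: d(2))
  qed
  then obtain d N where dN: "\<And>s. s \<in> C \<Longrightarrow> d s > 0" "\<And>s s'. s \<in> C \<Longrightarrow> s' \<in> C \<Longrightarrow> dist s' s < d s \<Longrightarrow> dist (center s') (center s) \<le> e / 3"
    "\<And>s s' n. s \<in> C \<Longrightarrow> s' \<in> C \<Longrightarrow> dist s' s < d s \<Longrightarrow> n \<ge> N s \<Longrightarrow> dist (\<Psi> s' (of_real (- real (Suc n)))) (center s) \<le> e / 3"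
    by metis
  have "C \<subseteq> (\<Union>s\<in>C. ball s (d s))" using dN(1) by force
  then obtain D where D: "D \<subseteq> C" "finite D" "C \<subseteq> (\<Union>s\<in>D. ball s (d s))"
    using compactE_image[OF C(1), of C "\<lambda>s. ball s (d s)"] by auto
  have "\<forall>s\<in>C. dist (\<Psi> s (of_real (- real (Suc n)))) (center s) < e" if n: "\<forall>s\<in>D. n \<ge> N s" for n
  proof
    fix s' assume s': "s' \<in> C"
    then obtain s where s: "s \<in> D" "dist s' s < d s" using D(3) by (force simp: dist_commute)
    then have "s \<in> C" using D by blast
    then have "dist (center s') (center s) \<le> e / 3" "dist (\<Psi> s' (of_real (- real (Suc n)))) (center s) \<le> e / 3"
      using dN(2,3) s s' n by auto
    then show "dist (\<Psi> s' (of_real (- real (Suc n)))) (center s') < e"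
      using dist_triangle2[of "\<Psi> s' (of_real (- real (Suc n)))" "center s'" "center s"] e by linarith
  qed
  moreover have "eventually (\<lambda>n. \<forall>s\<in>D. n \<ge> N s) sequentially"
    using D(2) by (intro eventually_ball_finite ballI eventually_ge_at_top)
  ultimately show "\<forall>\<^sub>F n in sequentially. \<forall>s\<in>C. dist (\<Psi> s (of_real (- real (Suc n)))) (center s) < e"
    by (rule eventually_mono[rotated])
qed

end

text \<open>The additional data for separating the branches at \<open>v = 0\<close>.
  \<open>\<Lambda>\<close> stands for the ambient coordinate functions: they detect equality of
  points and are holomorphic along the sheets. \<open>card_fibre\<close> controls the boundary
  circle, and \<open>no_cut_point\<close> is the trace of the conic structure.\<close>

locale unibranch_cover = bidisc_cover +
  fixes \<alpha> :: int and \<Lambda> :: "('a \<Rightarrow> complex) set"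
  assumes alpha_pos: "0 < \<alpha>" and fst_H: "fst ` H = range ((*) \<alpha>)"
    and card_fibre: "norm w = 1 \<Longrightarrow> int (card {x \<in> K. u x = w \<and> v x = 0}) = \<alpha>"
    and separating: "x \<in> K \<Longrightarrow> y \<in> K \<Longrightarrow> x \<noteq> y \<Longrightarrow> \<exists>l\<in>\<Lambda>. l x \<noteq> l y"
    and cont_functional: "l \<in> \<Lambda> \<Longrightarrow> continuous_on K l"
    and holo_functional: "l \<in> \<Lambda> \<Longrightarrow> Re t < 0 \<Longrightarrow> (\<lambda>s. l (\<Psi> s t)) holomorphic_on {s. Re s < 0}"
    and no_cut_point: "x \<in> K \<Longrightarrow> norm (u x) < 1 \<Longrightarrow> u x \<noteq> 0 \<Longrightarrow> v x = 0 \<Longrightarrow> e > 0 \<Longrightarrow>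
      \<exists>U d. U \<subseteq> K \<inter> ball x e \<and> d > 0 \<and> K \<inter> ball x d \<subseteq> U \<and> connected (U - {x})"
begin

lemma center_alpha_shift: "Re s \<le> 0 \<Longrightarrow> \<alpha> dvd j \<Longrightarrow> center (s + period j) = center s"
proof -
  assume s: "Re s \<le> 0" and "\<alpha> dvd j"
  then have "j \<in> fst ` H" unfolding fst_H by auto
  then show ?thesis using center_shift[OF s] by auto
qed

lemma center_mod: "Re s \<le> 0 \<Longrightarrow> center (s + period j) = center (s + period (j mod \<alpha>))"
proof -
  assume s: "Re s \<le> 0"
  have eq: "s + period j = (s + period (j mod \<alpha>)) + period (\<alpha> * (j div \<alpha>))"
    by (simp add: add.assoc flip: period_add)
  show ?thesis unfolding eq using s by (intro center_alpha_shift) auto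
qed

text \<open>A map from the \<open>\<alpha>\<close> residues onto a fibre of exactly
  \<open>\<alpha>\<close> points is injective.\<close>

lemma center_inj_boundary:
  assumes s: "Re s = 0" and eq: "center (s + period j) = center s"
  shows "\<alpha> dvd j"
proof -
  have "int (card ((\<lambda>j. center (s + period j)) ` {0..<\<alpha>})) = \<alpha>"
    using fibre_center[OF alpha_pos fst_H, of s] card_fibre[of "exp s"] s by (simp add: norm_exp_eq_Re)
  then have inj: "inj_on (\<lambda>j. center (s + period j)) {0..<\<alpha>}"
    by (intro eq_card_imp_inj_on) auto
  have "center (s + period (j mod \<alpha>)) = center (s + period 0)"
    using center_mod[of s j] s eq by simp
  then have "j mod \<alpha> = 0"
    using inj_onD[OF inj, of "j mod \<alpha>" 0] alpha_pos by simp
  then show ?thesis by auto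
qed

lemma holomorphic_center:
  assumes l: "l \<in> \<Lambda>"
  shows "(\<lambda>s. l (center s)) holomorphic_on {s. Re s < 0}"
proof (rule holomorphic_uniform_sequence[where f = "\<lambda>n s. l (\<Psi> s (of_real (- real (Suc n))))"])
  show "open {s. Re s < 0}" by (rule open_halfspace_Re_lt)
  show "(\<lambda>s. l (\<Psi> s (of_real (- real (Suc n))))) holomorphic_on {s. Re s < 0}" for n
    using l by (intro holo_functional) auto
  fix x :: complex assume "x \<in> {s. Re s < 0}"
  then obtain d where d: "d > 0" "cball x d \<subseteq> {s. Re s < 0}"
    using open_halfspace_Re_lt[of 0] open_contains_cball by blast
  then have sub: "cball x d \<subseteq> closed_lhp" by auto
  have "uniform_limit (cball x d) (\<lambda>n s. l (\<Psi> s (of_real (- real (Suc n))))) (\<lambda>s. l (center s)) sequentially"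
    unfolding uniform_limit_iff
  proof (intro allI impI)
    fix e :: real assume "e > 0"
    then obtain \<delta> where \<delta>: "\<delta> > 0" "\<And>x y. x \<in> K \<Longrightarrow> y \<in> K \<Longrightarrow> dist y x < \<delta> \<Longrightarrow> dist (l y) (l x) < e"
      using compact_uniformly_continuous[OF cont_functional[OF l] compact_K] unfolding uniformly_continuous_on_def by metis
    have "\<forall>\<^sub>F n in sequentially. \<forall>s\<in>cball x d. dist (\<Psi> s (of_real (- real (Suc n)))) (center s) < \<delta>"
      using center_uniform_limit[OF compact_cball sub] \<delta>(1) unfolding uniform_limit_iff by blast
    then show "\<forall>\<^sub>F n in sequentially. \<forall>s\<in>cball x d. dist (l (\<Psi> s (of_real (- real (Suc n))))) (l (center s)) < e"
    proof eventually_elim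
      case (elim n)
      show ?case
      proof
        fix s assume s: "s \<in> cball x d"
        then have "Re s \<le> 0" using sub by blast
        then show "dist (l (\<Psi> s (of_real (- real (Suc n))))) (l (center s)) < e"
          using \<delta>(2) elim s center_K Psi_K by simp
      qed
    qed
  qed
  then show "\<exists>d>0. cball x d \<subseteq> {s. Re s < 0} \<and> uniform_limit (cball x d)
      (\<lambda>n s. l (\<Psi> s (of_real (- real (Suc n))))) (\<lambda>s. l (center s)) sequentially"
    using d by blast
qed

text \<open>Some functional separates the two centers over the boundary point 0. The difference of
  its values along the two branches is holomorphic inside and continuous up to the boundary, hence
  not identically zero, and its zeros are isolated.\<close>

lemma coincidences_isolated:
  assumes s0: "Re s0 < 0" and j: "\<not> \<alpha> dvd j"
  shows "\<exists>d>0. \<forall>s\<in>ball s0 d - {s0}. Re s < 0 \<and> center (s + period j) \<noteq> center s"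
proof -
  have "center (0 + period j) \<noteq> center 0" using center_inj_boundary[of 0 j] j by auto
  then obtain l where l: "l \<in> \<Lambda>" "l (center (0 + period j)) \<noteq> l (center 0)"
    using separating[of "center (0 + period j)" "center 0"] center_K by auto
  define g where "g s = l (center (s + period j)) - l (center s)" for s
  have "(\<lambda>s. l (center (s + period j))) holomorphic_on {s. Re s < 0}"
    using holomorphic_on_compose_gen[OF _ holomorphic_center[OF l(1)], of "\<lambda>s. s + period j" "{s. Re s < 0}"]
    by (force simp: o_def intro!: holomorphic_intros)
  then have hol: "g holomorphic_on {s. Re s < 0}"
    unfolding g_def using holomorphic_center[OF l(1)] by (intro holomorphic_intros)
  have lc: "continuous_on closed_lhp (\<lambda>s. l (center s))"
    by (rule continuous_on_compose2[OF cont_functional[OF l(1)] continuous_on_center]) (auto simp: center_K)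
  have "continuous_on closed_lhp (\<lambda>s. l (center (s + period j)))"
    by (rule continuous_on_compose2[OF lc]) (auto intro!: continuous_intros)
  then have contg: "continuous_on closed_lhp g"
    unfolding g_def using lc by (intro continuous_intros)
  \<comment> \<open>The boundary point 0 lies outside the domain of holomorphy; continuity provides
    a nonzero value at a nearby interior point.\<close>
  obtain \<beta> where \<beta>: "Re \<beta> < 0" "g \<beta> \<noteq> 0"
  proof -
    have "(\<lambda>n. complex_of_real (- inverse (real (Suc n)))) \<longlonglongrightarrow> of_real (- 0)"
      by (intro tendsto_of_real tendsto_minus LIMSEQ_inverse_real_of_nat)
    then have "(\<lambda>n. g (of_real (- inverse (real (Suc n))))) \<longlonglongrightarrow> g 0"
      by (intro continuous_on_tendsto_compose[OF contg]) auto
    moreover have "g 0 \<noteq> 0" using l by (simp add: g_def)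
    ultimately have "eventually (\<lambda>n. g (of_real (- inverse (real (Suc n)))) \<noteq> 0) sequentially"
      by (rule tendsto_imp_eventually_ne)
    then obtain n where "g (of_real (- inverse (real (Suc n)))) \<noteq> 0"
      unfolding eventually_sequentially by blast
    then show ?thesis using that[of "of_real (- inverse (real (Suc n)))"] by auto
  qed
  have "\<exists>d>0. ball s0 d \<subseteq> {s. Re s < 0} \<and> (\<forall>s\<in>ball s0 d - {s0}. g s \<noteq> 0)"
  proof (cases "g s0 = 0")
    case True
    obtain r where "0 < r" "ball s0 r \<subseteq> {s. Re s < 0}" "\<And>z. z \<in> ball s0 r - {s0} \<Longrightarrow> g z \<noteq> 0"
      using isolated_zeros[OF hol open_halfspace_Re_lt convex_connected[OF convex_halfspace_Re_lt] _ True, of \<beta>]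
        \<beta> s0 by blast
    then show ?thesis by blast
  next
    case False
    have "open (g -` (- {0}) \<inter> {s. Re s < 0})"
      using continuous_on_open_vimage[OF open_halfspace_Re_lt, of 0 g] holomorphic_on_imp_continuous_on[OF hol]
        open_Compl[OF closed_singleton] by blast
    moreover have "s0 \<in> g -` (- {0}) \<inter> {s. Re s < 0}" using False s0 by simp
    ultimately obtain d where d: "d > 0" "ball s0 d \<subseteq> g -` (- {0}) \<inter> {s. Re s < 0}"
      using open_contains_ball by blast
    then have "ball s0 d \<subseteq> {s. Re s < 0}" "\<forall>s\<in>ball s0 d - {s0}. g s \<noteq> 0" by blast+
    then show ?thesis using d(1) by blast
  qed
  then obtain d where d: "d > 0" "ball s0 d \<subseteq> {s. Re s < 0}" "\<And>s. s \<in> ball s0 d - {s0} \<Longrightarrow> g s \<noteq> 0"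
    by blast
  show ?thesis
  proof (intro exI[of _ d] conjI ballI)
    fix s assume s: "s \<in> ball s0 d - {s0}"
    then show "Re s < 0" using d(2) by blast
    show "center (s + period j) \<noteq> center s" using d(3)[OF s] unfolding g_def by auto
  qed (fact d(1))
qed

text \<open>If two branches met at an interior point \<open>x0\<close>, then near \<open>x0\<close>
  the branches would be disjoint apart from \<open>x0\<close> itself, since their coincidences are
  isolated. Branch 0 and the union of all others would then be two nonempty disjoint closed sets
  covering a connected punctured neighbourhood.\<close>

lemma center_inj:
  assumes s0: "Re s0 \<le> 0" and eq: "center (s0 + period j0) = center s0"
  shows "\<alpha> dvd j0"
proof (rule ccontr)
  assume j0: "\<not> \<alpha> dvd j0"
  have Re0: "Re s0 < 0" using center_inj_boundary[of s0 j0] s0 eq j0 by force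
  \<comment> \<open>Centers depend on the index modulo \<open>\<alpha>\<close> only, so finitely
    many pairs of residues suffice for a common radius \<open>d1\<close>.\<close>
  define I where "I = {(i, j). i \<in> {0..<\<alpha>} \<and> j \<in> {0..<\<alpha>} \<and> i \<noteq> j}"
  have "finite I"
    unfolding I_def by (rule finite_subset[of _ "{0..<\<alpha>} \<times> {0..<\<alpha>}"]) auto
  moreover have "\<forall>\<^sub>F s in at s0. center (s + period (fst z)) \<noteq> center (s + period (snd z))" if z: "z \<in> I" for z
  proof -
    obtain i j where ij: "z = (i, j)" "0 \<le> i" "i < \<alpha>" "0 \<le> j" "j < \<alpha>" "i \<noteq> j"
      using z unfolding I_def by auto
    then have "\<not> \<alpha> dvd j - i" by (metis mod_pos_pos_trivial mod_eq_dvd_iff)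
    then obtain d where d: "d > 0" "\<And>s. s \<in> ball (s0 + period i) d - {s0 + period i} \<Longrightarrow> center (s + period (j - i)) \<noteq> center s"
      using coincidences_isolated[of "s0 + period i" "j - i"] Re0 by auto
    have "center (s + period i) \<noteq> center (s + period j)" if "s \<noteq> s0" "dist s s0 < d" for s
    proof -
      have "s + period i \<in> ball (s0 + period i) d - {s0 + period i}"
        using that by (simp add: dist_commute)
      then have "center (s + period i + period (j - i)) \<noteq> center (s + period i)" by (rule d(2))
      then show ?thesis by (simp add: add.assoc flip: period_add)
    qed
    then show ?thesis using d(1) ij(1) unfolding eventually_at by auto
  qed
  ultimately have "\<forall>\<^sub>F s in at s0. \<forall>z\<in>I. center (s + period (fst z)) \<noteq> center (s + period (snd z))"
    by (intro eventually_ball_finite) auto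
  then obtain d1 where d1: "d1 > 0"
    "\<And>s i j. s \<noteq> s0 \<Longrightarrow> dist s s0 < d1 \<Longrightarrow> (i, j) \<in> I \<Longrightarrow> center (s + period i) \<noteq> center (s + period j)"
    unfolding eventually_at by force
  \<comment> \<open>\<open>d1\<close> excludes coincidences, \<open>- Re s0\<close> keeps the disc
    in the half plane, and \<open>pi\<close> makes \<open>exp\<close> injective on it and separates
    its translates by periods.\<close>
  define \<delta> where "\<delta> = min d1 (min (- Re s0) pi)"
  have \<delta>: "\<delta> > 0" "\<delta> \<le> d1" "\<delta> \<le> pi" using d1(1) Re0 by (auto simp: \<delta>_def)
  have Re: "Re s \<le> 0" if "dist s s0 < \<delta>" for s
    using that abs_Re_le_cmod[of "s - s0"] by (auto simp: \<delta>_def dist_norm)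
  have iso: "\<alpha> dvd i - j" if "s \<noteq> s0" "dist s s0 < \<delta>" "center (s + period i) = center (s + period j)" for s i j
  proof (rule ccontr)
    assume "\<not> \<alpha> dvd i - j"
    then have "(i mod \<alpha>, j mod \<alpha>) \<in> I"
      using alpha_pos by (auto simp: I_def mod_eq_dvd_iff)
    then have "center (s + period (i mod \<alpha>)) \<noteq> center (s + period (j mod \<alpha>))"
      using d1(2) that \<delta> by auto
    then show False using that(3) center_mod[OF Re[OF that(2)], of i] center_mod[OF Re[OF that(2)], of j] by simp
  qed
  define x0 where "x0 = center s0"
  have x0: "x0 \<in> K" "u x0 = exp s0" "v x0 = 0" using s0 by (auto simp: x0_def center_K u_center v_center)
  obtain \<eta> where \<eta>: "\<eta> > 0" "\<And>w. dist w (exp s0) < \<eta> \<Longrightarrow> \<exists>s. dist s s0 < \<delta> \<and> exp s = w"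
  proof -
    have "inj_on exp (ball s0 \<delta>)"
    proof (rule inj_onI)
      fix x y assume xy: "x \<in> ball s0 \<delta>" "y \<in> ball s0 \<delta>" "exp x = exp y"
      have "\<bar>Im x - Im y\<bar> \<le> dist x y"
        using abs_Im_le_cmod[of "x - y"] by (simp add: dist_norm)
      also have "\<dots> < 2 * pi"
        using dist_triangle3[of x y s0] xy \<delta>(3) by simp
      finally show "x = y" using xy(3) by (rule exp_complex_eqI)
    qed
    then have "open (exp ` ball s0 \<delta>)"
      by (rule open_mapping_thm3[OF holomorphic_on_exp open_ball])
    moreover have "exp s0 \<in> exp ` ball s0 \<delta>" using \<delta>(1) by (intro imageI) simp
    ultimately obtain \<eta> where \<eta>: "\<eta> > 0" "ball (exp s0) \<eta> \<subseteq> exp ` ball s0 \<delta>"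
      by (rule openE)
    have "\<exists>s. dist s s0 < \<delta> \<and> exp s = w" if "dist w (exp s0) < \<eta>" for w
    proof -
      have "w \<in> exp ` ball s0 \<delta>" using \<eta>(2) that by (auto simp: dist_commute)
      then show ?thesis by (auto simp: dist_commute)
    qed
    then show ?thesis using that[OF \<eta>(1)] by blast
  qed
  obtain e1 where e1: "e1 > 0" "\<And>y. y \<in> K \<Longrightarrow> dist y x0 < e1 \<Longrightarrow> dist (u y) (exp s0) < \<eta>"
    using cont_u x0 \<eta>(1) unfolding continuous_on_iff by metis
  \<comment> \<open>The radius \<open>e2\<close> keeps the other points of the fibre of
    \<open>x0\<close> away, so that a point of \<open>U - {x0}\<close> on the axis has a parameter
    different from \<open>s0\<close>.\<close>
  obtain e2 where e2: "e2 > 0" "\<And>y. y \<in> K \<Longrightarrow> u y = exp s0 \<Longrightarrow> v y = 0 \<Longrightarrow> y \<noteq> x0 \<Longrightarrow> e2 \<le> dist x0 y"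
    using finite_set_avoid[OF finite_fibre[of "exp s0" 0], of x0] by auto
  obtain U d where U: "U \<subseteq> K \<inter> ball x0 (min e1 e2)" "d > 0" "K \<inter> ball x0 d \<subseteq> U" "connected (U - {x0})"
    using no_cut_point[of x0 "min e1 e2"] x0 Re0 e1(1) e2(1) by (auto simp: norm_exp_eq_Re)
  have Uu: "\<exists>s. dist s s0 < \<delta> \<and> exp s = u y" if "y \<in> U" for y
  proof -
    have "y \<in> K \<inter> ball x0 (min e1 e2)" using U(1) that by blast
    then have "dist (u y) (exp s0) < \<eta>" using e1(2) by (simp add: dist_commute)
    then show ?thesis by (rule \<eta>(2))
  qed
  have Uf: "\<not> (u y = exp s0 \<and> v y = 0)" if "y \<in> U - {x0}" for y
  proof -
    have "y \<in> K \<inter> ball x0 (min e1 e2)" using U(1) that by blast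
    then show ?thesis using e2(2)[of y] that by auto
  qed
  \<comment> \<open>The part of the punctured neighbourhood swept out by the branches with index in
    \<open>J\<close>: the closed discs over parameters close to \<open>s0 + period i\<close>,
    centers included.\<close>
  define A where "A J = {y \<in> U - {x0}. \<exists>i\<in>J. \<exists>z. dist z (s0 + period i) < \<delta> \<and> over z y}" for J
  have mem_A: "y \<in> A J" if "i \<in> J" "dist z (s0 + period i) < \<delta>" "over z y" "y \<in> U - {x0}" for i J z y
    unfolding A_def mem_Collect_eq using that by (intro conjI bexI[of _ i] exI[of _ z])
  have A_Un: "A (J \<union> J') = A J \<union> A J'" for J J'
    unfolding A_def by blast
  \<comment> \<open>Two parameters of one point differ by a multiple of \<open>\<alpha>\<close>: off
    the axis by the description of the covering through \<open>H\<close>, on the axis because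
    \<open>s \<noteq> s0\<close> and coincidences over the punctured disc are excluded.\<close>
  have key: "\<exists>j. z' = z + period j \<and> \<alpha> dvd j"
    if y: "y \<in> U - {x0}" and z: "over z y" "dist z (s0 + period i) < \<delta>" and z': "over z' y" for y z z' i
  proof -
    have "exp z' = exp z" using over_u[OF z(1)] over_u[OF z'] by simp
    then obtain j where j: "z' = z + period j" by (auto simp: exp_eq_period)
    have "\<alpha> dvd j"
    proof (cases "v y = 0")
      case False
      then obtain j' k where "(j', k) \<in> H" "z' = z + period j'" using over_unique[OF z(1) z'] by blast
      then have "j \<in> fst ` H" using j by force
      then show ?thesis unfolding fst_H by auto
    next
      case True
      define s where "s = z - period i"
      have z_s: "z = s + period i" "z' = s + period (i + j)" "dist s s0 < \<delta>"
        using z(2) by (auto simp: s_def j period_add dist_norm algebra_simps)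
      have "u y = exp s" using over_u[OF z(1)] by (simp add: z_s)
      then have "s \<noteq> s0" using Uf[OF y] True by auto
      have "center z = center z'" using over_center[OF z(1) True] over_center[OF z' True] by simp
      then have "\<alpha> dvd (i + j) - i" using iso[OF \<open>s \<noteq> s0\<close> z_s(3), of "i + j" i] z_s by simp
      then show ?thesis by simp
    qed
    then show ?thesis using j by blast
  qed
  \<comment> \<open>Distinct translates are at least \<open>2 * pi\<close> apart, which is at least
    \<open>\<delta> + \<delta>\<close>. One inequality may be non-strict, as needed for limits of
    parameters.\<close>
  have same: "i' = i + j" if "dist z (s0 + period i) < \<delta>" "dist (z + period j) (s0 + period i') \<le> \<delta>" for z i i' j
  proof -
    have "norm (period (i + j - i')) = norm ((z + period j - (s0 + period i')) - (z - (s0 + period i)))"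
      by (simp add: period_add period_diff algebra_simps)
    also have "\<dots> < \<delta> + \<delta>"
      using that norm_triangle_ineq4[of "z + period j - (s0 + period i')" "z - (s0 + period i)"]
      by (simp add: dist_norm)
    also have "\<dots> \<le> 2 * pi" using \<delta> by simp
    finally have "2 * pi * \<bar>real_of_int (i + j - i')\<bar> < 2 * pi * 1"
      unfolding norm_period by simp
    then have "\<bar>real_of_int (i + j - i')\<bar> < 1"
      by (rule mult_less_cancel_left_pos[THEN iffD1, rotated]) simp
    then have "i + j - i' = 0" by linarith
    then show ?thesis by simp
  qed
  have cover: "A {0} \<union> A {1..<\<alpha>} = U - {x0}"
  proof
    show "U - {x0} \<subseteq> A {0} \<union> A {1..<\<alpha>}"
    proof
      fix y assume y: "y \<in> U - {x0}"
      then obtain s where s: "dist s s0 < \<delta>" "exp s = u y" using Uu by blast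
      have "y \<in> K" "u y \<noteq> 0" using y U(1) s(2) by (auto simp flip: s(2))
      then obtain z where z: "over z y" using over_exists by blast
      then have "exp z = exp s" using over_u s(2) by simp
      then obtain i where i: "z = s + period i" by (auto simp: exp_eq_period)
      have "\<alpha> * (- (i div \<alpha>)) \<in> fst ` H" unfolding fst_H by blast
      then obtain k where "(\<alpha> * (- (i div \<alpha>)), k) \<in> H" by auto
      then have "over (z + period (\<alpha> * (- (i div \<alpha>)))) y" using over_shift[OF z] by blast
      moreover have "z + period (\<alpha> * (- (i div \<alpha>))) = s + period (i mod \<alpha>)"
        by (simp add: i add.assoc minus_div_mult_eq_mod[symmetric] algebra_simps flip: period_add)
      ultimately have o: "over (s + period (i mod \<alpha>)) y" by simp
      have d: "dist (s + period (i mod \<alpha>)) (s0 + period (i mod \<alpha>)) < \<delta>" using s(1) by simp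
      have m: "i mod \<alpha> \<in> {0} \<union> {1..<\<alpha>}" 
        unfolding Un_iff singleton_iff atLeastLessThan_iff
        using pos_mod_bound[OF alpha_pos, of i] pos_mod_sign[OF alpha_pos, of i] by linarith
      show "y \<in> A {0} \<union> A {1..<\<alpha>}"
        using mem_A[OF m d o y] unfolding A_Un .
    qed
  qed (auto simp: A_def)
  have closed: "closedin (top_of_set (U - {x0})) (A J)" if J: "J \<subseteq> {0..<\<alpha>}" for J
  proof -
    have "(U - {x0}) \<inter> closure (A J) \<subseteq> A J"
    proof
      fix y assume y: "y \<in> (U - {x0}) \<inter> closure (A J)"
      then obtain yq where yq: "\<And>n. yq n \<in> A J" "yq \<longlonglongrightarrow> y" by (auto simp: closure_sequential)
      let ?C = "\<Union>i\<in>J. cball (s0 + period i) \<delta>"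
      have "compact ?C" using J by (intro compact_UN) (auto intro: finite_subset)
      have "\<forall>n. \<exists>z. z \<in> ?C \<and> over z (yq n)"
      proof
        fix n
        obtain i z where "i \<in> J" "dist z (s0 + period i) < \<delta>" "over z (yq n)"
          using yq(1)[of n] unfolding A_def by blast
        then show "\<exists>z. z \<in> ?C \<and> over z (yq n)"
          by (intro exI[of _ z] conjI UN_I[of i]) (auto simp: dist_commute)
      qed
      then obtain zq where zq: "\<And>n. zq n \<in> ?C" "\<And>n. over (zq n) (yq n)" by metis
      obtain z r where z: "z \<in> ?C" "strict_mono r" "(\<lambda>n. zq (r n)) \<longlonglongrightarrow> z"
        by (rule compact_subseqE[OF \<open>compact ?C\<close> zq(1)])
      have "over z y"
        using over_closed[of "\<lambda>n. zq (r n)" "\<lambda>n. yq (r n)", OF zq(2) z(3)]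
          LIMSEQ_subseq_LIMSEQ[OF yq(2) z(2)] by (simp add: o_def)
      obtain i where i: "i \<in> J" "dist z (s0 + period i) \<le> \<delta>" using z(1) by (auto simp: dist_commute)
      obtain i' z' where i': "i' \<in> {0..<\<alpha>}" "dist z' (s0 + period i') < \<delta>" "over z' y"
      proof -
        have "y \<in> A ({0} \<union> {1..<\<alpha>})" using y cover A_Un by blast
        moreover have "{0} \<union> {1..<\<alpha>} \<subseteq> {0..<\<alpha>}" using alpha_pos by auto
        ultimately show ?thesis using that unfolding A_def by blast
      qed
      \<comment> \<open>\<open>z\<close> is the limit parameter, known only to lie in a closed disc
        with index in \<open>J\<close>, while \<open>z'\<close> lies in an open one. The two indices
        are congruent modulo \<open>\<alpha>\<close> and both are residues, hence equal.\<close>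
      obtain j where j: "z = z' + period j" "\<alpha> dvd j"
        using key[of y z' i' z] y i' \<open>over z y\<close> by blast
      have "i = i' + j" using same[OF i'(2), of j i] i j by simp
      moreover have "i \<in> {0..<\<alpha>}" using i J by blast
      ultimately have "i = i'" using i'(1) j(2)
        by (metis atLeastLessThan_iff dvd_imp_mod_0 mod_add_right_eq mod_pos_pos_trivial add.right_neutral)
      then show "y \<in> A J" using mem_A[of i J z' y] i(1) i'(2,3) y by simp
    qed
    then have "A J = (U - {x0}) \<inter> closure (A J)"
      using closure_subset[of "A J"] by (auto simp: A_def)
    then show ?thesis by (metis closedin_closed_Int closed_closure)
  qed
  have disj: "A {0} \<inter> A {1..<\<alpha>} = {}"
  proof (rule ccontr)
    assume "A {0} \<inter> A {1..<\<alpha>} \<noteq> {}"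
    then obtain y z z' i where y: "y \<in> U - {x0}" "over z y" "dist z (s0 + period 0) < \<delta>"
      "i \<in> {1..<\<alpha>}" "over z' y" "dist z' (s0 + period i) < \<delta>" unfolding A_def by blast
    obtain j where "z' = z + period j" "\<alpha> dvd j" using key[OF y(1,2,3,5)] by blast
    then have "i = j" using same[OF y(3), of j i] y(6) by simp
    then show False using \<open>\<alpha> dvd j\<close> y(4) zdvd_imp_le by force
  qed
  \<comment> \<open>A branch whose center over \<open>s0\<close> is \<open>x0\<close> reaches every
    neighbourhood of \<open>x0\<close> along its ray.\<close>
  have nonempty: "A {i} \<noteq> {}" if i: "center (s0 + period i) = x0" for i
  proof -
    have "(\<lambda>n. \<Psi> (s0 + period i) (of_real (- real n))) \<longlonglongrightarrow> x0"
      using Psi_ray_tendsto_center[of "s0 + period i"] s0 i by simp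
    then have "eventually (\<lambda>n. dist (\<Psi> (s0 + period i) (of_real (- real n))) x0 < d) sequentially"
      using U(2) by (rule tendstoD)
    then obtain n where n: "dist (\<Psi> (s0 + period i) (of_real (- real n))) x0 < d"
      unfolding eventually_sequentially by blast
    let ?y = "\<Psi> (s0 + period i) (of_real (- real n))"
    have "?y \<in> K" "v ?y \<noteq> 0" using s0 by (auto simp: Psi_K v_Psi)
    then have "?y \<in> U - {x0}" using n U(3) x0 by (auto simp: dist_commute)
    moreover have "over (s0 + period i) ?y"
      unfolding over_def using s0 by (auto intro!: exI[of _ "of_real (- real n)"])
    ultimately show ?thesis using mem_A[of i "{i}" "s0 + period i" ?y] \<delta>(1) by auto
  qed
  have "j0 mod \<alpha> \<in> {1..<\<alpha>}"
    using j0 pos_mod_bound[OF alpha_pos, of j0] pos_mod_sign[OF alpha_pos, of j0]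
    unfolding dvd_eq_mod_eq_0 atLeastLessThan_iff by linarith
  moreover have "center (s0 + period (j0 mod \<alpha>)) = x0"
    using center_mod[OF s0, of j0] eq by (simp add: x0_def)
  ultimately have "A {1..<\<alpha>} \<noteq> {}" using nonempty[of "j0 mod \<alpha>"] unfolding A_def by blast
  moreover have "A {0} \<noteq> {}" using nonempty[of 0] x0_def by simp
  moreover have "closedin (top_of_set (U - {x0})) (A {0})" "closedin (top_of_set (U - {x0})) (A {1..<\<alpha>})"
    using closed alpha_pos by auto
  ultimately show False
    using U(4) cover disj unfolding connected_closedin_eq by blast
qed

end

section \<open>Two coverings with the same lattice\<close>

locale bidisc_cover_pair =
  C1: bidisc_cover K1 u1 v1 \<Psi>1 H + C2: bidisc_cover K2 u2 v2 \<Psi>2 H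
  for K1 :: "'a::euclidean_space set" and u1 v1 \<Psi>1 and K2 :: "'b::euclidean_space set" and u2 v2 \<Psi>2 and H
begin

lemma limit_u:
  assumes "(\<lambda>n. \<Psi>1 (s n) (t n)) \<longlonglongrightarrow> x" "\<And>n. Re (s n) \<le> 0" "\<And>n. Re (t n) \<le> 0"
  shows "(\<lambda>n. exp (s n)) \<longlonglongrightarrow> u1 x" "(\<lambda>n. exp (t n)) \<longlonglongrightarrow> v1 x"
  using C1.K_limit[OF assms(1)] C1.Psi_K C1.u_Psi C1.v_Psi assms(2,3) by auto

text \<open>Both coverings have the same \<open>H\<close>, so one subsequence and one choice of
  periods normalise the parameters on both sides. The two limits are centers of the same
  \<open>s0\<close>.\<close>

lemma limit_over_axis:
  assumes x: "(\<lambda>n. \<Psi>1 (s n) (t n)) \<longlonglongrightarrow> x" and y: "(\<lambda>n. \<Psi>2 (s n) (t n)) \<longlonglongrightarrow> y"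
    and Re: "\<And>n. Re (s n) \<le> 0" "\<And>n. Re (t n) \<le> 0" and ux: "u1 x \<noteq> 0" and vx: "v1 x = 0"
  shows "\<exists>s0. Re s0 \<le> 0 \<and> x = C1.center s0 \<and> y = C2.center s0"
proof -
  obtain m where m: "m > 0" "(m, 0) \<in> H" using C1.ex_H_first by blast
  obtain r l s0 where r: "strict_mono r" "(\<lambda>n. s (r n) + period (m * l n)) \<longlonglongrightarrow> s0"
    by (rule exp_tendsto_nonzero_subseq[OF limit_u(1)[OF x Re] ux m(1)])
  have Re': "Re (s (r n) + period (m * l n)) \<le> 0" for n using Re by simp
  then have Re0: "Re s0 \<le> 0" by (rule Re_limit_le_0[OF r(2)])
  have "(\<lambda>n. exp (t (r n))) \<longlonglongrightarrow> 0"
    using LIMSEQ_subseq_LIMSEQ[OF limit_u(2)[OF x Re] r(1)] vx by (simp add: o_def)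
  then have t: "filterlim (\<lambda>n. Re (t (r n))) at_bot sequentially"
    by (rule filterlim_Re_at_bot_of_exp_tendsto_0)
  have mH: "(m * l n, 0) \<in> H" for n using C1.H_mult[OF m(2), of "l n"] by (simp add: mult.commute)
  have "\<Psi>1 (s (r n) + period (m * l n)) (t (r n)) = \<Psi>1 (s (r n)) (t (r n))"
    "\<Psi>2 (s (r n) + period (m * l n)) (t (r n)) = \<Psi>2 (s (r n)) (t (r n))" for n
    using C1.Psi_shift[OF Re(1)[of "r n"] Re(2)[of "r n"] mH[of n]]
      C2.Psi_shift[OF Re(1)[of "r n"] Re(2)[of "r n"] mH[of n]] by auto
  then have c: "(\<lambda>n. \<Psi>1 (s (r n)) (t (r n))) \<longlonglongrightarrow> C1.center s0" "(\<lambda>n. \<Psi>2 (s (r n)) (t (r n))) \<longlonglongrightarrow> C2.center s0"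
    using C1.Psi_tendsto_center[OF Re0 r(2) t Re' Re(2)] C2.Psi_tendsto_center[OF Re0 r(2) t Re' Re(2)] by auto
  have "(\<lambda>n. \<Psi>1 (s (r n)) (t (r n))) \<longlonglongrightarrow> x" "(\<lambda>n. \<Psi>2 (s (r n)) (t (r n))) \<longlonglongrightarrow> y"
    using LIMSEQ_subseq_LIMSEQ[OF x r(1)] LIMSEQ_subseq_LIMSEQ[OF y r(1)] by (simp_all add: o_def)
  then have "x = C1.center s0" "y = C2.center s0"
    using LIMSEQ_unique[OF _ c(1)] LIMSEQ_unique[OF _ c(2)] by auto
  then show ?thesis using Re0 by blast
qed

lemma limit_off_axes:
  assumes x: "(\<lambda>n. \<Psi>1 (s n) (t n)) \<longlonglongrightarrow> x" and y: "(\<lambda>n. \<Psi>2 (s n) (t n)) \<longlonglongrightarrow> y"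
    and Re: "\<And>n. Re (s n) \<le> 0" "\<And>n. Re (t n) \<le> 0" and ux: "u1 x \<noteq> 0" and vx: "v1 x \<noteq> 0"
  shows "\<exists>s0 t0. Re s0 \<le> 0 \<and> Re t0 \<le> 0 \<and> x = \<Psi>1 s0 t0 \<and> y = \<Psi>2 s0 t0"
proof -
  obtain m where m: "m > 0" "(m, 0) \<in> H" using C1.ex_H_first by blast
  obtain m' where m': "m' > 0" "(0, m') \<in> H"
    using bidisc_cover.ex_H_first[OF bidisc_cover_swap[OF C1.bidisc_cover_axioms]] by auto
  obtain r l s0 where r: "strict_mono r" "(\<lambda>n. s (r n) + period (m * l n)) \<longlonglongrightarrow> s0"
    by (rule exp_tendsto_nonzero_subseq[OF limit_u(1)[OF x Re] ux m(1)])
  have lt: "(\<lambda>n. exp (t (r n))) \<longlonglongrightarrow> v1 x"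
    using LIMSEQ_subseq_LIMSEQ[OF limit_u(2)[OF x Re] r(1)] by (simp add: o_def)
  obtain r' l' t0 where r': "strict_mono r'" "(\<lambda>n. t (r (r' n)) + period (m' * l' n)) \<longlonglongrightarrow> t0"
    by (rule exp_tendsto_nonzero_subseq[OF lt vx m'(1)])
  define q where "q n = r (r' n)" for n
  have q: "strict_mono q" unfolding q_def using r(1) r'(1) by (simp add: strict_mono_def)
  define s' where "s' n = s (q n) + period (m * l (r' n))" for n
  define t' where "t' n = t (q n) + period (m' * l' n)" for n
  have lim: "s' \<longlonglongrightarrow> s0" "t' \<longlonglongrightarrow> t0"
    using LIMSEQ_subseq_LIMSEQ[OF r(2) r'(1)] r'(2) by (simp_all add: o_def s'_def[abs_def] t'_def[abs_def] q_def)
  have Re': "Re (s' n) \<le> 0" "Re (t' n) \<le> 0" for n using Re by (simp_all add: s'_def t'_def)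
  have mH: "(m * l (r' n), m' * l' n) \<in> H" for n
    using C1.H_add[OF C1.H_mult[OF m(2), of "l (r' n)"] C1.H_mult[OF m'(2), of "l' n"]] by (simp add: mult.commute)
  have "\<Psi>1 (s' n) (t' n) = \<Psi>1 (s (q n)) (t (q n))" "\<Psi>2 (s' n) (t' n) = \<Psi>2 (s (q n)) (t (q n))" for n
    unfolding s'_def t'_def by (rule C1.Psi_shift[OF Re mH] C2.Psi_shift[OF Re mH])+
  then have c: "(\<lambda>n. \<Psi>1 (s (q n)) (t (q n))) \<longlonglongrightarrow> \<Psi>1 s0 t0" "(\<lambda>n. \<Psi>2 (s (q n)) (t (q n))) \<longlonglongrightarrow> \<Psi>2 s0 t0"
    using C1.Psi_tendsto(1)[OF lim Re'] C2.Psi_tendsto(1)[OF lim Re'] by simp_all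
  have "(\<lambda>n. \<Psi>1 (s (q n)) (t (q n))) \<longlonglongrightarrow> x" "(\<lambda>n. \<Psi>2 (s (q n)) (t (q n))) \<longlonglongrightarrow> y"
    using LIMSEQ_subseq_LIMSEQ[OF x q] LIMSEQ_subseq_LIMSEQ[OF y q] by (simp_all add: o_def)
  then have "x = \<Psi>1 s0 t0" "y = \<Psi>2 s0 t0"
    using LIMSEQ_unique[OF _ c(1)] LIMSEQ_unique[OF _ c(2)] by auto
  then show ?thesis using C1.Psi_tendsto(2,3)[OF lim Re'] by blast
qed

text \<open>The pairing goes through the common parameters \<open>(s, t)\<close> and is therefore
  symmetric in the two covers. The closure adds the points over the axes without a separate
  construction of the extension.\<close>

definition graph :: "('a \<times> 'b) set" where
  "graph = closure ((\<lambda>(s, t). (\<Psi>1 s t, \<Psi>2 s t)) ` (closed_lhp \<times> closed_lhp))"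

lemma graph_sequence:
  assumes "(x, y) \<in> graph"
  obtains s t where "\<And>n. Re (s n) \<le> 0" "\<And>n. Re (t n) \<le> 0"
    "(\<lambda>n::nat. \<Psi>1 (s n) (t n)) \<longlonglongrightarrow> x" "(\<lambda>n. \<Psi>2 (s n) (t n)) \<longlonglongrightarrow> y"
proof -
  obtain z where z: "\<And>n. z n \<in> (\<lambda>(s, t). (\<Psi>1 s t, \<Psi>2 s t)) ` (closed_lhp \<times> closed_lhp)" "z \<longlonglongrightarrow> (x, y)"
    using assms unfolding graph_def closure_sequential by blast
  have "\<exists>s t. Re s \<le> 0 \<and> Re t \<le> 0 \<and> z n = (\<Psi>1 s t, \<Psi>2 s t)" for n
    using z(1)[of n] by auto
  then obtain s t where st: "\<And>n. Re (s n) \<le> 0" "\<And>n. Re (t n) \<le> 0" "\<And>n. z n = (\<Psi>1 (s n) (t n), \<Psi>2 (s n) (t n))"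
    by metis
  show ?thesis
    using that[OF st(1,2)] tendsto_fst[OF z(2)] tendsto_snd[OF z(2)] by (simp add: st(3))
qed

lemma Psi_graph: "Re s \<le> 0 \<Longrightarrow> Re t \<le> 0 \<Longrightarrow> (\<Psi>1 s t, \<Psi>2 s t) \<in> graph"
  unfolding graph_def by (intro subsetD[OF closure_subset] image_eqI[of _ _ "(s, t)"]) auto

lemma graph_K: "graph \<subseteq> K1 \<times> K2"
  unfolding graph_def
  by (intro closure_minimal closed_Times compact_imp_closed[OF C1.compact_K] compact_imp_closed[OF C2.compact_K])
     (auto simp: C1.Psi_K C2.Psi_K)

lemma compact_graph: "compact graph"
proof -
  have "compact ((K1 \<times> K2) \<inter> graph)"
    using closed_closure unfolding graph_def
    by (intro compact_Int_closed compact_Times C1.compact_K C2.compact_K) auto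
  then show ?thesis using graph_K by (simp add: Int_absorb1)
qed

lemma graph_coordinates:
  assumes "(x, y) \<in> graph"
  shows "u1 x = u2 y" "v1 x = v2 y"
proof -
  interpret S: bidisc_cover_pair K2 u2 v2 \<Psi>2 K1 u1 v1 \<Psi>1 H ..
  obtain s t where st: "\<And>n. Re (s n) \<le> 0" "\<And>n. Re (t n) \<le> 0"
    "(\<lambda>n::nat. \<Psi>1 (s n) (t n)) \<longlonglongrightarrow> x" "(\<lambda>n. \<Psi>2 (s n) (t n)) \<longlonglongrightarrow> y"
    using graph_sequence[OF assms] by metis
  show "u1 x = u2 y" "v1 x = v2 y"
    using LIMSEQ_unique[OF limit_u(1)[OF st(3,1,2)] S.limit_u(1)[OF st(4,1,2)]]
      LIMSEQ_unique[OF limit_u(2)[OF st(3,1,2)] S.limit_u(2)[OF st(4,1,2)]] by auto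
qed

lemma fst_graph: "fst ` graph = K1"
proof
  show "fst ` graph \<subseteq> K1" using graph_K by auto
  have "closed (fst ` graph)"
    by (intro compact_imp_closed compact_continuous_image compact_graph continuous_intros)
  moreover have "{x \<in> K1. u1 x \<noteq> 0 \<and> v1 x \<noteq> 0} \<subseteq> fst ` graph"
  proof
    fix x assume "x \<in> {x \<in> K1. u1 x \<noteq> 0 \<and> v1 x \<noteq> 0}"
    then obtain s t where "Re s \<le> 0" "Re t \<le> 0" "\<Psi>1 s t = x" using C1.Psi_surj by blast
    then show "x \<in> fst ` graph" using Psi_graph[of s t] by force
  qed
  ultimately show "K1 \<subseteq> fst ` graph"
    using C1.dense closure_minimal by blast
qed

end

lemma (in bidisc_cover_pair) swap_pair:
  "bidisc_cover_pair K1 v1 u1 (\<lambda>t s. \<Psi>1 s t) K2 v2 u2 (\<lambda>t s. \<Psi>2 s t) (prod.swap ` H)"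
  by (intro bidisc_cover_pair.intro bidisc_cover_swap C1.bidisc_cover_axioms C2.bidisc_cover_axioms)

text \<open>The one consequence of the analytic part that the comparison of two covers needs. It
  lies outside the locale so that it can be stated for both covers and for both axes.\<close>

definition separated_branches :: "'a::euclidean_space set \<Rightarrow> ('a \<Rightarrow> complex) \<Rightarrow> ('a \<Rightarrow> complex) \<Rightarrow>
    (complex \<Rightarrow> complex \<Rightarrow> 'a) \<Rightarrow> (int \<times> int) set \<Rightarrow> bool" where
  "separated_branches K u v \<Psi> H \<longleftrightarrow> (\<forall>s j. Re s \<le> 0 \<longrightarrow>
     bidisc_cover.center K u v \<Psi> (s + period j) = bidisc_cover.center K u v \<Psi> s \<longrightarrow> j \<in> fst ` H)"

context bidisc_cover_pair
begin

text \<open>Two parameters of the same center in \<open>K1\<close> differ by a first component of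
  \<open>H\<close>, because the branches there are separated; the shared lattice then makes the
  corresponding centers in \<open>K2\<close> equal.\<close>

lemma graph_single_valued_axis:
  assumes "separated_branches K1 u1 v1 \<Psi>1 H"
    and "(x, y) \<in> graph" "(x, y') \<in> graph" "u1 x \<noteq> 0" "v1 x = 0"
  shows "y = y'"
proof -
  have "\<exists>s. Re s \<le> 0 \<and> x = C1.center s \<and> z = C2.center s" if xz: "(x, z) \<in> graph" for z
  proof -
    obtain s t where st: "\<And>n. Re (s n) \<le> 0" "\<And>n. Re (t n) \<le> 0"
      "(\<lambda>n::nat. \<Psi>1 (s n) (t n)) \<longlonglongrightarrow> x" "(\<lambda>n. \<Psi>2 (s n) (t n)) \<longlonglongrightarrow> z"
      using graph_sequence[OF xz] by blast
    show ?thesis by (rule limit_over_axis[OF st(3,4,1,2) assms(4,5)])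
  qed
  then obtain s s' where s: "Re s \<le> 0" "x = C1.center s" "y = C2.center s"
    and s': "Re s' \<le> 0" "x = C1.center s'" "y' = C2.center s'" using assms(2,3) by metis
  then have "exp s' = exp s" using C1.u_center by metis
  then obtain j where j: "s' = s + period j" by (auto simp: exp_eq_period)
  then obtain k where "(j, k) \<in> H" using assms(1) s s' unfolding separated_branches_def by force
  then show ?thesis using C2.center_shift[OF s(1)] s s' j by metis
qed

text \<open>Off the axes this is the description of the identifications by \<open>H\<close>, on each
  punctured axis it is separation of branches, and over the origin the target has only one
  point.\<close>

lemma graph_single_valued:
  assumes "separated_branches K1 u1 v1 \<Psi>1 H" "separated_branches K1 v1 u1 (\<lambda>t s. \<Psi>1 s t) (prod.swap ` H)"
    and p: "{y \<in> K2. u2 y = 0 \<and> v2 y = 0} \<subseteq> {p2}"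
    and xy: "(x, y) \<in> graph" "(x, y') \<in> graph"
  shows "y = y'"
proof -
  interpret S: bidisc_cover_pair K1 v1 u1 "\<lambda>t s. \<Psi>1 s t" K2 v2 u2 "\<lambda>t s. \<Psi>2 s t" "prod.swap ` H"
    by (rule swap_pair)
  have Sgraph: "S.graph = graph"
  proof -
    have "(\<lambda>(t, s). (\<Psi>1 s t, \<Psi>2 s t)) ` (closed_lhp \<times> closed_lhp) = (\<lambda>(s, t). (\<Psi>1 s t, \<Psi>2 s t)) ` (closed_lhp \<times> closed_lhp)"
      by (auto simp: image_iff)
    then show ?thesis unfolding S.graph_def graph_def by simp
  qed
  consider "u1 x \<noteq> 0" "v1 x = 0" | "u1 x = 0" "v1 x \<noteq> 0" | "u1 x = 0" "v1 x = 0" | "u1 x \<noteq> 0" "v1 x \<noteq> 0" by blast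
  then show ?thesis
  proof cases
    case 1
    then show ?thesis using graph_single_valued_axis[OF assms(1) xy] by blast
  next
    case 2
    then show ?thesis using S.graph_single_valued_axis[OF assms(2), unfolded Sgraph, OF xy] by blast
  next
    case 3
    then have "y \<in> {y \<in> K2. u2 y = 0 \<and> v2 y = 0}" "y' \<in> {y \<in> K2. u2 y = 0 \<and> v2 y = 0}"
      using xy graph_K graph_coordinates[OF xy(1)] graph_coordinates[OF xy(2)] by auto
    then show ?thesis using p by blast
  next
    case 4
    have "\<exists>s t. Re s \<le> 0 \<and> Re t \<le> 0 \<and> x = \<Psi>1 s t \<and> z = \<Psi>2 s t" if xz: "(x, z) \<in> graph" for z
    proof -
      obtain s t where st: "\<And>n. Re (s n) \<le> 0" "\<And>n. Re (t n) \<le> 0"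
        "(\<lambda>n::nat. \<Psi>1 (s n) (t n)) \<longlonglongrightarrow> x" "(\<lambda>n. \<Psi>2 (s n) (t n)) \<longlonglongrightarrow> z"
        using graph_sequence[OF xz] by blast
      show ?thesis by (rule limit_off_axes[OF st(3,4,1,2) 4])
    qed
    then obtain s t s' t' where s: "Re s \<le> 0" "Re t \<le> 0" "x = \<Psi>1 s t" "y = \<Psi>2 s t"
      and s': "Re s' \<le> 0" "Re t' \<le> 0" "x = \<Psi>1 s' t'" "y' = \<Psi>2 s' t'" using xy by metis
    then have "\<exists>j k. (j, k) \<in> H \<and> s' = s + period j \<and> t' = t + period k"
      using C1.Psi_eq[OF s(1,2) s'(1,2)] by simp
    then show ?thesis using C2.Psi_eq[OF s(1,2) s'(1,2)] s(4) s'(4) by simp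
  qed
qed

proposition bidisc_covers_homeomorphic:
  assumes "separated_branches K1 u1 v1 \<Psi>1 H" "separated_branches K1 v1 u1 (\<lambda>t s. \<Psi>1 s t) (prod.swap ` H)"
    and "separated_branches K2 u2 v2 \<Psi>2 H" "separated_branches K2 v2 u2 (\<lambda>t s. \<Psi>2 s t) (prod.swap ` H)"
    and p1: "{x \<in> K1. u1 x = 0 \<and> v1 x = 0} = {p1}" and p2: "{y \<in> K2. u2 y = 0 \<and> v2 y = 0} = {p2}"
  obtains f g where "homeomorphism K1 K2 f g" "f p1 = p2"
    "\<And>x. x \<in> K1 \<Longrightarrow> u1 x = u2 (f x) \<and> v1 x = v2 (f x)"
proof -
  interpret S: bidisc_cover_pair K2 u2 v2 \<Psi>2 K1 u1 v1 \<Psi>1 H ..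
  have Sgraph: "S.graph = prod.swap ` graph"
  proof -
    have "closed (prod.swap ` graph)"
      by (intro compact_imp_closed compact_continuous_image continuous_on_swap compact_graph)
    moreover have "closed (prod.swap ` S.graph)"
      by (intro compact_imp_closed compact_continuous_image continuous_on_swap S.compact_graph)
    moreover have "(\<lambda>(s, t). (\<Psi>2 s t, \<Psi>1 s t)) ` (closed_lhp \<times> closed_lhp) \<subseteq> prod.swap ` graph"
      using Psi_graph by force
    moreover have "(\<lambda>(s, t). (\<Psi>1 s t, \<Psi>2 s t)) ` (closed_lhp \<times> closed_lhp) \<subseteq> prod.swap ` S.graph"
      using S.Psi_graph by force
    ultimately have "S.graph \<subseteq> prod.swap ` graph" "graph \<subseteq> prod.swap ` S.graph"
      unfolding S.graph_def[of] graph_def[of] by (meson closure_minimal)+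
    then show ?thesis by force
  qed
  have S_iff: "(y, x) \<in> S.graph \<longleftrightarrow> (x, y) \<in> graph" for x y
    unfolding Sgraph by force
  have ex1: "\<exists>y. (x, y) \<in> graph" if "x \<in> K1" for x
    using that fst_graph by force
  have ex2: "\<exists>x. (x, y) \<in> graph" if "y \<in> K2" for y
    using that S.fst_graph S_iff by force
  define f where "f x = (SOME y. (x, y) \<in> graph)" for x
  define g where "g y = (SOME x. (x, y) \<in> graph)" for y
  have f0: "(x, f x) \<in> graph" if "x \<in> K1" for x
    unfolding f_def by (rule someI_ex[OF ex1[OF that]])
  have g0: "(g y, y) \<in> graph" if "y \<in> K2" for y
    unfolding g_def by (rule someI_ex[OF ex2[OF that]])
  have f: "(x, y) \<in> graph \<longleftrightarrow> x \<in> K1 \<and> y = f x" for x y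
  proof
    assume xy: "(x, y) \<in> graph"
    then have "x \<in> K1" using graph_K by auto
    then show "x \<in> K1 \<and> y = f x"
      using graph_single_valued[OF assms(1,2) equalityD1[OF p2] xy f0] by simp
  qed (use f0 in auto)
  have g: "(x, y) \<in> graph \<longleftrightarrow> y \<in> K2 \<and> x = g y" for x y
  proof
    assume xy: "(x, y) \<in> graph"
    then have "y \<in> K2" using graph_K by auto
    then show "y \<in> K2 \<and> x = g y"
      using S.graph_single_valued[OF assms(3,4) equalityD1[OF p1], unfolded S_iff, OF xy g0] by simp
  qed (use g0 in auto)
  have fK: "f x \<in> K2" if "x \<in> K1" for x using f graph_K that by blast
  have gK: "g y \<in> K1" if "y \<in> K2" for y using g graph_K that by blast
  have "homeomorphism K1 K2 f g"
  proof (rule homeomorphismI)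
    \<comment> \<open>A function into a compact space whose graph is closed is continuous.\<close>
    have "(\<lambda>x. (x, f x)) ` K1 = graph" using f by auto
    then show "continuous_on K1 f"
      using compact_imp_closed[OF compact_graph] fK
      by (intro continuous_from_closed_graph[OF C2.compact_K]) auto
    have "(\<lambda>y. (y, g y)) ` K2 = S.graph" using g S_iff by auto
    then show "continuous_on K2 g"
      using compact_imp_closed[OF S.compact_graph] gK
      by (intro continuous_from_closed_graph[OF C1.compact_K]) auto
    show "f ` K1 \<subseteq> K2" "g ` K2 \<subseteq> K1" using fK gK by auto
    show "g (f x) = x" if "x \<in> K1" for x using f g that by metis
    show "f (g y) = y" if "y \<in> K2" for y using f g that by metis
  qed
  moreover have coord: "u1 x = u2 (f x) \<and> v1 x = v2 (f x)" if "x \<in> K1" for x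
    using graph_coordinates[of x "f x"] f that by blast
  moreover have "f p1 = p2"
  proof -
    have "p1 \<in> K1" "u1 p1 = 0" "v1 p1 = 0" using p1 by auto
    then have "f p1 \<in> {y \<in> K2. u2 y = 0 \<and> v2 y = 0}" using coord[of p1] fK by auto
    then show ?thesis using p2 by blast
  qed
  ultimately show ?thesis using that by blast
qed

end

section \<open>The lattice of a lens space\<close>

lemma nonzero_loop_exp:
  assumes "path \<gamma>" "pathfinish \<gamma> = pathstart \<gamma>" "0 \<notin> path_image \<gamma>"
  obtains s j where "path s" "\<And>t. t \<in> {0..1} \<Longrightarrow> \<gamma> t = exp (s t)" "s 1 = s 0 + period j"
    "winding_number \<gamma> 0 = of_int j"
proof -
  have "\<gamma> 0 \<noteq> 0" using assms(3) by (force simp: path_image_def)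
  obtain s where s: "path s" "\<And>t. t \<in> {0..1} \<Longrightarrow> exp (s t) = \<gamma> t"
  proof (rule covering_space_lift_path_strong[OF covering_space_exp_punctured_plane, of "Ln (\<gamma> 0)" \<gamma>])
    show "path_image \<gamma> \<subseteq> - {0}" using assms(3) by auto
    show "pathstart \<gamma> = exp (Ln (\<gamma> 0))" using \<open>\<gamma> 0 \<noteq> 0\<close> by (simp add: pathstart_def)
  qed (use assms(1) in auto)
  have "exp (s 1) = exp (s 0)"
    using s(2)[of 0] s(2)[of 1] assms(2) by (simp add: pathfinish_def pathstart_def)
  then obtain j where j: "s 1 = s 0 + period j" by (auto simp: exp_eq_period)
  show ?thesis
    using that[OF s(1) _ j] winding_number_exp_path[OF s(1) _ j, of \<gamma>] s(2) by metis
qed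

lemma int_shift_of_unit_shift:
  fixes g :: "real \<Rightarrow> complex"
  assumes "\<And>x. g (x + p) = g x + period a"
  shows "g (x + p * of_int j) = g x + period (a * j)"
proof (induction j rule: int_induct[where k = 0])
  case (step1 i)
  then show ?case using assms[of "x + p * of_int i"] by (simp add: algebra_simps period_add)
next
  case (step2 i)
  then show ?case using assms[of "x + p * of_int (i - 1)"] by (simp add: algebra_simps period_diff)
qed simp

text \<open>The plane is contractible, so \<open>F\<close> has a logarithm. Its change under either
  translation is continuous with values in a discrete set, hence constant; \<open>a\<close> and
  \<open>b\<close> are the winding numbers of \<open>F\<close> around the two factor
  circles.\<close>

lemma doubly_periodic_logarithm:
  fixes F :: "real \<times> real \<Rightarrow> complex"
  assumes F: "continuous_on UNIV F" "\<And>z. F z \<noteq> 0"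
    and per: "\<And>x y. F (x + 2 * pi, y) = F (x, y)" "\<And>x y. F (x, y + 2 * pi) = F (x, y)"
  obtains G a b where "continuous_on UNIV G" "\<And>z. F z = exp (G z)"
    "\<And>x y j k. G (x + 2 * pi * of_int j, y + 2 * pi * of_int k) = G (x, y) + period (a * j + b * k)"
proof -
  obtain G where G: "continuous_on UNIV G" "\<And>z. F z = exp (G z)"
    using continuous_logarithm_on_contractible[OF F(1)] F(2) contractible_UNIV by auto
  have shift: "\<exists>a. \<forall>z. G (T z) = G z + period a"
    if T: "continuous_on UNIV T" "\<And>z. F (T z) = F z" for T
  proof -
    define D where "D z = G (T z) - G z" for z
    have "continuous_on UNIV D"
      unfolding D_def using continuous_on_compose2[OF G(1) T(1)] G(1) by (auto intro!: continuous_intros)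
    have Dp: "\<exists>j. D z = period j" for z
    proof -
      have "exp (G (T z)) = exp (G z)" using T(2)[of z] G(2) by simp
      then show ?thesis by (auto simp: exp_eq_period D_def)
    qed
    have "\<exists>c. \<forall>z\<in>UNIV. D z = c"
    proof (rule continuous_discrete_range_constant[OF connected_UNIV \<open>continuous_on UNIV D\<close>, unfolded constant_on_def])
      fix z
      have "1 \<le> norm (D y - D z)" if ne: "D y \<noteq> D z" for y
      proof -
        obtain j k where jk: "D y = period j" "D z = period k" using Dp by metis
        then have "j \<noteq> k" using ne by auto
        then have "1 \<le> \<bar>real_of_int (j - k)\<bar>" by linarith
        then have "2 * pi * 1 \<le> 2 * pi * \<bar>real_of_int (j - k)\<bar>" by (intro mult_left_mono) auto
        moreover have "1 \<le> 2 * pi" using pi_ge_two by linarith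
        moreover have "norm (D y - D z) = 2 * pi * \<bar>real_of_int (j - k)\<bar>"
          unfolding jk period_diff[symmetric] norm_period ..
        ultimately show ?thesis by linarith
      qed
      then show "\<exists>e>0. \<forall>y. y \<in> UNIV \<and> D y \<noteq> D z \<longrightarrow> e \<le> norm (D y - D z)"
        by (intro exI[of _ 1]) auto
    qed
    then obtain c where "\<And>z. D z = c" by blast
    then show ?thesis using Dp unfolding D_def by (metis diff_eq_eq add.commute)
  qed
  obtain a where a: "\<And>x y. G (x + 2 * pi, y) = G (x, y) + period a"
    using shift[of "\<lambda>z. (fst z + 2 * pi, snd z)"] per(1) by (force intro!: continuous_intros)
  obtain b where b: "\<And>x y. G (x, y + 2 * pi) = G (x, y) + period b"
    using shift[of "\<lambda>z. (fst z, snd z + 2 * pi)"] per(2) by (force intro!: continuous_intros)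
  have "G (x + 2 * pi * of_int j, y + 2 * pi * of_int k) = G (x, y) + period (a * j + b * k)" for x y j k
    using int_shift_of_unit_shift[of "\<lambda>x. G (x, y + 2 * pi * of_int k)" "2 * pi" a x j]
      int_shift_of_unit_shift[of "\<lambda>y. G (x, y)" "2 * pi" b y k] a b by (simp add: period_add)
  then show ?thesis using that[OF G] by blast
qed

lemma vector2_eq_lambda: "(\<lambda>t. vector [f t, g t] :: complex^2) = (\<lambda>t. \<chi> i. if i = 1 then f t else g t)"
  by (auto simp: vec_eq_iff forall_2)

lemma continuous_on_vector2 [continuous_intros]:
  assumes "continuous_on S f" "continuous_on S g"
  shows "continuous_on S (\<lambda>t. vector [f t, g t] :: complex^2)"
  unfolding vector2_eq_lambda
proof (rule continuous_on_vec_lambda)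
  show "continuous_on S (\<lambda>t. if i = 1 then f t else g t)" for i :: 2
    using assms by (cases "i = 1") simp_all
qed

text \<open>The integer functional that \<open>f\<close> induces on the first homology group of the
  torus, made explicit by a logarithm on the universal cover. The winding numbers of the coordinates
  of \<open>h' \<circ> \<gamma>\<close> are the homology coordinates of
  \<open>\<gamma>\<close>.\<close>

lemma torus_loop_winding_linear:
  fixes h :: "complex^2 \<Rightarrow> 'a::topological_space" and h' :: "'a \<Rightarrow> complex^2" and f :: "'a \<Rightarrow> complex"
  assumes h: "homeomorphism (bidisc \<S> \<S>) \<tau> h h'" and f: "continuous_on \<tau> f" "\<And>x. x \<in> \<tau> \<Longrightarrow> f x \<noteq> 0"
  obtains a b :: int where "\<And>\<gamma> j k. path \<gamma> \<Longrightarrow> pathfinish \<gamma> = pathstart \<gamma> \<Longrightarrow> path_image \<gamma> \<subseteq> \<tau> \<Longrightarrow>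
      winding_number (\<lambda>t. (h' \<circ> \<gamma>) t $ 1) 0 = of_int j \<Longrightarrow> winding_number (\<lambda>t. (h' \<circ> \<gamma>) t $ 2) 0 = of_int k \<Longrightarrow>
      winding_number (f \<circ> \<gamma>) 0 = of_int (a * j + b * k)"
proof -
  define T where "T z = (vector [cis (fst z), cis (snd z)] :: complex^2)" for z
  have T: "T z \<in> bidisc \<S> \<S>" for z by (simp add: T_def bidisc_def)
  have contT: "continuous_on UNIV T"
    unfolding T_def cis_conv_exp by (intro continuous_intros)
  define F where "F z = f (h (T z))" for z
  have hT: "h (T z) \<in> \<tau>" for z using h T unfolding homeomorphism_def by blast
  have "continuous_on UNIV (\<lambda>z. h (T z))"
    using T by (intro continuous_on_compose2[OF homeomorphism_cont1[OF h] contT]) auto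
  then have F: "continuous_on UNIV F"
    unfolding F_def using hT by (intro continuous_on_compose2[OF f(1)]) auto
  have F0: "F z \<noteq> 0" for z unfolding F_def using f(2) hT by blast
  have per: "F (x + 2 * pi, y) = F (x, y)" "F (x, y + 2 * pi) = F (x, y)" for x y
    by (simp_all add: F_def T_def cis.ctr)
  obtain G a b where G: "continuous_on UNIV G" "\<And>z. F z = exp (G z)"
    "\<And>x y j k. G (x + 2 * pi * of_int j, y + 2 * pi * of_int k) = G (x, y) + period (a * j + b * k)"
    using doubly_periodic_logarithm[OF F F0 per] by blast
  have "winding_number (f \<circ> \<gamma>) 0 = of_int (a * j + b * k)"
    if \<gamma>: "path \<gamma>" "pathfinish \<gamma> = pathstart \<gamma>" "path_image \<gamma> \<subseteq> \<tau>"
      and w: "winding_number (\<lambda>t. (h' \<circ> \<gamma>) t $ 1) 0 = of_int j" "winding_number (\<lambda>t. (h' \<circ> \<gamma>) t $ 2) 0 = of_int k" for \<gamma> j k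
  proof -
    have \<gamma>\<tau>: "\<gamma> t \<in> \<tau>" if "t \<in> {0..1}" for t using \<gamma>(3) that by (auto simp: path_image_def)
    have h'\<gamma>: "h' (\<gamma> t) \<in> bidisc \<S> \<S>" "h (h' (\<gamma> t)) = \<gamma> t" if "t \<in> {0..1}" for t
      using h \<gamma>\<tau>[OF that] unfolding homeomorphism_def by blast+
    have ph: "path (h' \<circ> \<gamma>)"
      using \<gamma> by (intro path_continuous_image) (auto intro: continuous_on_subset[OF homeomorphism_cont2[OF h]])
    have comp: "\<exists>s. path s \<and> (\<forall>t\<in>{0..1}. Re (s t) = 0 \<and> (h' \<circ> \<gamma>) t $ i = exp (s t)) \<and> s 1 = s 0 + period l"
      if "winding_number (\<lambda>t. (h' \<circ> \<gamma>) t $ i) 0 = of_int l" and i: "\<And>w. w \<in> bidisc \<S> \<S> \<Longrightarrow> norm (w $ i) = 1" for i l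
    proof -
      have nrm: "norm ((h' \<circ> \<gamma>) t $ i) = 1" if "t \<in> {0..1}" for t using i h'\<gamma>(1)[OF that] by simp
      have 1: "path (\<lambda>t. (h' \<circ> \<gamma>) t $ i)"
        using path_continuous_image[OF ph, of "\<lambda>w. w $ i"] by (simp add: o_def continuous_intros)
      have 2: "pathfinish (\<lambda>t. (h' \<circ> \<gamma>) t $ i) = pathstart (\<lambda>t. (h' \<circ> \<gamma>) t $ i)"
        using \<gamma>(2) by (simp add: pathfinish_def pathstart_def)
      have 3: "0 \<notin> path_image (\<lambda>t. (h' \<circ> \<gamma>) t $ i)"
        using nrm by (force simp: path_image_def)
      obtain s l' where s: "path s" "\<And>t. t \<in> {0..1} \<Longrightarrow> (h' \<circ> \<gamma>) t $ i = exp (s t)" "s 1 = s 0 + period l'"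
          "winding_number (\<lambda>t. (h' \<circ> \<gamma>) t $ i) 0 = of_int l'"
        using nonzero_loop_exp[OF 1 2 3] by blast
      have "Re (s t) = 0" if "t \<in> {0..1}" for t
        using nrm[OF that] s(2)[OF that] by (simp add: norm_exp_eq_Re)
      moreover have "l' = l" using s(4) \<open>winding_number _ 0 = of_int l\<close> by simp
      ultimately show ?thesis using s by blast
    qed
    obtain s1 where s1: "path s1" "\<And>t. t \<in> {0..1} \<Longrightarrow> Re (s1 t) = 0 \<and> (h' \<circ> \<gamma>) t $ 1 = exp (s1 t)" "s1 1 = s1 0 + period j"
      using comp[OF w(1)] by (auto simp: bidisc_def)
    obtain s2 where s2: "path s2" "\<And>t. t \<in> {0..1} \<Longrightarrow> Re (s2 t) = 0 \<and> (h' \<circ> \<gamma>) t $ 2 = exp (s2 t)" "s2 1 = s2 0 + period k"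
      using comp[OF w(2)] by (auto simp: bidisc_def)
    have "\<gamma> t = h (T (Im (s1 t), Im (s2 t)))" if "t \<in> {0..1}" for t
    proof -
      have "exp (s1 t) = cis (Im (s1 t))" "exp (s2 t) = cis (Im (s2 t))"
        using s1(2)[OF that] s2(2)[OF that] by (simp_all add: exp_eq_polar)
      then have "h' (\<gamma> t) = T (Im (s1 t), Im (s2 t))"
        using s1(2)[OF that] s2(2)[OF that] by (simp add: T_def vec_eq_iff forall_2)
      then show ?thesis using h'\<gamma>(2)[OF that] by simp
    qed
    then have fe: "(f \<circ> \<gamma>) t = exp (G (Im (s1 t), Im (s2 t)))" if "t \<in> {0..1}" for t
      using that G(2) by (simp add: F_def)
    have "path (\<lambda>t. G (Im (s1 t), Im (s2 t)))"
      using s1(1) s2(1) unfolding path_def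
      by (intro continuous_on_compose2[OF G(1)] continuous_intros) auto
    moreover have "G (Im (s1 1), Im (s2 1)) = G (Im (s1 0), Im (s2 0)) + period (a * j + b * k)"
      using G(3)[of "Im (s1 0)" j "Im (s2 0)" k] s1(3) s2(3) by (simp add: Im_period)
    ultimately show ?thesis by (intro winding_number_exp_path[OF _ fe]) auto
  qed
  then show ?thesis using that by blast
qed

section \<open>Winding numbers along powers and meridians, and loops in solid tori\<close>

lemma loop_power_props:
  assumes "path \<gamma>" "pathfinish \<gamma> = pathstart \<gamma>"
  shows "path (loop_power \<gamma> k) \<and> pathstart (loop_power \<gamma> k) = pathstart \<gamma> \<and>
    pathfinish (loop_power \<gamma> k) = pathstart \<gamma> \<and> path_image (loop_power \<gamma> k) \<subseteq> path_image \<gamma>"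
proof (induction k)
  case 0
  then show ?case
    by (auto simp: path_def pathstart_def pathfinish_def path_image_def)
next
  case (Suc k)
  then show ?case using assms path_image_join_subset[of \<gamma> "loop_power \<gamma> k"] by auto
qed

lemma winding_number_loop_power:
  assumes \<gamma>: "path \<gamma>" "pathfinish \<gamma> = pathstart \<gamma>"
    and f: "continuous_on (path_image \<gamma>) f" "\<And>x. x \<in> path_image \<gamma> \<Longrightarrow> f x \<noteq> 0"
  shows "winding_number (f \<circ> loop_power \<gamma> k) 0 = of_nat k * winding_number (f \<circ> \<gamma>) 0"
proof (induction k)
  case 0
  then show ?case
    using winding_number_exp_path[of "\<lambda>_. Ln (f (pathstart \<gamma>))" "f \<circ> loop_power \<gamma> 0" 0] f(2)[OF pathstart_in_path_image]
    by (simp add: path_def)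
next
  case (Suc k)
  have p: "path (f \<circ> \<gamma>)" "path (f \<circ> loop_power \<gamma> k)"
    using \<gamma> f loop_power_props[OF \<gamma>, of k] by (auto intro!: path_continuous_image intro: continuous_on_subset)
  have "0 \<notin> path_image (f \<circ> \<gamma>)" "0 \<notin> path_image (f \<circ> loop_power \<gamma> k)"
    using f(2) loop_power_props[OF \<gamma>, of k] unfolding path_image_compose by force+
  moreover have "pathfinish (f \<circ> \<gamma>) = pathstart (f \<circ> loop_power \<gamma> k)"
    using loop_power_props[OF \<gamma>, of k] \<gamma> by (simp add: pathfinish_compose pathstart_compose)
  ultimately have join: "winding_number ((f \<circ> \<gamma>) +++ (f \<circ> loop_power \<gamma> k)) 0 =
      winding_number (f \<circ> \<gamma>) 0 + winding_number (f \<circ> loop_power \<gamma> k) 0"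
    using p by (intro winding_number_join)
  have eq: "f \<circ> loop_power \<gamma> (Suc k) = (f \<circ> \<gamma>) +++ (f \<circ> loop_power \<gamma> k)"
    by (simp add: path_compose_join)
  show ?case unfolding eq join Suc by (simp only: of_nat_Suc ring_distribs mult_1_left)
qed

text \<open>A nowhere vanishing function has a logarithm on the disc bounded by the meridian, so the
  logarithm returns to its initial value.\<close>

lemma winding_number_meridian:
  fixes T :: "'a::topological_space set"
  assumes m: "meridian T \<tau> m" and f: "continuous_on T f" "\<And>x. x \<in> T \<Longrightarrow> f x \<noteq> 0"
  shows "winding_number (f \<circ> m) 0 = 0"
proof -
  obtain \<Delta> g g' where g: "\<Delta> \<subseteq> T" "homeomorphism \<D> \<Delta> g g'" "g ` \<S> = path_image m"
    using m unfolding meridian_def by blast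
  have pm: "path m" "pathfinish m = pathstart m"
    using m unfolding meridian_def simple_closed_curve_on_def by (auto simp: simple_path_imp_path)
  have gT: "g z \<in> T" if "z \<in> \<D>" for z using g that unfolding homeomorphism_def by blast
  have cfg: "continuous_on \<D> (\<lambda>z. f (g z))"
    using gT by (intro continuous_on_compose2[OF f(1) homeomorphism_cont1[OF g(2)]]) auto
  have nz: "f (g z) \<noteq> 0" if "z \<in> \<D>" for z using f(2) gT[OF that] by blast
  obtain L where L: "continuous_on \<D> L" "\<And>z. z \<in> \<D> \<Longrightarrow> f (g z) = exp (L z)"
    using continuous_logarithm_on_cball[OF cfg nz] by blast
  have mS: "m t \<in> g ` \<S>" if "t \<in> {0..1}" for t using g(3) that by (auto simp: path_image_def)
  have sub: "path_image m \<subseteq> \<Delta>"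
    using image_mono[OF sphere_cball, of g 0 1] g(3) homeomorphism_image1[OF g(2)] by simp
  then have m\<Delta>: "m t \<in> \<Delta>" if "t \<in> {0..1}" for t using that by (auto simp: path_image_def)
  have g'm: "g' (m t) \<in> \<D>" "g (g' (m t)) = m t" if "t \<in> {0..1}" for t
    using homeomorphism_apply2[OF g(2) m\<Delta>[OF that]] homeomorphism_image2[OF g(2)] m\<Delta>[OF that] by blast+
  have "path (L \<circ> (g' \<circ> m))"
  proof (rule path_continuous_image)
    show "path (g' \<circ> m)"
      using pm(1) sub by (intro path_continuous_image continuous_on_subset[OF homeomorphism_cont2[OF g(2)]])
    show "continuous_on (path_image (g' \<circ> m)) L"
      using g'm(1) by (intro continuous_on_subset[OF L(1)]) (auto simp: path_image_def)
  qed
  moreover have "(f \<circ> m) t = exp ((L \<circ> (g' \<circ> m)) t)" if "t \<in> {0..1}" for t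
    using L(2)[OF g'm(1)[OF that]] g'm(2)[OF that] by simp
  moreover have "(L \<circ> (g' \<circ> m)) 1 = (L \<circ> (g' \<circ> m)) 0 + period 0"
    using pm(2) by (simp add: pathfinish_def pathstart_def)
  ultimately show ?thesis using winding_number_exp_path[of "L \<circ> (g' \<circ> m)" "f \<circ> m" 0] by simp
qed

lemma solid_torus_loop_to_boundary:
  fixes T :: "'a::real_normed_vector set"
  assumes T: "solid_torus_with_boundary T \<tau>"
    and \<gamma>: "path \<gamma>" "pathfinish \<gamma> = pathstart \<gamma>" "path_image \<gamma> \<subseteq> T"
  shows "\<exists>\<gamma>'. homotopic_loops T \<gamma> \<gamma>' \<and> path_image \<gamma>' \<subseteq> \<tau>"
proof -
  obtain g g' where g: "homeomorphism (bidisc \<D> \<S>) T g g'" "g ` bidisc \<S> \<S> = \<tau>"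
    using T unfolding solid_torus_with_boundary_def by blast
  define \<zeta> where "\<zeta> = g' \<circ> \<gamma>"
  \<comment> \<open>The disc factor is convex, so its coordinate slides linearly to the boundary
    point 1 while the circle coordinate stays fixed.\<close>
  define \<zeta>' where "\<zeta>' t = (vector [1, \<zeta> t $ 2] :: complex^2)" for t
  have \<gamma>T: "\<gamma> t \<in> T" if "t \<in> {0..1}" for t using \<gamma>(3) that by (auto simp: path_image_def)
  have \<zeta>: "\<zeta> t \<in> bidisc \<D> \<S>" "g (\<zeta> t) = \<gamma> t" if "t \<in> {0..1}" for t
    using g(1) \<gamma>T[OF that] unfolding homeomorphism_def \<zeta>_def o_def by blast+
  have p\<zeta>: "path \<zeta>"
    unfolding \<zeta>_def using \<gamma> by (intro path_continuous_image continuous_on_subset[OF homeomorphism_cont2[OF g(1)]])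
  have p\<zeta>': "path \<zeta>'"
    using p\<zeta> unfolding path_def \<zeta>'_def by (intro continuous_intros)
  have l\<zeta>: "pathfinish \<zeta> = pathstart \<zeta>" "pathfinish \<zeta>' = pathstart \<zeta>'"
    using \<gamma>(2) by (simp_all add: pathfinish_def pathstart_def \<zeta>_def \<zeta>'_def)
  have "homotopic_loops (bidisc \<D> \<S>) \<zeta> \<zeta>'"
  proof (rule homotopic_loops_linear[OF p\<zeta> p\<zeta>' l\<zeta>])
    fix t :: real assume t: "t \<in> {0..1}"
    show "closed_segment (\<zeta> t) (\<zeta>' t) \<subseteq> bidisc \<D> \<S>"
    proof
      fix w assume "w \<in> closed_segment (\<zeta> t) (\<zeta>' t)"
      then obtain r where r: "0 \<le> r" "r \<le> 1" "w = (1 - r) *\<^sub>R \<zeta> t + r *\<^sub>R \<zeta>' t"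
        by (auto simp: closed_segment_def)
      have "w $ 1 \<in> \<D>"
      proof -
        have "w $ 1 = (1 - r) *\<^sub>R (\<zeta> t $ 1) + r *\<^sub>R 1" by (simp add: r(3) \<zeta>'_def)
        moreover have "\<zeta> t $ 1 \<in> \<D>" "(1::complex) \<in> \<D>" using \<zeta>(1)[OF t] by (auto simp: bidisc_def)
        ultimately show ?thesis using r(1,2) convexD_alt[OF convex_cball, of "\<zeta> t $ 1" "0::complex" 1 1 r] by simp
      qed
      moreover have "w $ 2 = \<zeta> t $ 2" by (simp add: r(3) \<zeta>'_def algebra_simps flip: scaleR_add_left)
      ultimately show "w \<in> bidisc \<D> \<S>" using \<zeta>(1)[OF t] by (simp add: bidisc_def)
    qed
  qed
  then have hom: "homotopic_loops T (g \<circ> \<zeta>) (g \<circ> \<zeta>')"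
    using g(1) unfolding homeomorphism_def by (intro homotopic_loops_continuous_image) auto
  have "homotopic_loops T \<gamma> (g \<circ> \<zeta>)"
    using \<zeta>(2) \<gamma> by (intro homotopic_loops_eq) (auto simp: pathfinish_def pathstart_def)
  then have "homotopic_loops T \<gamma> (g \<circ> \<zeta>')" using hom homotopic_loops_trans by blast
  moreover have "\<zeta>' t \<in> bidisc \<S> \<S>" if "t \<in> {0..1}" for t
    using \<zeta>(1)[OF that] by (auto simp: bidisc_def \<zeta>'_def)
  then have "path_image (g \<circ> \<zeta>') \<subseteq> \<tau>" using g(2) by (auto simp: path_image_def)
  ultimately show ?thesis by blast
qed

text \<open>For coprime \<open>q\<close> and \<open>n\<close>, the sublattice of \<open>\<int>\<^sup>2\<close> that belongs to the covering of the
  torus \<open>S \<times> S\<close> by the torus of the lens space \<open>L(n, q)\<close>.\<close>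

definition lens_lattice :: "int \<Rightarrow> int \<Rightarrow> int \<Rightarrow> int \<Rightarrow> (int \<times> int) set" where
  "lens_lattice n q \<alpha> \<beta> = {(n * \<alpha> * j + q * \<alpha> * k, \<beta> * k) | j k. True}"

text \<open>By Bezout, \<open>n * j + q * k\<close> takes every integer value. So the first
  components form \<open>\<alpha> \<int>\<close>, although the sublattice with vanishing second
  component consists of multiples of \<open>n * \<alpha>\<close>.\<close>

lemma fst_lens_lattice:
  assumes "coprime n q"
  shows "fst ` lens_lattice n q \<alpha> \<beta> = range ((*) \<alpha>)"
proof
  show "fst ` lens_lattice n q \<alpha> \<beta> \<subseteq> range ((*) \<alpha>)"
  proof -
    have "n * \<alpha> * j + q * \<alpha> * k = \<alpha> * (n * j + q * k)" for j k by (simp add: algebra_simps)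
    then show ?thesis by (auto simp: lens_lattice_def)
  qed
  show "range ((*) \<alpha>) \<subseteq> fst ` lens_lattice n q \<alpha> \<beta>"
  proof clarify
    fix l :: int
    obtain x y where "x * n + y * q = 1"
      using assms bezout_int[of n q] by (auto simp: coprime_iff_gcd_eq_1)
    then have "\<alpha> * l = \<alpha> * l * (x * n + y * q)" by simp
    also have "\<dots> = n * \<alpha> * (x * l) + q * \<alpha> * (y * l)" by (simp add: algebra_simps)
    finally show "\<alpha> * l \<in> fst ` lens_lattice n q \<alpha> \<beta>"
      unfolding lens_lattice_def by (intro image_eqI[of _ _ "(\<alpha> * l, \<beta> * (y * l))"]) auto
  qed
qed

lemma snd_lens_lattice: "snd ` lens_lattice n q \<alpha> \<beta> = range ((*) \<beta>)"
  by (force simp: lens_lattice_def)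

text \<open>Meridians and parallels determine the generators only up to a common sign; this lets
  both be taken positive.\<close>

lemma lens_lattice_uminus: "lens_lattice n q (- \<alpha>) (- \<beta>) = lens_lattice n q \<alpha> \<beta>"
proof -
  have sub: "lens_lattice n q (- \<alpha>) (- \<beta>) \<subseteq> lens_lattice n q \<alpha> \<beta>" for \<alpha> \<beta>
  proof
    fix z assume "z \<in> lens_lattice n q (- \<alpha>) (- \<beta>)"
    then obtain j k where "z = (n * - \<alpha> * j + q * - \<alpha> * k, - \<beta> * k)" by (auto simp: lens_lattice_def)
    then have "z = (n * \<alpha> * (- j) + q * \<alpha> * (- k), \<beta> * (- k))" by simp
    then show "z \<in> lens_lattice n q \<alpha> \<beta>" unfolding lens_lattice_def by blast
  qed
  then show ?thesis using sub[of "- \<alpha>" "- \<beta>"] by auto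
qed

lemma winding_number_power_difference:
  assumes l: "path l" "pathfinish l = pathstart l" and m: "path m" "pathfinish m = pathstart m"
    and start: "pathstart l = pathstart m"
    and f: "continuous_on A f" "\<And>x. x \<in> A \<Longrightarrow> f x \<noteq> 0" and A: "path_image l \<subseteq> A" "path_image m \<subseteq> A"
  shows "winding_number (f \<circ> (loop_power l n +++ reversepath (loop_power m q))) 0 =
    of_nat n * winding_number (f \<circ> l) 0 - of_nat q * winding_number (f \<circ> m) 0"
proof -
  let ?L = "loop_power l n" and ?M = "loop_power m q"
  note L = loop_power_props[OF l, of n] and M = loop_power_props[OF m, of q]
  have sub: "path_image ?L \<subseteq> A" "path_image ?M \<subseteq> A" using L M A by auto
  have p: "path (f \<circ> ?L)" "path (f \<circ> ?M)"
    using L M by (auto intro!: path_continuous_image continuous_on_subset[OF f(1)] sub)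
  have nz: "0 \<notin> path_image (f \<circ> ?L)" "0 \<notin> path_image (f \<circ> ?M)"
    using f(2) L M A unfolding path_image_compose by force+
  have "f \<circ> (?L +++ reversepath ?M) = (f \<circ> ?L) +++ reversepath (f \<circ> ?M)"
    by (simp add: path_compose_join path_compose_reversepath)
  moreover have "winding_number ((f \<circ> ?L) +++ reversepath (f \<circ> ?M)) 0 =
      winding_number (f \<circ> ?L) 0 + winding_number (reversepath (f \<circ> ?M)) 0"
    using p nz L M start by (intro winding_number_join) (auto simp: pathfinish_compose pathstart_compose)
  moreover have "winding_number (f \<circ> ?L) 0 = of_nat n * winding_number (f \<circ> l) 0"
    using f A by (intro winding_number_loop_power[OF l]) (auto intro: continuous_on_subset)
  moreover have "winding_number (f \<circ> ?M) 0 = of_nat q * winding_number (f \<circ> m) 0"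
    using f A by (intro winding_number_loop_power[OF m]) (auto intro: continuous_on_subset)
  ultimately show ?thesis
    using winding_number_reversepath[OF p(2) nz(2)] by simp
qed

lemma homotopic_loops_winding_number_eq:
  assumes "homotopic_loops A \<gamma> \<gamma>'" "continuous_on A f" "\<And>x. x \<in> A \<Longrightarrow> f x \<noteq> 0"
  shows "winding_number (f \<circ> \<gamma>) 0 = winding_number (f \<circ> \<gamma>') 0"
proof (rule winding_number_homotopic_loops)
  show "homotopic_loops (- {0}) (f \<circ> \<gamma>) (f \<circ> \<gamma>')"
    using assms(3) by (intro homotopic_loops_continuous_image[OF assms(1,2)]) auto
qed

text \<open>The pairs of winding numbers of \<open>m2\<close> and \<open>l2\<close> generate
  \<open>H\<close>. On \<open>T2\<close> the function \<open>v\<close> has no zeros, so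
  \<open>m2\<close> gives \<open>(\<mu>, 0)\<close>. On \<open>T1\<close> the function
  \<open>u\<close> has none, so \<open>m1\<close> has winding number 0 for \<open>u\<close>, and
  \<open>m1 = n l2 - q m2\<close> becomes \<open>n \<rho>1 = q \<mu>\<close>. Coprimality yields a
  common factor \<alpha>' with \<open>\<mu> = n \<alpha>'\<close> and
  \<open>\<rho>1 = q \<alpha>'\<close>.\<close>

proposition (in bidisc_cover) lens_space_lattice:
  fixes n q :: nat and P :: "(complex^2 \<Rightarrow> 'a) set"
  assumes nq: "q < n" "coprime q n"
    and lens: "lens_space n q L {x \<in> K. norm (u x) = 1} {x \<in> K. norm (v x) = 1} P"
    and P: "\<And>h. h \<in> P \<Longrightarrow> 0 < Re
      (winding_number (\<lambda>t. u (h (vector [circlepath 0 1 t, 1]))) 0 * winding_number (\<lambda>t. v (h (vector [1, circlepath 0 1 t]))) 0 -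
       winding_number (\<lambda>t. v (h (vector [circlepath 0 1 t, 1]))) 0 * winding_number (\<lambda>t. u (h (vector [1, circlepath 0 1 t]))) 0)"
  shows "\<exists>\<alpha> \<beta>. \<alpha> > 0 \<and> \<beta> > 0 \<and> H = lens_lattice (int n) (int q) \<alpha> \<beta>"
proof -
  define T1 where "T1 = {x \<in> K. norm (u x) = 1}"
  define T2 where "T2 = {x \<in> K. norm (v x) = 1}"
  define \<tau> where "\<tau> = T1 \<inter> T2"
  have \<tau>: "\<tau> \<subseteq> {x \<in> K. u x \<noteq> 0 \<and> v x \<noteq> 0}" by (auto simp: \<tau>_def T1_def T2_def)
  obtain m1 m2 l2 h h' where m1: "meridian T1 \<tau> m1" and m2: "meridian T2 \<tau> m2"
    and l2: "simple_closed_curve_on \<tau> l2" and start: "pathstart l2 = pathstart m2"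
    and h: "h \<in> P" "homeomorphism (bidisc \<S> \<S>) \<tau> h h'"
    and int1: "std_torus_intersection (h' \<circ> m2) (h' \<circ> l2) = 1"
    and hom: "homotopic_loops \<tau> m1 (loop_power l2 n +++ reversepath (loop_power m2 q))"
    using lens unfolding lens_space_def T1_def[symmetric] T2_def[symmetric] \<tau>_def[symmetric] by blast
  have cu: "continuous_on A u" and cv: "continuous_on A v" if "A \<subseteq> K" for A
    using cont_u cont_v that by (auto intro: continuous_on_subset)
  have \<tau>K: "\<tau> \<subseteq> K" "T1 \<subseteq> K" "T2 \<subseteq> K" by (auto simp: \<tau>_def T1_def T2_def)
  have nz: "u x \<noteq> 0" "v x \<noteq> 0" if "x \<in> \<tau>" for x using that \<tau> by auto
  \<comment> \<open>The four coefficients are the matrix of \<open>(u, v)\<close> on first homology,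
    in the basis given by the parametrisation \<open>h\<close>.\<close>
  obtain a11 a12 where au: "\<And>\<gamma> j k. path \<gamma> \<Longrightarrow> pathfinish \<gamma> = pathstart \<gamma> \<Longrightarrow> path_image \<gamma> \<subseteq> \<tau> \<Longrightarrow>
      winding_number (\<lambda>t. (h' \<circ> \<gamma>) t $ 1) 0 = of_int j \<Longrightarrow> winding_number (\<lambda>t. (h' \<circ> \<gamma>) t $ 2) 0 = of_int k \<Longrightarrow>
      winding_number (u \<circ> \<gamma>) 0 = of_int (a11 * j + a12 * k)"
    using torus_loop_winding_linear[OF h(2) cu[OF \<tau>K(1)] nz(1)] by blast
  obtain a21 a22 where av: "\<And>\<gamma> j k. path \<gamma> \<Longrightarrow> pathfinish \<gamma> = pathstart \<gamma> \<Longrightarrow> path_image \<gamma> \<subseteq> \<tau> \<Longrightarrow>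
      winding_number (\<lambda>t. (h' \<circ> \<gamma>) t $ 1) 0 = of_int j \<Longrightarrow> winding_number (\<lambda>t. (h' \<circ> \<gamma>) t $ 2) 0 = of_int k \<Longrightarrow>
      winding_number (v \<circ> \<gamma>) 0 = of_int (a21 * j + a22 * k)"
    using torus_loop_winding_linear[OF h(2) cv[OF \<tau>K(1)] nz(2)] by blast
  have w_int: "\<exists>j k. winding_number (\<lambda>t. (h' \<circ> \<gamma>) t $ 1) 0 = of_int j \<and> winding_number (\<lambda>t. (h' \<circ> \<gamma>) t $ 2) 0 = of_int k"
    if \<gamma>: "path \<gamma>" "pathfinish \<gamma> = pathstart \<gamma>" "path_image \<gamma> \<subseteq> \<tau>" for \<gamma>
  proof -
    have ph: "path (h' \<circ> \<gamma>)"
      using \<gamma> by (intro path_continuous_image) (auto intro: continuous_on_subset[OF homeomorphism_cont2[OF h(2)]])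
    have "(h' \<circ> \<gamma>) t \<in> bidisc \<S> \<S>" if "t \<in> {0..1}" for t
    proof -
      have "\<gamma> t \<in> \<tau>" using \<gamma>(3) that by (auto simp: path_image_def)
      then show ?thesis using homeomorphism_image2[OF h(2)] by auto
    qed
    then have nz: "(h' \<circ> \<gamma>) t $ 1 \<noteq> 0" "(h' \<circ> \<gamma>) t $ 2 \<noteq> 0" if "t \<in> {0..1}" for t
      using that by (force simp: bidisc_def)+
    have "winding_number (\<lambda>t. (h' \<circ> \<gamma>) t $ i) 0 \<in> \<int>" if "\<And>t. t \<in> {0..1} \<Longrightarrow> (h' \<circ> \<gamma>) t $ i \<noteq> 0" for i
    proof (rule integer_winding_number)
      show "path (\<lambda>t. (h' \<circ> \<gamma>) t $ i)"
        using path_continuous_image[OF ph, of "\<lambda>w. w $ i"] by (simp add: o_def continuous_intros)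
      show "pathfinish (\<lambda>t. (h' \<circ> \<gamma>) t $ i) = pathstart (\<lambda>t. (h' \<circ> \<gamma>) t $ i)"
        using \<gamma>(2) by (simp add: pathfinish_def pathstart_def)
      show "0 \<notin> path_image (\<lambda>t. (h' \<circ> \<gamma>) t $ i)" using that by (force simp: path_image_def)
    qed
    then show ?thesis using nz by (meson Ints_cases)
  qed
  have pm2: "path m2" "pathfinish m2 = pathstart m2" "path_image m2 \<subseteq> \<tau>"
    using m2 unfolding meridian_def simple_closed_curve_on_def by (auto simp: simple_path_imp_path)
  have pl2: "path l2" "pathfinish l2 = pathstart l2" "path_image l2 \<subseteq> \<tau>"
    using l2 unfolding simple_closed_curve_on_def by (auto simp: simple_path_imp_path)
  obtain p1 p2 where p: "winding_number (\<lambda>t. (h' \<circ> m2) t $ 1) 0 = of_int p1" "winding_number (\<lambda>t. (h' \<circ> m2) t $ 2) 0 = of_int p2"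
    using w_int[OF pm2] by blast
  obtain r1 r2 where r: "winding_number (\<lambda>t. (h' \<circ> l2) t $ 1) 0 = of_int r1" "winding_number (\<lambda>t. (h' \<circ> l2) t $ 2) 0 = of_int r2"
    using w_int[OF pl2] by blast
  have "of_int (p1 * r2 - p2 * r1) = (of_int 1 :: complex)"
    using int1 unfolding std_torus_intersection_def p r by simp
  then have det1: "p1 * r2 - p2 * r1 = 1" by (rule of_int_eq_iff[THEN iffD1])
  define \<mu> where "\<mu> = a11 * p1 + a12 * p2"
  define \<rho>1 where "\<rho>1 = a11 * r1 + a12 * r2"
  define \<rho>2 where "\<rho>2 = a21 * r1 + a22 * r2"
  have wm2: "winding_number (u \<circ> m2) 0 = of_int \<mu>" "winding_number (v \<circ> m2) 0 = of_int (a21 * p1 + a22 * p2)"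
    unfolding \<mu>_def using au[OF pm2 p] av[OF pm2 p] by auto
  have wl2: "winding_number (u \<circ> l2) 0 = of_int \<rho>1" "winding_number (v \<circ> l2) 0 = of_int \<rho>2"
    unfolding \<rho>1_def \<rho>2_def using au[OF pl2 r] av[OF pl2 r] by auto
  have "winding_number (v \<circ> m2) 0 = 0"
    by (rule winding_number_meridian[OF m2 cv]) (auto simp: T2_def)
  then have v0: "a21 * p1 + a22 * p2 = 0" using wm2(2) by (metis of_int_eq_0_iff)
  have "winding_number (u \<circ> m1) 0 = 0"
    by (rule winding_number_meridian[OF m1 cu]) (auto simp: T1_def)
  moreover have "winding_number (u \<circ> m1) 0 = of_nat n * winding_number (u \<circ> l2) 0 - of_nat q * winding_number (u \<circ> m2) 0"
    using homotopic_loops_winding_number_eq[OF hom cu[OF \<tau>K(1)] nz(1)]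
      winding_number_power_difference[OF pl2(1,2) pm2(1,2) start cu[OF \<tau>K(1)] nz(1) pl2(3) pm2(3), of n q] by simp
  ultimately have "of_int (int n * \<rho>1 - int q * \<mu>) = (of_int 0 :: complex)" by (simp add: wl2 wm2)
  then have rel: "int n * \<rho>1 = int q * \<mu>" by (simp only: of_int_eq_iff)
  have cop: "coprime (int n) (int q)" using nq(2) by (simp add: coprime_commute)
  then have "int n dvd \<mu>" using rel by (metis coprime_dvd_mult_right_iff dvd_triv_left)
  then obtain \<alpha>' where \<alpha>': "\<mu> = int n * \<alpha>'" by auto
  then have \<rho>1: "\<rho>1 = int q * \<alpha>'" using rel nq(1) by (simp add: mult.left_commute)
  \<comment> \<open>The two factor circles of \<open>h\<close> have the columns of the matrix as
    winding numbers, so positivity of its determinant is the orientation condition on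
    \<open>h\<close>.\<close>
  have detA: "0 < a11 * a22 - a12 * a21"
  proof -
    define e1 where "e1 t = h (vector [circlepath 0 1 t, 1])" for t
    define e2 where "e2 t = h (vector [1, circlepath 0 1 t])" for t
    have circ: "circlepath 0 1 t \<in> \<S>" for t by (simp add: circlepath)
    have in_bidisc: "vector [circlepath 0 1 t, 1] \<in> bidisc \<S> \<S>" "vector [1, circlepath 0 1 t] \<in> bidisc \<S> \<S>" for t
      using circ[of t] by (auto simp: bidisc_def)
    have cc: "continuous_on A (circlepath 0 1)" for A
      unfolding circlepath_def part_circlepath_def by (intro continuous_intros)
    have e: "path e1" "path e2" "pathfinish e1 = pathstart e1" "pathfinish e2 = pathstart e2"
      "path_image e1 \<subseteq> \<tau>" "path_image e2 \<subseteq> \<tau>"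
    proof -
      show "path e1" unfolding path_def e1_def
        using in_bidisc by (intro continuous_on_compose2[OF homeomorphism_cont1[OF h(2)]] continuous_intros cc) auto
      show "path e2" unfolding path_def e2_def
        using in_bidisc by (intro continuous_on_compose2[OF homeomorphism_cont1[OF h(2)]] continuous_intros cc) auto
      show "pathfinish e1 = pathstart e1" "pathfinish e2 = pathstart e2"
        using pathfinish_circlepath[of 0 1] pathstart_circlepath[of 0 1]
        by (simp_all add: pathfinish_def pathstart_def e1_def e2_def)
      show "path_image e1 \<subseteq> \<tau>" "path_image e2 \<subseteq> \<tau>"
        using in_bidisc homeomorphism_image1[OF h(2)] by (auto simp: path_image_def e1_def e2_def)
    qed
    have h'e: "h' (e1 t) = vector [circlepath 0 1 t, 1]" "h' (e2 t) = vector [1, circlepath 0 1 t]" for t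
      unfolding e1_def e2_def using homeomorphism_apply1[OF h(2)] in_bidisc by blast+
    have w1: "winding_number (\<lambda>t. circlepath 0 1 t) 0 = of_int 1"
      by (simp add: winding_number_circlepath_centre)
    have w0: "winding_number (\<lambda>t::real. 1) 0 = of_int 0"
      by (rule winding_number_exp_path[of "\<lambda>_. 0"]) (auto simp: path_def)
    have "winding_number (u \<circ> e1) 0 = of_int (a11 * 1 + a12 * 0)" "winding_number (v \<circ> e1) 0 = of_int (a21 * 1 + a22 * 0)"
      by (rule au[OF e(1,3,5)] av[OF e(1,3,5)]; simp add: h'e w1[simplified] w0[simplified])+
    moreover have "winding_number (u \<circ> e2) 0 = of_int (a11 * 0 + a12 * 1)" "winding_number (v \<circ> e2) 0 = of_int (a21 * 0 + a22 * 1)"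
      by (rule au[OF e(2,4,6)] av[OF e(2,4,6)]; simp add: h'e w1[simplified] w0[simplified])+
    moreover have "0 < Re (winding_number (u \<circ> e1) 0 * winding_number (v \<circ> e2) 0 - winding_number (v \<circ> e1) 0 * winding_number (u \<circ> e2) 0)"
      using P[OF h(1)] unfolding o_def e1_def e2_def .
    ultimately have "0 < Re (of_int (a11 * a22 - a21 * a12))" by simp
    then have "0 < real_of_int (a11 * a22 - a21 * a12)" by (metis of_real_of_int_eq Re_complex_of_real)
    then have "0 < a11 * a22 - a21 * a12" by (simp only: of_int_0_less_iff)
    then show ?thesis by (simp add: mult.commute)
  qed
  \<comment> \<open>Multiplicativity of determinants. As \<open>m2\<close> and \<open>l2\<close>
    have intersection number 1, the product \<open>\<mu> * \<rho>2\<close> equals the positive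
    determinant of the covering; hence \<alpha>' and \<rho>2 have the same sign.\<close>
  have "\<mu> * \<rho>2 - (a21 * p1 + a22 * p2) * \<rho>1 = (a11 * a22 - a12 * a21) * (p1 * r2 - p2 * r1)"
    unfolding \<mu>_def \<rho>1_def \<rho>2_def by (simp add: algebra_simps)
  then have "0 < \<mu> * \<rho>2" using v0 det1 detA by simp
  then have "0 < int n * (\<alpha>' * \<rho>2)" unfolding \<alpha>' by (simp only: mult.assoc)
  then have pos: "0 < \<alpha>' * \<rho>2" by (simp add: zero_less_mult_iff)
  have H: "H = lens_lattice (int n) (int q) \<alpha>' \<rho>2"
  proof (intro set_eqI iffI)
    fix z assume "z \<in> H"
    then obtain x y where z: "z = (x, y)" "(x, y) \<in> H" by (cases z) auto
    \<comment> \<open>The segment from the origin to the lattice point, on the imaginary axes,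
      projects to a loop on the torus with the prescribed winding numbers \<open>x\<close> and
      \<open>y\<close>.\<close>
    define \<gamma> where "\<gamma> t = \<Psi> (of_real t * period x) (of_real t * period y)" for t :: real
    have path\<gamma>: "path \<gamma>"
      unfolding path_def \<gamma>_def
      using continuous_on_compose2[OF Psi_cont, of "{0..1}" "\<lambda>t. (of_real t * period x, of_real t * period y)"]
      by (force intro!: continuous_intros)
    have loop\<gamma>: "pathfinish \<gamma> = pathstart \<gamma>"
      using z(2) unfolding H_iff by (simp add: pathfinish_def pathstart_def \<gamma>_def)
    have \<gamma>\<tau>: "path_image \<gamma> \<subseteq> \<tau>"
      by (auto simp: path_image_def \<gamma>_def \<tau>_def T1_def T2_def Psi_K u_Psi v_Psi norm_exp_eq_Re)
    obtain j k where jk: "winding_number (\<lambda>t. (h' \<circ> \<gamma>) t $ 1) 0 = of_int j" "winding_number (\<lambda>t. (h' \<circ> \<gamma>) t $ 2) 0 = of_int k"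
      using w_int[OF path\<gamma> loop\<gamma> \<gamma>\<tau>] by blast
    have "winding_number (u \<circ> \<gamma>) 0 = of_int x"
      by (rule winding_number_exp_path[of "\<lambda>t. of_real t * period x"])
         (auto simp: path_def \<gamma>_def u_Psi intro!: continuous_intros)
    moreover have "winding_number (v \<circ> \<gamma>) 0 = of_int y"
      by (rule winding_number_exp_path[of "\<lambda>t. of_real t * period y"])
         (auto simp: path_def \<gamma>_def v_Psi intro!: continuous_intros)
    ultimately have xy: "x = a11 * j + a12 * k" "y = a21 * j + a22 * k"
      using au[OF path\<gamma> loop\<gamma> \<gamma>\<tau> jk] av[OF path\<gamma> loop\<gamma> \<gamma>\<tau> jk] by (simp_all only: of_int_eq_iff)
    \<comment> \<open>Cramer's rule with determinant 1: \<open>c\<close> and \<open>d\<close> are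
      the integer coordinates of the class of \<gamma> in the basis \<open>m2\<close>,
      \<open>l2\<close>.\<close>
    define c where "c = j * r2 - k * r1"
    define d where "d = p1 * k - p2 * j"
    have "c * p1 + d * r1 = (p1 * r2 - p2 * r1) * j" "c * p2 + d * r2 = (p1 * r2 - p2 * r1) * k"
      by (simp_all add: c_def d_def algebra_simps)
    then have jk': "j = c * p1 + d * r1" "k = c * p2 + d * r2" using det1 by simp_all
    have "x = c * \<mu> + d * \<rho>1" "y = c * (a21 * p1 + a22 * p2) + d * \<rho>2"
      unfolding xy \<mu>_def \<rho>1_def \<rho>2_def jk' by (simp_all add: algebra_simps)
    then have "z = (int n * \<alpha>' * c + int q * \<alpha>' * d, \<rho>2 * d)"
      using v0 by (simp add: z \<alpha>' \<rho>1 algebra_simps)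
    then show "z \<in> lens_lattice (int n) (int q) \<alpha>' \<rho>2" unfolding lens_lattice_def by blast
  next
    fix z assume "z \<in> lens_lattice (int n) (int q) \<alpha>' \<rho>2"
    then obtain c d where z: "z = (int n * \<alpha>' * c + int q * \<alpha>' * d, \<rho>2 * d)" by (auto simp: lens_lattice_def)
    have "\<exists>j k. (j, k) \<in> H \<and> winding_number (u \<circ> \<gamma>) 0 = of_int j \<and> winding_number (v \<circ> \<gamma>) 0 = of_int k"
      if "path \<gamma>" "pathfinish \<gamma> = pathstart \<gamma>" "path_image \<gamma> \<subseteq> \<tau>" for \<gamma>
      using loop_H that \<tau> by blast
    then have "(\<mu>, 0) \<in> H" "(\<rho>1, \<rho>2) \<in> H"
      using pm2 pl2 wm2 wl2 v0 by (metis of_int_eq_iff)+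
    then have "(c * \<mu> + d * \<rho>1, c * 0 + d * \<rho>2) \<in> H" using H_add H_mult by blast
    then show "z \<in> H" by (simp add: z \<alpha>' \<rho>1 algebra_simps)
  qed
  show ?thesis
  proof (cases "\<alpha>' > 0")
    case True
    then show ?thesis using H pos by (auto simp: zero_less_mult_iff)
  next
    case False
    then have "- \<alpha>' > 0" "- \<rho>2 > 0" using pos by (auto simp: zero_less_mult_iff)
    moreover have "H = lens_lattice (int n) (int q) (- \<alpha>') (- \<rho>2)" using H lens_lattice_uminus by simp
    ultimately show ?thesis by blast
  qed
qed

section \<open>Analytic maps\<close>

lemma has_derivative_vec_componentwise:
  fixes G :: "'a::euclidean_space \<Rightarrow> complex^'m"
  assumes "\<And>i. ((\<lambda>z. G z $ i) has_derivative (\<lambda>h. G' h $ i)) (at x)"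
  shows "(G has_derivative G') (at x)"
  unfolding has_derivative_def
proof
  have lin: "linear (\<lambda>h. G' h $ i)" for i
    using assms[of i] by (simp add: has_derivative_linear)
  have "linear G'"
    using linear_add[OF lin] linear_scale[OF lin] by (intro linearI) (simp_all add: vec_eq_iff)
  then show "bounded_linear G'" by (simp add: linear_conv_bounded_linear)
  show "((\<lambda>y. ((G y - G (Lim (at x) (\<lambda>x. x))) - G' (y - Lim (at x) (\<lambda>x. x))) /\<^sub>R norm (y - Lim (at x) (\<lambda>x. x))) \<longlongrightarrow> 0) (at x)"
    using assms by (intro vec_tendstoI) (simp add: has_derivative_def)
qed

lemma holomorphic_several_continuous: "holomorphic_several U f \<Longrightarrow> continuous_on U f"
  unfolding holomorphic_several_def
  by (meson continuous_at_imp_continuous_on has_derivative_continuous)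

lemma holomorphic_components_continuous:
  assumes "\<And>i. holomorphic_several U (\<lambda>z. F z $ i)"
  shows "continuous_on U F"
proof -
  have "continuous_on U (\<lambda>z. \<chi> i. F z $ i)"
    using assms holomorphic_several_continuous by (intro continuous_on_vec_lambda) auto
  then show ?thesis by simp
qed

lemma holomorphic_several_compose:
  assumes F: "holomorphic_several U F" and G: "\<And>i. holomorphic_several V (\<lambda>z. G z $ i)"
  shows "holomorphic_several (V \<inter> G -` U) (\<lambda>z. F (G z))"
  unfolding holomorphic_several_def
proof (intro conjI ballI)
  have V: "open V" and U: "open U" using F G unfolding holomorphic_several_def by auto
  show "open (V \<inter> G -` U)"
    using continuous_on_open_vimage[OF V, of G] holomorphic_components_continuous[OF G] U by (simp add: Int_commute)
  fix x assume x: "x \<in> V \<inter> G -` U"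
  have "\<forall>i. \<exists>g'. ((\<lambda>z. G z $ i) has_derivative g') (at x) \<and> (\<forall>c v. g' (c *s v) = c * g' v)"
    using G x unfolding holomorphic_several_def by blast
  then obtain g' where g': "\<And>i. ((\<lambda>z. G z $ i) has_derivative g' i) (at x)" "\<And>i c v. g' i (c *s v) = c * g' i v"
    by metis
  have dG: "(G has_derivative (\<lambda>h. \<chi> i. g' i h)) (at x)"
    by (rule has_derivative_vec_componentwise) (simp add: g'(1))
  obtain f' where f': "(F has_derivative f') (at (G x))" "\<And>c v. f' (c *s v) = c * f' v"
    using F x unfolding holomorphic_several_def by blast
  have "((\<lambda>z. F (G z)) has_derivative (\<lambda>h. f' (\<chi> i. g' i h))) (at x)"
    using has_derivative_compose[OF dG f'(1)] .
  moreover have "f' (\<chi> i. g' i (c *s v)) = c * f' (\<chi> i. g' i v)" for c v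
  proof -
    have "(\<chi> i. g' i (c *s v)) = c *s (\<chi> i. g' i v)" by (simp add: vec_eq_iff g'(2))
    then show ?thesis by (simp add: f'(2))
  qed
  ultimately show "\<exists>f'. ((\<lambda>z. F (G z)) has_derivative f') (at x) \<and> (\<forall>c v. f' (c *s v) = c * f' v)" by blast
qed

lemma holomorphic_several_compose_curve:
  assumes F: "holomorphic_several U F" and S: "open S" "\<And>z. z \<in> S \<Longrightarrow> \<gamma> z \<in> U"
    and \<gamma>: "\<And>i. (\<lambda>z. \<gamma> z $ i) holomorphic_on S"
  shows "(\<lambda>z. F (\<gamma> z)) holomorphic_on S"
proof -
  have "\<exists>D. ((\<lambda>z. F (\<gamma> z)) has_field_derivative D) (at z)" if z: "z \<in> S" for z
  proof -
    have "\<exists>d. ((\<lambda>z. \<gamma> z $ i) has_field_derivative d) (at z)" for i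
      using \<gamma>[of i] S(1) z by (meson holomorphic_on_open)
    then obtain d where d: "\<And>i. ((\<lambda>z. \<gamma> z $ i) has_field_derivative d i) (at z)" by metis
    have dG: "(\<gamma> has_derivative (\<lambda>h. h *s (\<chi> i. d i))) (at z)"
      by (rule has_derivative_vec_componentwise) (use d in \<open>simp add: has_field_derivative_def mult_commute_abs\<close>)
    obtain f' where f': "(F has_derivative f') (at (\<gamma> z))" "\<And>c v. f' (c *s v) = c * f' v"
      using F S(2)[OF z] unfolding holomorphic_several_def by blast
    have "((\<lambda>z. F (\<gamma> z)) has_derivative (\<lambda>h. f' (h *s (\<chi> i. d i)))) (at z)"
      using has_derivative_compose[OF dG f'(1)] .
    then have "((\<lambda>z. F (\<gamma> z)) has_field_derivative f' (\<chi> i. d i)) (at z)"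
      unfolding has_field_derivative_def f'(2) by (simp add: mult_commute_abs)
    then show ?thesis by blast
  qed
  then show ?thesis using holomorphic_on_open[OF S(1)] by blast
qed

lemma analytic_map_on_continuous:
  assumes "analytic_map_on A f"
  shows "continuous_on A f"
proof (subst continuous_on_eq_continuous_within, rule ballI)
  fix x assume x: "x \<in> A"
  then obtain V F where V: "x \<in> V" "\<And>i. holomorphic_several V (\<lambda>z. F z $ i)" "\<And>z. z \<in> A \<inter> V \<Longrightarrow> f z = F z"
    using assms unfolding analytic_map_on_def by metis
  have "open V" using V(2) unfolding holomorphic_several_def by blast
  then have "continuous (at x) F"
    using holomorphic_components_continuous[OF V(2)] V(1) continuous_on_eq_continuous_at by blast
  then have F: "continuous (at x within A) F" by (rule continuous_at_imp_continuous_at_within)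
  obtain d where d: "d > 0" "ball x d \<subseteq> V" using openE[OF \<open>open V\<close> V(1)] .
  show "continuous (at x within A) f"
    by (rule continuous_transform_within[OF F d(1) x]) (use V(3) d(2) in \<open>auto simp: dist_commute subset_iff\<close>)
qed

lemma analytic_map_on_subset: "analytic_map_on A f \<Longrightarrow> B \<subseteq> A \<Longrightarrow> analytic_map_on B f"
  unfolding analytic_map_on_def by (meson IntI IntD1 IntD2 subsetD)

lemma analytic_map_on_compose_curve:
  assumes f: "analytic_map_on A f" and S: "open S" "\<And>z. z \<in> S \<Longrightarrow> \<gamma> z \<in> A"
    and \<gamma>: "\<And>i. (\<lambda>z. \<gamma> z $ i) holomorphic_on S"
  shows "(\<lambda>z. f (\<gamma> z) $ i) holomorphic_on S"
proof -
  have "continuous_on S (\<lambda>z. \<chi> i. \<gamma> z $ i)"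
    using \<gamma> by (intro continuous_on_vec_lambda holomorphic_on_imp_continuous_on)
  then have cont\<gamma>: "continuous_on S \<gamma>" by simp
  have "(\<lambda>z. f (\<gamma> z) $ i) field_differentiable (at z)" if z: "z \<in> S" for z
  proof -
    obtain V F where V: "\<gamma> z \<in> V" "\<And>i. holomorphic_several V (\<lambda>z. F z $ i)" "\<And>w. w \<in> A \<inter> V \<Longrightarrow> f w = F w"
      using f S(2)[OF z] unfolding analytic_map_on_def by metis
    have "open V" using V(2) unfolding holomorphic_several_def by blast
    define S' where "S' = S \<inter> \<gamma> -` V"
    have S': "open S'" "z \<in> S'"
      using continuous_on_open_vimage[OF S(1), of \<gamma>] cont\<gamma> \<open>open V\<close> z V(1) by (auto simp: S'_def Int_commute)
    have "(\<lambda>z. F (\<gamma> z) $ i) holomorphic_on S'"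
      using \<gamma> by (intro holomorphic_several_compose_curve[OF V(2) S'(1)])
        (auto simp: S'_def intro: holomorphic_on_subset)
    then have "(\<lambda>z. f (\<gamma> z) $ i) holomorphic_on S'"
      by (rule holomorphic_transform) (use V(3) S(2) in \<open>auto simp: S'_def\<close>)
    then show ?thesis using S' holomorphic_on_imp_differentiable_at by blast
  qed
  then show ?thesis
    unfolding holomorphic_on_def using field_differentiable_at_within by blast
qed

lemma analytic_iso_homeomorphism:
  assumes "analytic_iso A B f"
  shows "homeomorphism A B f (inv_into A f)"
proof -
  have bij: "bij_betw f A B" and c: "continuous_on A f" "continuous_on B (inv_into A f)"
    using assms analytic_map_on_continuous unfolding analytic_iso_def by blast+
  show ?thesis
    using c bij bij_betw_imp_surj_on[OF bij] bij_betw_inv_into_left[OF bij] bij_betw_inv_into_right[OF bij]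
      bij_betw_imp_surj_on[OF bij_betw_inv_into[OF bij]]
    by (intro homeomorphismI) auto
qed

text \<open>Locally \<open>f\<close> is the inverse of a chart of \<open>\<phi>2\<close> after a
  holomorphic extension of \<open>\<phi>1\<close>. Continuity of \<open>f\<close> keeps its values
  in the domain of that chart, where the inverse is unambiguous.\<close>

lemma analytic_map_on_lift:
  assumes \<phi>1: "analytic_map_on A \<phi>1" and f: "continuous_on A f" "f ` A \<subseteq> X2"
    and eq: "\<And>x. x \<in> A \<Longrightarrow> \<phi>1 x = \<phi>2 (f x)"
    and iso: "\<And>x. x \<in> A \<Longrightarrow> local_analytic_iso_at X2 \<phi>2 (f x)"
  shows "analytic_map_on A f"
  unfolding analytic_map_on_def
proof
  fix x assume x: "x \<in> A"
  obtain V2 Q where V2: "open V2" "f x \<in> V2" "open Q" "analytic_iso (X2 \<inter> V2) Q \<phi>2"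
    using iso[OF x] unfolding local_analytic_iso_at_def by blast
  define k where "k = inv_into (X2 \<inter> V2) \<phi>2"
  have bij: "bij_betw \<phi>2 (X2 \<inter> V2) Q" and ak: "analytic_map_on Q k"
    using V2(4) unfolding analytic_iso_def k_def by auto
  have "\<phi>2 (f x) \<in> Q" using bij V2(2) f(2) x by (auto simp: bij_betw_def)
  then obtain V' F where V': "\<phi>2 (f x) \<in> V'" "\<And>i. holomorphic_several V' (\<lambda>z. F z $ i)" "\<And>w. w \<in> Q \<inter> V' \<Longrightarrow> k w = F w"
    using ak unfolding analytic_map_on_def by metis
  obtain V \<Phi> where V: "x \<in> V" "\<And>i. holomorphic_several V (\<lambda>z. \<Phi> z $ i)" "\<And>z. z \<in> A \<inter> V \<Longrightarrow> \<phi>1 z = \<Phi> z"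
    using \<phi>1 x unfolding analytic_map_on_def by metis
  have "openin (top_of_set A) (A \<inter> f -` V2)"
    using continuous_openin_preimage_gen[OF f(1) V2(1)] .
  then obtain O' where O': "open O'" "A \<inter> f -` V2 = A \<inter> O'" by (auto simp: openin_open)
  define W where "W = (V \<inter> \<Phi> -` V') \<inter> (O' \<inter> (V \<inter> \<Phi> -` Q))"
  have oV: "open V" using V(2) unfolding holomorphic_several_def by blast
  have "open (V \<inter> \<Phi> -` Q)"
    using continuous_on_open_vimage[OF oV, of \<Phi>] holomorphic_components_continuous[OF V(2)] V2(3) by (simp add: Int_commute)
  then have oW: "open (O' \<inter> (V \<inter> \<Phi> -` Q))" using O'(1) by blast
  have hol: "holomorphic_several W (\<lambda>z. F (\<Phi> z) $ i)" for i
    using holomorphic_several_compose[OF V'(2) V(2), of i] oW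
    unfolding W_def holomorphic_several_def by (auto simp: open_Int)
  have "x \<in> W"
    using V(1,3) x eq[OF x] V'(1) \<open>\<phi>2 (f x) \<in> Q\<close> O'(2) V2(2) by (auto simp: W_def)
  moreover have "f z = F (\<Phi> z)" if z: "z \<in> A \<inter> W" for z
  proof -
    have "f z \<in> X2 \<inter> V2" using z O'(2) f(2) unfolding W_def by blast
    then have "f z = k (\<phi>2 (f z))" unfolding k_def using bij_betw_inv_into_left[OF bij] by simp
    also have "\<phi>2 (f z) = \<Phi> z" using eq V(3) z unfolding W_def by auto
    also have "k (\<Phi> z) = F (\<Phi> z)" using V'(3) z unfolding W_def by auto
    finally show ?thesis .
  qed
  ultimately show "\<exists>V F. x \<in> V \<and> (\<forall>i. holomorphic_several V (\<lambda>z. F z $ i)) \<and> (\<forall>z\<in>A \<inter> V. f z = F z)"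
    using hol by (intro exI[of _ W] exI[of _ "\<lambda>z. F (\<Phi> z)"]) auto
qed

text \<open>The same argument for maps of one variable; it makes the sheets of the covering
  holomorphic although \<open>\<Psi>\<close> comes from topology only.\<close>

lemma lift_curve_holomorphic:
  assumes iso: "\<And>z. z \<in> S \<Longrightarrow> local_analytic_iso_at X \<phi> (P z)"
    and P: "continuous_on S P" "\<And>z. z \<in> S \<Longrightarrow> P z \<in> X" and S: "open S"
    and \<gamma>: "\<And>i. (\<lambda>z. \<phi> (P z) $ i) holomorphic_on S"
  shows "(\<lambda>z. P z $ i) holomorphic_on S"
proof -
  have "(\<lambda>z. P z $ i) field_differentiable (at z)" if z: "z \<in> S" for z
  proof -
    obtain V Q where V: "open V" "P z \<in> V" "open Q" "analytic_iso (X \<inter> V) Q \<phi>"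
      using iso[OF z] unfolding local_analytic_iso_at_def by blast
    have bij: "bij_betw \<phi> (X \<inter> V) Q" and ak: "analytic_map_on Q (inv_into (X \<inter> V) \<phi>)"
      using V(4) unfolding analytic_iso_def by auto
    define S' where "S' = S \<inter> P -` V"
    have S': "open S'" "z \<in> S'"
      using continuous_on_open_vimage[OF S, of P] P(1) V(1,2) z by (auto simp: S'_def Int_commute)
    have PV: "P w \<in> X \<inter> V" if "w \<in> S'" for w using that P(2) by (auto simp: S'_def)
    have "(\<lambda>z. inv_into (X \<inter> V) \<phi> (\<phi> (P z)) $ i) holomorphic_on S'"
    proof (rule analytic_map_on_compose_curve[OF ak S'(1)])
      show "\<phi> (P w) \<in> Q" if "w \<in> S'" for w using PV[OF that] bij by (auto simp: bij_betw_def)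
      show "(\<lambda>z. \<phi> (P z) $ i) holomorphic_on S'" for i
        using \<gamma> by (rule holomorphic_on_subset) (auto simp: S'_def)
    qed
    then have "(\<lambda>z. P z $ i) holomorphic_on S'"
      by (rule holomorphic_transform) (use PV bij_betw_inv_into_left[OF bij] in auto)
    then show ?thesis using S' holomorphic_on_imp_differentiable_at by blast
  qed
  then show ?thesis
    unfolding holomorphic_on_def using field_differentiable_at_within by blast
qed

text \<open>Holomorphic functions of two variables have no isolated zeros. If \<open>w0\<close> is
  isolated in its fibre along a line, then every nearby parallel line also carries a point of the
  fibre, which produces infinitely many. Holomorphy is used along lines parallel to the first axis
  only.\<close>

lemma analytic_function_infinite_fibre:
  fixes g :: "complex^2 \<Rightarrow> complex"
  assumes Q: "open Q" "w0 \<in> Q" and cont: "continuous_on Q g"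
    and hol: "\<And>S a b. open S \<Longrightarrow> (\<And>z. z \<in> S \<Longrightarrow> vector [a + z, b] \<in> Q) \<Longrightarrow> (\<lambda>z. g (vector [a + z, b])) holomorphic_on S"
  shows "infinite {w \<in> Q. g w = g w0}"
proof
  assume fin: "finite {w \<in> Q. g w = g w0}"
  define a where "a = w0 $ 1"
  define b where "b = w0 $ 2"
  have w0: "w0 = vector [a, b]" by (simp add: a_def b_def vec_eq_iff forall_2)
  define G where "G z w = g (vector [a + z, b + w])" for z w
  have "\<exists>e>0. \<forall>z w. norm z \<le> e \<longrightarrow> norm w \<le> e \<longrightarrow> vector [a + z, b + w] \<in> Q"
  proof -
    have "open ((\<lambda>p. vector [a + fst p, b + snd p] :: complex^2) -` Q)"
      by (intro open_vimage Q(1) continuous_intros)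
    moreover have "(0, 0) \<in> (\<lambda>p. vector [a + fst p, b + snd p] :: complex^2) -` Q" using Q(2) w0 by simp
    ultimately obtain A B where AB: "open A" "open B" "0 \<in> A" "0 \<in> B" "A \<times> B \<subseteq> (\<lambda>p. vector [a + fst p, b + snd p] :: complex^2) -` Q"
      by (rule open_prod_elim) auto
    obtain e1 where e1: "e1 > 0" "cball 0 e1 \<subseteq> A" using AB(1,3) open_contains_cball by blast
    obtain e2 where e2: "e2 > 0" "cball 0 e2 \<subseteq> B" using AB(2,4) open_contains_cball by blast
    have "vector [a + z, b + w] \<in> Q" if "norm z \<le> min e1 e2" "norm w \<le> min e1 e2" for z w
    proof -
      have "z \<in> A" "w \<in> B" using that e1(2) e2(2) by auto
      then show ?thesis using AB(5) by fastforce
    qed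
    then show ?thesis using e1 e2 by (intro exI[of _ "min e1 e2"]) auto
  qed
  then obtain e where e: "e > 0" "\<And>z w. norm z \<le> e \<Longrightarrow> norm w \<le> e \<Longrightarrow> vector [a + z, b + w] \<in> Q" by blast
  have "finite {z. norm z \<le> e \<and> G z 0 = g w0}"
  proof (rule finite_imageD)
    show "finite ((\<lambda>z. vector [a + z, b + 0] :: complex^2) ` {z. norm z \<le> e \<and> G z 0 = g w0})"
      by (rule finite_subset[OF _ fin]) (use e(1) e(2)[of _ 0] in \<open>auto simp: G_def\<close>)
    show "inj_on (\<lambda>z. vector [a + z, b + 0] :: complex^2) {z. norm z \<le> e \<and> G z 0 = g w0}"
      by (auto simp: inj_on_def vec_eq_iff forall_2)
  qed
  then obtain d where d: "d > 0" "\<And>z. norm z \<le> e \<Longrightarrow> G z 0 = g w0 \<Longrightarrow> z \<noteq> 0 \<Longrightarrow> d \<le> norm z"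
    using finite_set_avoid[of _ "0::complex"] by force
  define r where "r = min e (d / 2)"
  have r: "0 < r" "r \<le> e" "r < d" using e(1) d(1) by (auto simp: r_def)
  have nz: "G z 0 \<noteq> g w0" if "norm z = r" for z
    using d(2)[of z] that r by auto
  have contG: "continuous_on (cball 0 r \<times> cball 0 r) (\<lambda>(z, w). G z w)"
    unfolding G_def case_prod_unfold
    using e(2) r(2) by (intro continuous_on_compose2[OF cont] continuous_intros) auto
  have contGw: "continuous_on (cball 0 r) (\<lambda>z. G z w)" if "norm w \<le> r" for w
  proof -
    have "continuous_on (cball 0 r) (\<lambda>z. (z, w))" by (intro continuous_intros)
    moreover have "(\<lambda>z. (z, w)) ` cball 0 r \<subseteq> cball 0 r \<times> cball 0 r" using that by auto
    ultimately have "continuous_on (cball 0 r) (\<lambda>z. (\<lambda>(z, w). G z w) (z, w))"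
      by (rule continuous_on_compose2[OF contG])
    then show ?thesis by simp
  qed
  have unif: "\<exists>\<delta>>0. \<forall>w. norm w < \<delta> \<longrightarrow> norm w \<le> r \<and> (\<forall>z\<in>cball 0 r. norm (G z w - G z 0) < \<epsilon>)" if "\<epsilon> > 0" for \<epsilon>
  proof -
    have "uniformly_continuous_on (cball 0 r \<times> cball 0 r) (\<lambda>(z, w). G z w)"
      by (intro compact_uniformly_continuous[OF contG] compact_Times compact_cball)
    then obtain \<delta> where \<delta>: "\<delta> > 0" "\<And>p p'. p \<in> cball 0 r \<times> cball 0 r \<Longrightarrow> p' \<in> cball 0 r \<times> cball 0 r \<Longrightarrow> dist p' p < \<delta>
        \<Longrightarrow> dist ((\<lambda>(z, w). G z w) p') ((\<lambda>(z, w). G z w) p) < \<epsilon>"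
      unfolding uniformly_continuous_on_def using \<open>\<epsilon> > 0\<close> by metis
    have "norm (G z w - G z 0) < \<epsilon>" if "norm w < min \<delta> r" "z \<in> cball 0 r" for z w
      using \<delta>(2)[of "(z, 0)" "(z, w)"] that r(1) by (simp add: dist_norm dist_Pair_Pair)
    then show ?thesis using \<delta>(1) r(1) by (intro exI[of _ "min \<delta> r"]) auto
  qed
  have "compact (sphere (0::complex) r)" "sphere (0::complex) r \<noteq> {}" using r(1) by auto
  moreover have "continuous_on (sphere 0 r) (\<lambda>z. norm (G z 0 - g w0))"
    using r(1) by (intro continuous_intros continuous_on_subset[OF contGw sphere_cball]) auto
  ultimately obtain z0 where z0: "z0 \<in> sphere 0 r" "\<And>z. z \<in> sphere 0 r \<Longrightarrow> norm (G z0 0 - g w0) \<le> norm (G z 0 - g w0)"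
    using continuous_attains_inf[of "sphere 0 r" "\<lambda>z. norm (G z 0 - g w0)"] by blast
  define \<mu> where "\<mu> = norm (G z0 0 - g w0)"
  have "\<mu> / 2 > 0" using nz[of z0] z0(1) by (simp add: \<mu>_def)
  from unif[OF this] obtain \<delta> where \<delta>: "\<delta> > 0" "\<And>w::complex. norm w < \<delta> \<Longrightarrow> norm w \<le> r" "\<And>z w. norm w < \<delta> \<Longrightarrow> z \<in> cball 0 r \<Longrightarrow> norm (G z w - G z 0) < \<mu> / 2"
    by blast
  have zero: "\<exists>z. norm z \<le> r \<and> G z w = g w0" if w: "norm w < \<delta>" for w
  proof -
    have wr: "norm w \<le> r" using \<delta>(2) w by blast
    have "(\<lambda>z. g (vector [a + z, b + w])) holomorphic_on ball 0 r"
      by (rule hol) (use e(2) wr r(2) in auto)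
    then have h: "(\<lambda>z. G z w - g w0) holomorphic_on ball 0 r"
      unfolding G_def by (intro holomorphic_intros)
    have c: "continuous_on (cball 0 r) (\<lambda>z. G z w - g w0)"
      by (intro continuous_intros contGw wr)
    \<comment> \<open>Moving the line by less than \<delta> changes values by less than
      \<open>\<mu> / 2\<close>. The modulus then stays smaller at the centre than on the circle,
      which forces a zero inside.\<close>
    have "norm (G 0 w - g w0) < norm (G z w - g w0)" if z: "norm (0 - z) = r" for z
    proof -
      have "norm (G 0 w - g w0) < \<mu> / 2"
        using \<delta>(3)[OF w, of 0] r(1) by (simp add: G_def w0)
      moreover have "norm (G z w - G z 0) < \<mu> / 2" using \<delta>(3)[OF w, of z] z by simp
      moreover have "\<mu> \<le> norm (G z 0 - g w0)" unfolding \<mu>_def using z0(2)[of z] z by simp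
      moreover have "norm (G z 0 - g w0) \<le> norm (G z w - g w0) + norm (G z w - G z 0)"
        using norm_triangle_ineq4[of "G z w - g w0" "G z w - G z 0"] by simp
      ultimately show ?thesis by linarith
    qed
    then obtain z where "z \<in> ball 0 r" "G z w - g w0 = 0"
      using holomorphic_contract_to_zero[OF c h r(1)] by blast
    then show ?thesis by (intro exI[of _ z]) auto
  qed
  have "ball 0 \<delta> \<subseteq> (\<lambda>p. p $ 2 - b) ` {w \<in> Q. g w = g w0}"
  proof
    fix w :: complex assume "w \<in> ball 0 \<delta>"
    then have w: "norm w < \<delta>" by simp
    then obtain z where z: "norm z \<le> r" "G z w = g w0" using zero by blast
    have "vector [a + z, b + w] \<in> {w \<in> Q. g w = g w0}"
      using z e(2)[of z w] \<delta>(2)[OF w] r(2) by (simp add: G_def)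
    then show "w \<in> (\<lambda>p. p $ 2 - b) ` {w \<in> Q. g w = g w0}"
      by (intro image_eqI[of _ _ "vector [a + z, b + w]"]) auto
  qed
  then have "finite (ball (0::complex) \<delta>)" using fin finite_surj by blast
  then show False using finite_imp_not_open[of "ball (0::complex) \<delta>"] \<delta>(1) by simp
qed

section \<open>Local connectedness of the cone\<close>

text \<open>The set \<open>B\<close>, a vertical segment over \<open>l' \<noteq> l\<close> joined to
  the bottom slice, avoids the removed point. Every slice at a height other than \<open>t\<close>
  meets \<open>B\<close>, as does every segment over a point other than \<open>l\<close>, and
  together these sets fill the rest.\<close>

lemma connected_Times_minus_point:
  fixes A :: "'a::topological_space set" and t \<eta> :: real
  assumes A: "connected A" "l \<in> A" "A \<noteq> {l}" and \<eta>: "\<eta> > 0"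
  shows "connected (A \<times> {t - \<eta>..t + \<eta>} - {(l, t)})"
proof -
  define I where "I = {t - \<eta>..t + \<eta>}"
  have I: "connected I" "t - \<eta> \<in> I" using \<eta> by (auto simp: I_def)
  obtain l' where l': "l' \<in> A" "l' \<noteq> l" using A by blast
  define B where "B = {l'} \<times> I \<union> A \<times> {t - \<eta>}"
  have B: "connected B"
    unfolding B_def using A(1) I l'(1) by (intro connected_Un connected_Times) auto
  define F where "F = (\<lambda>s. B \<union> A \<times> {s}) ` (I - {t}) \<union> (\<lambda>a. B \<union> {a} \<times> I) ` (A - {l})"
  have "connected (\<Union>F)"
  proof (rule connected_Union)
    show "connected S" if "S \<in> F" for S
    proof -
      have "connected (B \<union> A \<times> {s})" if "s \<in> I - {t}" for s
        using B A(1) l'(1) that by (intro connected_Un connected_Times) (auto simp: B_def)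
      moreover have "connected (B \<union> {a} \<times> I)" if "a \<in> A - {l}" for a
        using B I that by (intro connected_Un connected_Times) (auto simp: B_def)
      ultimately show ?thesis using \<open>S \<in> F\<close> by (auto simp: F_def)
    qed
    have "(l', t - \<eta>) \<in> \<Inter>F" using I l' by (auto simp: F_def B_def)
    then show "\<Inter>F \<noteq> {}" by blast
  qed
  moreover have "\<Union>F = A \<times> I - {(l, t)}"
  proof
    show "\<Union>F \<subseteq> A \<times> I - {(l, t)}" using l' I \<eta> by (auto simp: F_def B_def)
    show "A \<times> I - {(l, t)} \<subseteq> \<Union>F" by (auto simp: F_def)
  qed
  ultimately show ?thesis by (simp add: I_def)
qed

text \<open>Away from vertex and base the cone is locally a product of the link with an interval. A
  connected neighbourhood in the link times an interval stays connected after removal of one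
  point.\<close>

lemma cone_no_cut_point:
  fixes K L :: "'a::metric_space set"
  assumes cone: "cone_over p L K" and L: "compact L"
    and lc: "\<And>l e. l \<in> L \<Longrightarrow> e > 0 \<Longrightarrow>
      \<exists>A d. connected A \<and> l \<in> A \<and> A \<noteq> {l} \<and> A \<subseteq> L \<inter> ball l e \<and> d > 0 \<and> L \<inter> ball l d \<subseteq> A"
    and x: "x \<in> K" "x \<noteq> p" "x \<notin> L" and e: "e > 0"
  shows "\<exists>U d. U \<subseteq> K \<inter> ball x e \<and> d > 0 \<and> K \<inter> ball x d \<subseteq> U \<and> connected (U - {x})"
proof -
  obtain H where H: "continuous_on (L \<times> {0..1::real}) H" "H ` (L \<times> {0..1}) = K"
    "\<And>x. x \<in> L \<Longrightarrow> H (x, 0) = p \<and> H (x, 1) = x" "inj_on H (L \<times> {0<..1})"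
    using cone unfolding cone_over_def by blast
  obtain l t where lt: "l \<in> L" "0 \<le> t" "t \<le> 1" "x = H (l, t)" using x(1) H(2) by auto
  have t: "0 < t" "t < 1"
    using lt x(2,3) H(3)[OF lt(1)] by (metis order_le_less)+
  obtain \<delta> where \<delta>: "\<delta> > 0" "\<And>z. z \<in> L \<times> {0..1} \<Longrightarrow> dist z (l, t) < \<delta> \<Longrightarrow> dist (H z) x < e"
    using H(1) lt e unfolding continuous_on_iff by (metis SigmaI atLeastAtMost_iff)
  obtain A d where A: "connected A" "l \<in> A" "A \<noteq> {l}" "A \<subseteq> L \<inter> ball l (\<delta> / 2)" "d > 0" "L \<inter> ball l d \<subseteq> A"
    using lc[OF lt(1), of "\<delta> / 2"] \<delta>(1) by auto
  \<comment> \<open>With \<open>\<delta> / 2\<close> for the link factor,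
    \<open>\<delta> / 4\<close> stays below \<open>\<delta>\<close> in total; the other bounds keep
    the interval away from the vertex and the base.\<close>
  define \<eta> where "\<eta> = min (\<delta> / 4) (min (t / 2) ((1 - t) / 2))"
  have \<eta>: "\<eta> > 0" "\<eta> \<le> \<delta> / 4" "\<eta> < t" "\<eta> < 1 - t" using \<delta>(1) t by (auto simp: \<eta>_def min_def)
  define I where "I = {t - \<eta>..t + \<eta>}"
  have I: "I \<subseteq> {0<..1}" "t \<in> I" using \<eta> by (auto simp: I_def)
  have AI: "A \<times> I \<subseteq> L \<times> {0<..1}" "A \<times> I \<subseteq> L \<times> {0..1}" using A(4) I by auto
  have near: "dist (H z) x < e" if zAI: "z \<in> A \<times> I" for z
  proof (rule \<delta>(2))
    show "z \<in> L \<times> {0..1}" using AI zAI by blast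
    obtain a s where z: "z = (a, s)" "a \<in> A" "s \<in> I" using zAI by auto
    have "dist z (l, t) \<le> dist a l + dist s t"
      unfolding z dist_Pair_Pair by (rule sqrt_sum_squares_le_sum) auto
    also have "dist a l < \<delta> / 2" using A(4) z(2) by (auto simp: dist_commute)
    also have "dist s t \<le> \<delta> / 4" using z(3) \<eta>(2) unfolding I_def dist_real_def atLeastAtMost_iff by linarith
    finally show "dist z (l, t) < \<delta>" using \<delta>(1) by simp
  qed
  \<comment> \<open>The complement of an open box about \<open>(l, t)\<close> is compact, so its
    image is closed, and injectivity keeps \<open>x\<close> out of it. A ball about \<open>x\<close>
    that misses this image meets \<open>K\<close> in points of the box only.\<close>
  define Z where "Z = L \<times> {0..1} - ball l d \<times> ball t \<eta>"
  have "compact Z"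
    unfolding Z_def by (intro compact_diff compact_Times L open_Times open_ball) auto
  then have "closed (H ` Z)"
    by (intro compact_imp_closed compact_continuous_image continuous_on_subset[OF H(1)]) (auto simp: Z_def)
  moreover have "x \<notin> H ` Z"
  proof
    assume "x \<in> H ` Z"
    then obtain a s where as: "(a, s) \<in> Z" "x = H (a, s)" by auto
    then have "a \<in> L" "0 \<le> s" "s \<le> 1" by (auto simp: Z_def)
    moreover have "s \<noteq> 0" using as(2) x(2) H(3) calculation by auto
    ultimately have "(a, s) = (l, t)"
      using inj_onD[OF H(4), of "(a, s)" "(l, t)"] as(2) lt t by auto
    then show False using as(1) A(5) \<eta>(1) by (auto simp: Z_def)
  qed
  ultimately obtain d' where d': "d' > 0" "ball x d' \<subseteq> - (H ` Z)"
    by (metis ComplI openE open_Compl)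
  have inj: "H ` (A \<times> I) - {x} = H ` (A \<times> I - {(l, t)})"
  proof -
    have "(l, t) \<in> A \<times> I" using A(2) I(2) by auto
    then show ?thesis
      unfolding lt(4) using inj_on_image_set_diff[OF inj_on_subset[OF H(4) AI(1)], of "A \<times> I" "{(l, t)}"] by auto
  qed
  show ?thesis
  proof (intro exI conjI)
    show "H ` (A \<times> I) \<subseteq> K \<inter> ball x e" using near AI(2) H(2) by (auto simp: dist_commute)
    show "K \<inter> ball x d' \<subseteq> H ` (A \<times> I)"
    proof
      fix y assume y: "y \<in> K \<inter> ball x d'"
      then obtain a s where as: "a \<in> L" "s \<in> {0..1}" "y = H (a, s)" using H(2) by auto
      then have "(a, s) \<notin> Z" using y d'(2) by auto
      then have "a \<in> ball l d" "s \<in> ball t \<eta>" using as by (auto simp: Z_def)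
      then have "a \<in> A" "s \<in> I" using A(6) as(1) by (auto simp: I_def dist_real_def)
      then show "y \<in> H ` (A \<times> I)" using as(3) by blast
    qed
    show "connected (H ` (A \<times> I) - {x})"
      unfolding inj unfolding I_def
      using AI(2) by (intro connected_continuous_image continuous_on_subset[OF H(1)]
          connected_Times_minus_point A \<eta>(1)) (auto simp: I_def)
  qed (fact d'(1))
qed

section \<open>Topology of solid tori and of their union\<close>

lemma solid_torus_topology:
  fixes T :: "'a::metric_space set"
  assumes "solid_torus_with_boundary T \<tau>"
  shows "compact T" "connected T" "locally connected T" "path_connected \<tau>" "\<tau> \<noteq> {}"
    "\<And>x. T \<noteq> {x}"
proof -
  obtain g g' where g: "homeomorphism (bidisc \<D> \<S>) T g g'" "g ` bidisc \<S> \<S> = \<tau>"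
    using assms unfolding solid_torus_with_boundary_def by blast
  let ?f = "\<lambda>z. (vector [fst z, snd z] :: complex^2)"
  have contf: "continuous_on A ?f" for A by (intro continuous_intros)
  have f: "homeomorphism (A \<times> B) (bidisc A B) ?f (\<lambda>w. (w $ 1, w $ 2))" for A B
    by (rule homeomorphismI[OF contf]) (auto simp: bidisc_def vec_eq_iff forall_2 intro!: continuous_intros)
  have hom: "\<D> \<times> \<S> homeomorphic T"
    using homeomorphism_compose[OF f g(1)] unfolding homeomorphic_def by blast
  have dim: "2 \<le> DIM(complex)" by simp
  show "compact T"
    using homeomorphic_compactness[OF hom] compact_Times[OF compact_cball compact_sphere] by blast
  have cS: "connected \<S>" "path_connected \<S>"
    using connected_sphere[OF dim] path_connected_sphere[OF dim] by auto
  show "connected T"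
    using homeomorphic_connectedness[OF hom] connected_Times[OF connected_cball cS(1)] by blast
  have "locally connected (\<D> \<times> \<S>)"
    by (rule locally_Times[of connected _ connected _ connected])
       (auto intro!: convex_imp_locally_connected locally_connected_sphere connected_Times)
  then show "locally connected T"
    using homeomorphic_locally[OF hom, of connected connected] homeomorphic_connectedness by blast
  have "path_connected (\<S> \<times> \<S>)" using cS(2) by (intro path_connected_Times)
  then have "path_connected (?f ` (\<S> \<times> \<S>))" by (intro path_connected_continuous_image contf)
  then have "path_connected (bidisc \<S> \<S>)" using homeomorphism_image1[OF f, of \<S> \<S>] by simp
  then have "path_connected (g ` bidisc \<S> \<S>)"
    by (intro path_connected_continuous_image continuous_on_subset[OF homeomorphism_cont1[OF g(1)]])
       (auto simp: bidisc_def)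
  then show "path_connected \<tau>" using g(2) by simp
  have pts: "vector [1, 1] \<in> bidisc \<S> \<S>" "vector [1, 1] \<in> bidisc \<D> \<S>" "vector [0, 1] \<in> bidisc \<D> \<S>"
    by (auto simp: bidisc_def)
  then show "\<tau> \<noteq> {}" using g(2) by blast
  show "T \<noteq> {x}" for x
  proof
    assume "T = {x}"
    then have "g (vector [1, 1]) = g (vector [0, 1])"
      using pts homeomorphism_image1[OF g(1)] by (metis imageI singletonD)
    then have "vector [1, 1] = (vector [0, 1] :: complex^2)"
      using pts homeomorphism_apply1[OF g(1)] by metis
    then have "(vector [1, 1] :: complex^2) $ 1 = (vector [0, 1] :: complex^2) $ 1" by simp
    then show False by simp
  qed
qed

text \<open>For \<open>l\<close> outside \<open>T\<close> the neighbourhood degenerates to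
  \<open>{l}\<close>. Allowing this lets the union of two tori be treated at one stroke: the two
  connected sets always share \<open>l\<close>, and at least one of them has a second point.\<close>

lemma solid_torus_connected_neighbourhood:
  fixes T :: "'a::metric_space set"
  assumes T: "solid_torus_with_boundary T \<tau>" and e: "e > 0"
  shows "\<exists>A d. connected A \<and> l \<in> A \<and> A \<subseteq> insert l T \<inter> ball l e \<and> d > 0 \<and> T \<inter> ball l d \<subseteq> A \<and> (l \<in> T \<longrightarrow> A \<noteq> {l})"
proof (cases "l \<in> T")
  case False
  then obtain d where "d > 0" "ball l d \<subseteq> - T"
    using solid_torus_topology(1)[OF T] by (metis ComplI compact_imp_closed openE open_Compl)
  then show ?thesis using False e by (intro exI[of _ "{l}"] exI[of _ d]) auto
next
  case True
  have "openin (top_of_set T) (T \<inter> ball l e)" by (simp add: openin_open_Int)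
  then obtain U A where A: "openin (top_of_set T) U" "connected A" "l \<in> U" "U \<subseteq> A" "A \<subseteq> T \<inter> ball l e"
    using solid_torus_topology(3)[OF T] True e unfolding locally_def by (metis IntI centre_in_ball)
  obtain d where d: "d > 0" "T \<inter> ball l d \<subseteq> U"
    using A(1,3) unfolding openin_contains_ball by (metis Int_commute)
  have "l islimpt T" using connected_imp_perfect[OF solid_torus_topology(2)[OF T] True] solid_torus_topology(6)[OF T] by blast
  then obtain z where "z \<in> T" "z \<noteq> l" "dist z l < d" using d(1) unfolding islimpt_approachable by blast
  then have "z \<in> A" using d(2) A(4) by (auto simp: dist_commute)
  then have "A \<noteq> {l}" using \<open>z \<noteq> l\<close> by blast
  then show ?thesis using A d by (intro exI[of _ A] exI[of _ d]) auto
qed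

lemma two_solid_tori_connected_neighbourhood:
  fixes T1 T2 :: "'a::metric_space set"
  assumes T: "solid_torus_with_boundary T1 \<tau>1" "solid_torus_with_boundary T2 \<tau>2"
    and l: "l \<in> T1 \<union> T2" and e: "e > 0"
  shows "\<exists>A d. connected A \<and> l \<in> A \<and> A \<noteq> {l} \<and> A \<subseteq> (T1 \<union> T2) \<inter> ball l e \<and> d > 0 \<and> (T1 \<union> T2) \<inter> ball l d \<subseteq> A"
proof -
  obtain A1 d1 where 1: "connected A1" "l \<in> A1" "A1 \<subseteq> insert l T1 \<inter> ball l e" "d1 > 0" "T1 \<inter> ball l d1 \<subseteq> A1" "l \<in> T1 \<longrightarrow> A1 \<noteq> {l}"
    using solid_torus_connected_neighbourhood[OF T(1) e, of l] by (elim exE conjE)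
  obtain A2 d2 where 2: "connected A2" "l \<in> A2" "A2 \<subseteq> insert l T2 \<inter> ball l e" "d2 > 0" "T2 \<inter> ball l d2 \<subseteq> A2" "l \<in> T2 \<longrightarrow> A2 \<noteq> {l}"
    using solid_torus_connected_neighbourhood[OF T(2) e, of l] by (elim exE conjE)
  have "connected (A1 \<union> A2)" using 1(1,2) 2(1,2) connected_Un[of A1 A2] by blast
  moreover have "A1 \<union> A2 \<noteq> {l}" using 1(2,6) 2(2,6) l by blast
  moreover have "A1 \<union> A2 \<subseteq> (T1 \<union> T2) \<inter> ball l e" using 1(3) 2(3) l by blast
  moreover have "(T1 \<union> T2) \<inter> ball l (min d1 d2) \<subseteq> A1 \<union> A2" using 1(5) 2(5) by auto
  ultimately show ?thesis using 1(2,4) 2(4) by (intro exI[of _ "A1 \<union> A2"] exI[of _ "min d1 d2"]) auto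
qed

section \<open>Density of the unramified part\<close>

text \<open>Otherwise one coordinate of \<phi> would vanish at each point near \<open>x\<close>. On
  a chart at a nearby manifold point one coordinate then vanishes on an open set, and the other
  alone has finite fibres there, which is impossible for a holomorphic function of two
  variables.\<close>

lemma unramified_dense_interior:
  fixes \<phi> :: "complex^'n \<Rightarrow> complex^2"
  assumes qo: "quasi_ordinary_morphism p \<epsilon> X \<phi>" and x: "x \<in> X" "norm (\<phi> x $ 1) < 1" "norm (\<phi> x $ 2) < 1"
  shows "x \<in> closure {y \<in> X. norm (\<phi> y $ 1) < 1 \<and> norm (\<phi> y $ 2) < 1 \<and> \<phi> y $ 1 \<noteq> 0 \<and> \<phi> y $ 2 \<noteq> 0}"
    (is "x \<in> closure ?C")
proof (rule ccontr)
  assume neg: "x \<notin> closure ?C"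
  have an: "analytic_map_on X \<phi>" and fin: "\<And>w. finite {x \<in> X. \<phi> x = w}" and pd: "pure_dimension_two X"
    using qo unfolding quasi_ordinary_morphism_def surface_germ_def by auto
  have cont: "continuous_on X \<phi>" using analytic_map_on_continuous[OF an] .
  have "open {w :: complex^2. norm (w $ 1) < 1 \<and> norm (w $ 2) < 1}"
    by (intro open_Collect_conj open_Collect_less continuous_intros)
  then have "openin (top_of_set X) (X \<inter> \<phi> -` {w. norm (w $ 1) < 1 \<and> norm (w $ 2) < 1})"
    by (rule continuous_openin_preimage_gen[OF cont])
  then obtain N where N: "open N" "X \<inter> \<phi> -` {w. norm (w $ 1) < 1 \<and> norm (w $ 2) < 1} = X \<inter> N"
    by (auto simp: openin_open)
  define O' where "O' = N \<inter> - closure ?C"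
  have O': "open O'" "x \<in> O'" using N x neg by (auto simp: O'_def)
  have zero: "\<phi> y $ 1 = 0 \<or> \<phi> y $ 2 = 0" if "y \<in> X \<inter> O'" for y
  proof -
    have "y \<in> X \<inter> N" "y \<notin> ?C" using that closure_subset[of ?C] unfolding O'_def by blast+
    then show ?thesis unfolding N(2)[symmetric] by blast
  qed
  obtain y \<psi> where y: "y \<in> X" "y \<in> O'" "local_analytic_iso_at X \<psi> y"
  proof -
    have "x \<in> O' \<inter> closure {x \<in> X. \<exists>\<psi>. local_analytic_iso_at X \<psi> x}"
      using pd x(1) O'(2) unfolding pure_dimension_two_def by blast
    then have "O' \<inter> {x \<in> X. \<exists>\<psi>. local_analytic_iso_at X \<psi> x} \<noteq> {}"
      using open_Int_closure_eq_empty[OF O'(1)] by blast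
    then show ?thesis using that by blast
  qed
  obtain V Q where V: "open V" "y \<in> V" "open Q" "analytic_iso (X \<inter> V) Q \<psi>"
    using y(3) unfolding local_analytic_iso_at_def by blast
  define k where "k = inv_into (X \<inter> V) \<psi>"
  have bij: "bij_betw \<psi> (X \<inter> V) Q" and ak: "analytic_map_on Q k"
    using V(4) unfolding analytic_iso_def k_def by auto
  have kbij: "bij_betw k Q (X \<inter> V)" unfolding k_def using bij by (rule bij_betw_inv_into)
  have ck: "continuous_on Q k" using analytic_map_on_continuous[OF ak] .
  have kX: "k w \<in> X" if "w \<in> Q" for w using kbij that by (auto simp: bij_betw_def)
  define Q1 where "Q1 = Q \<inter> k -` O'"
  have Q1: "open Q1"
    using continuous_on_open_vimage[OF V(3), of k] ck O'(1) by (simp add: Q1_def Int_commute)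
  have y0: "\<psi> y \<in> Q1"
    using bij y V(2) bij_betw_inv_into_left[OF bij] by (auto simp: Q1_def k_def bij_betw_def)
  have contU: "continuous_on Q (\<lambda>w. \<phi> (k w) $ i)" for i
    using kX by (intro continuous_intros continuous_on_compose2[OF cont ck]) auto
  \<comment> \<open>Where all coordinates but the \<open>i\<close>-th vanish, a fibre of that
    coordinate is a fibre of \<phi>, hence finite.\<close>
  have contra: False
    if Q': "open Q'" "w1 \<in> Q'" "Q' \<subseteq> Q" and z: "\<And>w l. w \<in> Q' \<Longrightarrow> l \<noteq> i \<Longrightarrow> \<phi> (k w) $ l = 0" for Q' w1 i
  proof -
    have "infinite {w \<in> Q'. \<phi> (k w) $ i = \<phi> (k w1) $ i}"
    proof (rule analytic_function_infinite_fibre[OF Q'(1,2)])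
      show "continuous_on Q' (\<lambda>w. \<phi> (k w) $ i)" using contU Q'(3) continuous_on_subset by blast
      fix S :: "complex set" and a b assume S: "open S" "\<And>z. z \<in> S \<Longrightarrow> vector [a + z, b] \<in> Q'"
      then have SQ: "\<And>z. z \<in> S \<Longrightarrow> vector [a + z, b] \<in> Q" using Q'(3) by blast
      have line: "(\<lambda>z. (vector [a + z, b] :: complex^2) $ l) holomorphic_on S" for l
        using exhaust_2[of l] by (auto intro!: holomorphic_intros)
      have "(\<lambda>z. k (vector [a + z, b]) $ j) holomorphic_on S" for j
        by (rule analytic_map_on_compose_curve[OF ak S(1) SQ line])
      then show "(\<lambda>z. \<phi> (k (vector [a + z, b])) $ i) holomorphic_on S"
        by (intro analytic_map_on_compose_curve[OF an S(1)] kX SQ)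
    qed
    moreover have "finite {w \<in> Q'. \<phi> (k w) $ i = \<phi> (k w1) $ i}"
    proof (rule inj_on_finite)
      show "inj_on k {w \<in> Q'. \<phi> (k w) $ i = \<phi> (k w1) $ i}"
        using kbij Q'(3) by (auto simp: bij_betw_def intro: inj_on_subset)
      show "k ` {w \<in> Q'. \<phi> (k w) $ i = \<phi> (k w1) $ i} \<subseteq> {x \<in> X. \<phi> x = \<phi> (k w1)}"
      proof clarify
        fix w assume w: "w \<in> Q'" "\<phi> (k w) $ i = \<phi> (k w1) $ i"
        have "\<phi> (k w) $ l = \<phi> (k w1) $ l" for l
          using z[OF w(1), of l] z[OF Q'(2), of l] w(2) by (cases "l = i") auto
        then show "k w \<in> X \<and> \<phi> (k w) = \<phi> (k w1)" using kX Q'(3) w(1) by (auto simp: vec_eq_iff)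
      qed
    qed (rule fin)
    ultimately show False by blast
  qed
  have prod0: "\<phi> (k w) $ 1 = 0 \<or> \<phi> (k w) $ 2 = 0" if "w \<in> Q1" for w
    using zero[of "k w"] that kX by (auto simp: Q1_def)
  show False
  proof (cases "\<exists>w1\<in>Q1. \<phi> (k w1) $ 1 \<noteq> 0")
    case True
    then obtain w1 where w1: "w1 \<in> Q1" "\<phi> (k w1) $ 1 \<noteq> 0" by blast
    \<comment> \<open>The product of the two coordinates vanishes, so the second one vanishes on the
      open set where the first does not.\<close>
    define Q2 where "Q2 = Q1 \<inter> (\<lambda>w. \<phi> (k w) $ 1) -` (- {0})"
    have "continuous_on Q1 (\<lambda>w. \<phi> (k w) $ 1)" using contU by (rule continuous_on_subset) (auto simp: Q1_def)
    then have "open ((\<lambda>w. \<phi> (k w) $ 1) -` (- {0}) \<inter> Q1)"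
      using continuous_on_open_vimage[OF Q1, of "\<lambda>w. \<phi> (k w) $ 1"] open_Compl[OF closed_singleton] by blast
    then have Q2: "open Q2" by (simp only: Q2_def Int_commute)
    have mem: "w1 \<in> Q2" and sub: "Q2 \<subseteq> Q" using w1 by (simp_all add: Q2_def) (auto simp: Q1_def)
    have "\<phi> (k w) $ l = 0" if "w \<in> Q2" "l \<noteq> 1" for w l
      using prod0[of w] that exhaust_2[of l] by (auto simp: Q2_def)
    then show False by (rule contra[OF Q2 mem sub])
  next
    case False
    then have "\<phi> (k w) $ l = 0" if "w \<in> Q1" "l \<noteq> 2" for w l
      using that exhaust_2[of l] by auto
    moreover have "Q1 \<subseteq> Q" by (simp add: Q1_def)
    ultimately show False using contra[OF Q1 y0] by blast
  qed
qed

section \<open>The covering of a quasi-ordinary germ\<close>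

text \<open>Points of the base are limits along their own rays; injectivity of the cone coordinates
  keeps the rays off the base before time 1.\<close>

lemma cone_base_complement_dense:
  fixes K L :: "'a::metric_space set"
  assumes "cone_over p L K"
  shows "K \<subseteq> closure (K - L)"
proof
  fix x assume x: "x \<in> K"
  obtain H where H: "continuous_on (L \<times> {0..1::real}) H" "H ` (L \<times> {0..1}) = K"
    "\<And>x. x \<in> L \<Longrightarrow> H (x, 0) = p \<and> H (x, 1) = x" "inj_on H (L \<times> {0<..1})"
    using assms unfolding cone_over_def by blast
  show "x \<in> closure (K - L)"
  proof (cases "x \<in> L")
    case False
    then show ?thesis using x closure_subset by blast
  next
    case True
    \<comment> \<open>Two successors keep \<open>t 0\<close> positive, inside the range where the
      cone coordinates are injective.\<close>
    define t where "t n = 1 - inverse (real (Suc (Suc n)))" for n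
    have t: "0 < t n" "t n < 1" for n by (auto simp: t_def field_simps)
    have "t \<longlonglongrightarrow> 1 - 0"
      unfolding t_def by (intro tendsto_diff tendsto_const filterlim_compose[OF LIMSEQ_inverse_real_of_nat filterlim_Suc])
    then have "(\<lambda>n. (x, t n)) \<longlonglongrightarrow> (x, 1)" by (intro tendsto_Pair tendsto_const) simp
    then have lim: "(\<lambda>n. H (x, t n)) \<longlonglongrightarrow> H (x, 1)"
      using True by (intro continuous_on_tendsto_compose[OF H(1)]) (auto intro!: always_eventually less_imp_le t)
    have "H (x, t n) \<in> K - L" for n
    proof
      show "H (x, t n) \<in> K" using H(2) True t[of n] by auto
      show "H (x, t n) \<notin> L"
      proof
        assume L: "H (x, t n) \<in> L"
        then have "H (H (x, t n), 1) = H (x, t n)" using H(3) by blast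
        then have "(H (x, t n), 1) = (x, t n)"
          using L True t[of n] by (intro inj_onD[OF H(4)]) auto
        then show False using t[of n] by simp
      qed
    qed
    then show ?thesis using lim H(3)[OF True] unfolding closure_sequential by (intro exI[of _ "\<lambda>n. H (x, t n)"]) auto
  qed
qed

lemma separated_branches_of_unibranch_cover:
  assumes "unibranch_cover K u v \<Psi> H \<alpha> \<Lambda>"
  shows "separated_branches K u v \<Psi> H"
proof -
  interpret unibranch_cover K u v \<Psi> H \<alpha> \<Lambda> by fact
  show ?thesis
    unfolding separated_branches_def fst_H
  proof (intro allI impI)
    fix s j assume "Re s \<le> 0" "center (s + period j) = center s"
    then have "\<alpha> dvd j" by (rule center_inj)
    then show "j \<in> range ((*) \<alpha>)" by auto
  qed
qed

text \<open>The chart of the ambient surface is restricted to the preimage of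
  \<open>A \<times> B\<close> and is open relative to it. Thus points of the link, where the closed
  bidisc has a boundary, need no separate treatment.\<close>

lemma local_analytic_iso_bidisc_chart:
  fixes \<phi> :: "complex^'n \<Rightarrow> complex^2"
  assumes iso: "local_analytic_iso_at X \<phi> x" and C: "C = {x \<in> X. \<phi> x $ 1 \<in> A \<and> \<phi> x $ 2 \<in> B}" and x: "x \<in> C"
  shows "\<exists>U V g. x \<in> U \<and> openin (top_of_set C) U \<and> openin (top_of_set (A \<times> B)) V \<and>
    homeomorphism U V (\<lambda>x. (\<phi> x $ 1, \<phi> x $ 2)) g"
proof -
  obtain V Q where V: "open V" "x \<in> V" "open Q" "analytic_iso (X \<inter> V) Q \<phi>"
    using iso unfolding local_analytic_iso_at_def by blast
  define k where "k = inv_into (X \<inter> V) \<phi>"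
  have h: "homeomorphism (X \<inter> V) Q \<phi> k" unfolding k_def by (rule analytic_iso_homeomorphism[OF V(4)])
  let ?vec = "\<lambda>z. (vector [fst z, snd z] :: complex^2)"
  define W where "W = (A \<times> B) \<inter> ?vec -` Q"
  have vecQ: "(vector [\<phi> y $ 1, \<phi> y $ 2] :: complex^2) = \<phi> y" for y by (simp add: vec_eq_iff forall_2)
  have CX: "C \<inter> V \<subseteq> X \<inter> V" using C by auto
  have WQ: "?vec z \<in> Q" if "z \<in> W" for z using that by (simp add: W_def)
  have "homeomorphism (C \<inter> V) W (\<lambda>x. (\<phi> x $ 1, \<phi> x $ 2)) (\<lambda>z. k (?vec z))"
  proof (rule homeomorphismI)
    show "continuous_on (C \<inter> V) (\<lambda>x. (\<phi> x $ 1, \<phi> x $ 2))"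
      by (intro continuous_intros continuous_on_subset[OF homeomorphism_cont1[OF h] CX])
    show "continuous_on W (\<lambda>z. k (?vec z))"
      using WQ by (intro continuous_on_compose2[OF homeomorphism_cont2[OF h]] continuous_intros) auto
    show "(\<lambda>x. (\<phi> x $ 1, \<phi> x $ 2)) ` (C \<inter> V) \<subseteq> W"
      using homeomorphism_image1[OF h] CX C by (auto simp: W_def vecQ)
    show "(\<lambda>z. k (?vec z)) ` W \<subseteq> C \<inter> V"
    proof clarify
      fix a b assume z: "(a, b) \<in> W"
      then have "k (?vec (a, b)) \<in> X \<inter> V" "\<phi> (k (?vec (a, b))) = ?vec (a, b)"
        using WQ[OF z] homeomorphism_image2[OF h] homeomorphism_apply2[OF h] by blast+
      then show "k (?vec (a, b)) \<in> C \<inter> V" using z unfolding C by (auto simp: W_def)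
    qed
    show "k (?vec (\<phi> y $ 1, \<phi> y $ 2)) = y" if "y \<in> C \<inter> V" for y
      using homeomorphism_apply1[OF h, of y] CX that by (auto simp: vecQ)
    show "(\<phi> (k (?vec z)) $ 1, \<phi> (k (?vec z)) $ 2) = z" if "z \<in> W" for z
      using homeomorphism_apply2[OF h WQ[OF that]] by simp
  qed
  moreover have "openin (top_of_set (A \<times> B)) W"
    unfolding W_def by (intro continuous_openin_preimage_gen V(3) continuous_intros)
  ultimately show ?thesis
    using x V(1,2) by (intro exI[of _ "C \<inter> V"] exI[of _ W]) (auto simp: openin_open_Int)
qed

text \<open>Everything needed about a single germ. The lattice depends only on \<open>n\<close>,
  \<open>q\<close>, \<open>a\<close> and \<open>b\<close>, which makes two germs comparable.\<close>

lemma lens_germ_cover: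
  fixes X :: "(complex^'n) set" and \<phi> :: "complex^'n \<Rightarrow> complex^2"
  defines "K \<equiv> compact_rep X \<phi>" and "u \<equiv> \<lambda>x. \<phi> x $ 1" and "v \<equiv> \<lambda>x. \<phi> x $ 2"
  assumes nq: "q < n" "coprime q n"
    and good: "good_compact_rep p \<epsilon> X \<phi>"
    and lens: "lens_space n q (link X \<phi>) (X \<inter> \<phi> -` bidisc \<S> \<D>) (X \<inter> \<phi> -` bidisc \<D> \<S>) (link_orientation X \<phi>)"
    and deg_a: "has_covering_degree \<phi> (X \<inter> \<phi> -` bidisc \<S> {0}) (bidisc \<S> {0}) a"
    and deg_b: "has_covering_degree \<phi> (X \<inter> \<phi> -` bidisc {0} \<S>) (bidisc {0} \<S>) b"
  obtains \<Psi> where "bidisc_cover K u v \<Psi> (lens_lattice (int n) (int q) (int a) (int b))"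
    "separated_branches K u v \<Psi> (lens_lattice (int n) (int q) (int a) (int b))"
    "separated_branches K v u (\<lambda>t s. \<Psi> s t) (prod.swap ` lens_lattice (int n) (int q) (int a) (int b))"
proof -
  have qo: "quasi_ordinary_morphism p \<epsilon> X \<phi>" and compK: "compact K" and cone: "cone_over p (link X \<phi>) K"
    using good unfolding good_compact_rep_def K_def by auto
  have an: "analytic_map_on X \<phi>" and fin: "\<And>w. finite {x \<in> X. \<phi> x = w}" and p: "{x \<in> X. \<phi> x = 0} = {p}"
    and disc: "discriminant X \<phi> \<subseteq> coordinate_cross"
    using qo unfolding quasi_ordinary_morphism_def by auto
  have cont: "continuous_on X \<phi>" using analytic_map_on_continuous[OF an] .
  have K: "K = {x \<in> X. norm (u x) \<le> 1 \<and> norm (v x) \<le> 1}"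
    by (auto simp: K_def compact_rep_def bidisc_def u_def v_def)
  have KX: "K \<subseteq> X" using K by auto
  have contu: "continuous_on K u" and contv: "continuous_on K v"
    unfolding u_def v_def by (intro continuous_intros continuous_on_subset[OF cont KX])+
  have phi_eq: "\<phi> x = w \<longleftrightarrow> u x = w $ 1 \<and> v x = w $ 2" for x w
    by (simp add: u_def v_def vec_eq_iff forall_2)
  define T1 where "T1 = {x \<in> K. norm (u x) = 1}"
  define T2 where "T2 = {x \<in> K. norm (v x) = 1}"
  have T: "X \<inter> \<phi> -` bidisc \<S> \<D> = T1" "X \<inter> \<phi> -` bidisc \<D> \<S> = T2"
    by (auto simp: T1_def T2_def K u_def v_def bidisc_def)
  have \<tau>: "T1 \<inter> T2 = {x \<in> K. norm (u x) = 1 \<and> norm (v x) = 1}" by (auto simp: T1_def T2_def)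
  have lens': "lens_space n q (link X \<phi>) T1 T2 (link_orientation X \<phi>)" using lens unfolding T .
  then have tori: "solid_torus_with_boundary T1 (T1 \<inter> T2)" "solid_torus_with_boundary T2 (T1 \<inter> T2)"
    and link: "link X \<phi> = T1 \<union> T2"
    unfolding lens_space_def by auto
  define C where "C = {x \<in> K. u x \<noteq> 0 \<and> v x \<noteq> 0}"
  have iso: "local_analytic_iso_at X \<phi> x" if "x \<in> C" for x
  proof (rule ccontr)
    assume "\<not> local_analytic_iso_at X \<phi> x"
    then have "\<phi> x \<in> discriminant X \<phi>" using that KX by (auto simp: discriminant_def C_def)
    then show False using disc that by (auto simp: coordinate_cross_def C_def u_def v_def)
  qed
  \<comment> \<open>Density off the link comes from purity of dimension, density at the link from
    the cone.\<close>
  have dense: "K \<subseteq> closure C"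
  proof -
    have "K - link X \<phi> \<subseteq> closure C"
    proof
      fix x assume x: "x \<in> K - link X \<phi>"
      then have "x \<in> X" "norm (\<phi> x $ 1) < 1" "norm (\<phi> x $ 2) < 1"
        unfolding link T1_def T2_def K by (auto simp: u_def v_def)
      then have A: "x \<in> closure {y \<in> X. norm (\<phi> y $ 1) < 1 \<and> norm (\<phi> y $ 2) < 1 \<and> \<phi> y $ 1 \<noteq> 0 \<and> \<phi> y $ 2 \<noteq> 0}"
        by (rule unramified_dense_interior[OF qo])
      have B: "{y \<in> X. norm (\<phi> y $ 1) < 1 \<and> norm (\<phi> y $ 2) < 1 \<and> \<phi> y $ 1 \<noteq> 0 \<and> \<phi> y $ 2 \<noteq> 0} \<subseteq> C"
        by (auto simp: C_def K u_def v_def)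
      show "x \<in> closure C" using subsetD[OF closure_mono[OF B] A] .
    qed
    then have "closure (K - link X \<phi>) \<subseteq> closure C" by (intro closure_minimal closed_closure)
    then show ?thesis using cone_base_complement_dense[OF cone] by blast
  qed
  have C_alt: "C = {x \<in> X. \<phi> x $ 1 \<in> cball 0 1 - {0} \<and> \<phi> x $ 2 \<in> cball 0 1 - {0}}"
    by (auto simp: C_def K u_def v_def)
  obtain \<Psi> H where cover: "bidisc_cover K u v \<Psi> H"
  proof (rule bidisc_cover_exists[OF compK contu contv])
    show "norm (u x) \<le> 1 \<and> norm (v x) \<le> 1" if "x \<in> K" for x using that K by auto
    show "finite {x \<in> K. u x = y \<and> v x = z}" for y z
      by (rule finite_subset[OF _ fin[of "vector [y, z]"]]) (use KX in \<open>auto simp: phi_eq\<close>)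
    show "K \<subseteq> closure {x \<in> K. u x \<noteq> 0 \<and> v x \<noteq> 0}" using dense C_def by simp
    show "\<exists>U V g. x \<in> U \<and> openin (top_of_set {x \<in> K. u x \<noteq> 0 \<and> v x \<noteq> 0}) U \<and>
        openin (top_of_set ((cball 0 1 - {0}) \<times> (cball 0 1 - {0}))) V \<and> homeomorphism U V (\<lambda>x. (u x, v x)) g"
      if x: "x \<in> {x \<in> K. u x \<noteq> 0 \<and> v x \<noteq> 0}" for x
    proof -
      have xC: "x \<in> C" using x C_def by simp
      show ?thesis
        using local_analytic_iso_bidisc_chart[OF iso[OF xC] C_alt xC] unfolding C_def u_def v_def .
    qed
    show "path_connected {x \<in> K. norm (u x) = 1 \<and> norm (v x) = 1}" "{x \<in> K. norm (u x) = 1 \<and> norm (v x) = 1} \<noteq> {}"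
      using solid_torus_topology(4,5)[OF tori(1)] unfolding \<tau> by auto
  qed (rule that)
  interpret bidisc_cover K u v \<Psi> H by fact
  have swap: "bidisc_cover K v u (\<lambda>t s. \<Psi> s t) (prod.swap ` H)" by (rule bidisc_cover_swap[OF cover])
  interpret S: bidisc_cover K v u "\<lambda>t s. \<Psi> s t" "prod.swap ` H" by fact
  obtain \<alpha> \<beta> where ab: "\<alpha> > 0" "\<beta> > 0" and H: "H = lens_lattice (int n) (int q) \<alpha> \<beta>"
  proof -
    have "0 < Re
      (winding_number (\<lambda>t. u (h (vector [circlepath 0 1 t, 1]))) 0 * winding_number (\<lambda>t. v (h (vector [1, circlepath 0 1 t]))) 0 -
       winding_number (\<lambda>t. v (h (vector [circlepath 0 1 t, 1]))) 0 * winding_number (\<lambda>t. u (h (vector [1, circlepath 0 1 t]))) 0)"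
      if "h \<in> link_orientation X \<phi>" for h
      using that unfolding link_orientation_def std_torus_intersection_def u_def v_def by blast
    then show ?thesis using lens_space_lattice[OF nq lens'[unfolded T1_def T2_def]] that by blast
  qed
  have cop: "coprime (int n) (int q)" using nq(2) by (simp add: coprime_commute)
  have fst_H: "fst ` H = range ((*) \<alpha>)" unfolding H by (rule fst_lens_lattice[OF cop])
  have snd_H: "fst ` prod.swap ` H = range ((*) \<beta>)"
    unfolding image_image H using snd_lens_lattice by simp
  have card_a: "card {x \<in> K. u x = w \<and> v x = 0} = a" if "norm w = 1" for w
  proof -
    have m: "vector [w, 0] \<in> bidisc \<S> {0}" using that by (simp add: bidisc_def)
    have e: "{x \<in> X \<inter> \<phi> -` bidisc \<S> {0}. \<phi> x = vector [w, 0]} = {x \<in> K. u x = w \<and> v x = 0}"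
      using that by (auto simp: K phi_eq bidisc_def u_def v_def)
    show ?thesis using bspec[OF conjunct2[OF deg_a[unfolded has_covering_degree_def]] m] unfolding e by simp
  qed
  have card_b: "card {x \<in> K. v x = w \<and> u x = 0} = b" if "norm w = 1" for w
  proof -
    have m: "vector [0, w] \<in> bidisc {0} \<S>" using that by (simp add: bidisc_def)
    have e: "{x \<in> X \<inter> \<phi> -` bidisc {0} \<S>. \<phi> x = vector [0, w]} = {x \<in> K. v x = w \<and> u x = 0}"
      using that by (auto simp: K phi_eq bidisc_def u_def v_def)
    show ?thesis using bspec[OF conjunct2[OF deg_b[unfolded has_covering_degree_def]] m] unfolding e by simp
  qed
  have a: "int a = \<alpha>"
  proof (rule core_degree[OF ab(1) fst_H card_a])
    fix \<gamma> :: "real \<Rightarrow> complex^'n" assume "path \<gamma>" "pathfinish \<gamma> = pathstart \<gamma>" "path_image \<gamma> \<subseteq> {x \<in> K. norm (u x) = 1}"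
    then show "\<exists>\<gamma>'. homotopic_loops {x \<in> K. norm (u x) = 1} \<gamma> \<gamma>' \<and> path_image \<gamma>' \<subseteq> {x \<in> K. norm (u x) = 1 \<and> norm (v x) = 1}"
      using solid_torus_loop_to_boundary[OF tori(1)[unfolded \<tau>, unfolded T1_def]] by blast
  qed
  have b: "int b = \<beta>"
  proof (rule S.core_degree[OF ab(2) snd_H card_b])
    fix \<gamma> :: "real \<Rightarrow> complex^'n" assume "path \<gamma>" "pathfinish \<gamma> = pathstart \<gamma>" "path_image \<gamma> \<subseteq> {x \<in> K. norm (v x) = 1}"
    then show "\<exists>\<gamma>'. homotopic_loops {x \<in> K. norm (v x) = 1} \<gamma> \<gamma>' \<and> path_image \<gamma>' \<subseteq> {x \<in> K. norm (v x) = 1 \<and> norm (u x) = 1}"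
      using solid_torus_loop_to_boundary[OF tori(2)[unfolded \<tau>, unfolded T2_def], of \<gamma>]
      by (simp add: conj_commute[of "norm (v _) = 1"])
  qed
  have no_cut: "\<exists>U d. U \<subseteq> K \<inter> ball x e \<and> d > 0 \<and> K \<inter> ball x d \<subseteq> U \<and> connected (U - {x})"
    if x: "x \<in> K" "norm (u x) < 1" "norm (v x) < 1" "\<not> (u x = 0 \<and> v x = 0)" and e: "e > 0" for x e
  proof (rule cone_no_cut_point[OF cone _ _ x(1) _ _ e])
    show "compact (link X \<phi>)"
      unfolding link using solid_torus_topology(1)[OF tori(1)] solid_torus_topology(1)[OF tori(2)] by (rule compact_Un)
    show "x \<noteq> p" using p x(4) phi_eq[of p 0] by auto
    show "x \<notin> link X \<phi>" unfolding link T1_def T2_def using x by auto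
    show "\<exists>A d. connected A \<and> l \<in> A \<and> A \<noteq> {l} \<and> A \<subseteq> link X \<phi> \<inter> ball l e \<and> d > 0 \<and> link X \<phi> \<inter> ball l d \<subseteq> A"
      if "l \<in> link X \<phi>" "e > 0" for l e
      using two_solid_tori_connected_neighbourhood[OF tori] that unfolding link by blast
  qed
  \<comment> \<open>The ambient coordinates: they separate points, and a map into the surface is
    holomorphic as soon as each of them is along it.\<close>
  define \<Lambda> where "\<Lambda> = range (\<lambda>i (x :: complex^'n). x $ i)"
  have sep: "\<exists>l\<in>\<Lambda>. l x \<noteq> l y" if "x \<noteq> y" for x y :: "complex^'n"
    using that by (auto simp: \<Lambda>_def vec_eq_iff)
  have contl: "continuous_on K l" if "l \<in> \<Lambda>" for l using that by (auto simp: \<Lambda>_def intro!: continuous_intros)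
  have PsiC: "\<Psi> s t \<in> C" if "Re s \<le> 0" "Re t \<le> 0" for s t
    using that by (simp add: C_def Psi_K u_Psi v_Psi)
  \<comment> \<open>Stated for two functions \<open>f\<close> and \<open>g\<close>, so that fixing
    either parameter covers either axis.\<close>
  have curve: "(\<lambda>z. l (\<Psi> (f z) (g z))) holomorphic_on {z. Re z < 0}"
    if l: "l \<in> \<Lambda>" and fg: "f holomorphic_on {z. Re z < 0}" "g holomorphic_on {z. Re z < 0}"
      "\<And>z. Re z < 0 \<Longrightarrow> Re (f z) \<le> 0 \<and> Re (g z) \<le> 0" for l f g
  proof -
    have "(\<lambda>z. \<Psi> (f z) (g z) $ i) holomorphic_on {z. Re z < 0}" for i
    proof (rule lift_curve_holomorphic[of _ X \<phi>])
      show "open {z. Re z < 0}" by (rule open_halfspace_Re_lt)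
      show "local_analytic_iso_at X \<phi> (\<Psi> (f z) (g z))" "\<Psi> (f z) (g z) \<in> X" if "z \<in> {z. Re z < 0}" for z
        using iso PsiC fg(3) that KX by (auto simp: C_def)
      have "continuous_on {z. Re z < 0} (\<lambda>z. (\<lambda>(s, t). \<Psi> s t) (f z, g z))"
        using fg by (intro continuous_on_compose2[OF Psi_cont] continuous_intros holomorphic_on_imp_continuous_on) auto
      then show "continuous_on {z. Re z < 0} (\<lambda>z. \<Psi> (f z) (g z))" by simp
      fix j :: 2
      have eq: "\<phi> (\<Psi> (f z) (g z)) $ j = (if j = 1 then exp (f z) else exp (g z))" if "z \<in> {z. Re z < 0}" for z
        using u_Psi[of "f z" "g z"] v_Psi[of "f z" "g z"] fg(3) that exhaust_2[of j] by (auto simp: u_def v_def)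
      have "(\<lambda>z. if j = 1 then exp (f z) else exp (g z)) holomorphic_on {z. Re z < 0}"
        using fg by (cases "j = 1") (auto intro!: holomorphic_intros)
      then show "(\<lambda>z. \<phi> (\<Psi> (f z) (g z)) $ j) holomorphic_on {z. Re z < 0}"
        by (rule holomorphic_transform) (simp add: eq)
    qed
    then show ?thesis using l by (auto simp: \<Lambda>_def)
  qed
  have "unibranch_cover K u v \<Psi> H \<alpha> \<Lambda>"
  proof
    show "0 < \<alpha>" "fst ` H = range ((*) \<alpha>)" by fact+
    show "int (card {x \<in> K. u x = w \<and> v x = 0}) = \<alpha>" if "norm w = 1" for w using card_a[OF that] a by simp
    show "(\<lambda>s. l (\<Psi> s t)) holomorphic_on {s. Re s < 0}" if "l \<in> \<Lambda>" "Re t < 0" for l t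
      using curve[OF that(1), of "\<lambda>s. s" "\<lambda>_. t"] that(2) by (simp add: holomorphic_on_ident holomorphic_on_const)
    show "\<exists>U d. U \<subseteq> K \<inter> ball x e \<and> d > 0 \<and> K \<inter> ball x d \<subseteq> U \<and> connected (U - {x})"
      if "x \<in> K" "norm (u x) < 1" "u x \<noteq> 0" "v x = 0" "e > 0" for x e
      using no_cut[of x e] that by simp
  qed (use sep contl in auto)
  then have s1: "separated_branches K u v \<Psi> H" by (rule separated_branches_of_unibranch_cover)
  have "unibranch_cover K v u (\<lambda>t s. \<Psi> s t) (prod.swap ` H) \<beta> \<Lambda>"
  proof
    show "0 < \<beta>" "fst ` prod.swap ` H = range ((*) \<beta>)" by fact+
    show "int (card {x \<in> K. v x = w \<and> u x = 0}) = \<beta>" if "norm w = 1" for w using card_b[OF that] b by simp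
    show "(\<lambda>s. l (\<Psi> t s)) holomorphic_on {s. Re s < 0}" if "l \<in> \<Lambda>" "Re t < 0" for l t
      using curve[OF that(1), of "\<lambda>_. t" "\<lambda>s. s"] that(2) by (simp add: holomorphic_on_ident holomorphic_on_const)
    show "\<exists>U d. U \<subseteq> K \<inter> ball x e \<and> d > 0 \<and> K \<inter> ball x d \<subseteq> U \<and> connected (U - {x})"
      if "x \<in> K" "norm (v x) < 1" "v x \<noteq> 0" "u x = 0" "e > 0" for x e
      using no_cut[of x e] that by simp
  qed (use sep contl in auto)
  then have s2: "separated_branches K v u (\<lambda>t s. \<Psi> s t) (prod.swap ` H)" by (rule separated_branches_of_unibranch_cover)
  have "H = lens_lattice (int n) (int q) (int a) (int b)" unfolding H a b ..
  then show ?thesis using that[of \<Psi>] cover s1 s2 by simp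
qed

section \<open>Analyticity of the homeomorphism off the ramification locus\<close>

lemma analytic_map_on_cong:
  "(\<And>x. x \<in> A \<Longrightarrow> f x = g x) \<Longrightarrow> analytic_map_on A f \<longleftrightarrow> analytic_map_on A g"
  unfolding analytic_map_on_def by simp

lemma unramified_interior_eq:
  "unramified_interior X \<phi> = {x \<in> X. norm (\<phi> x $ 1) < 1 \<and> norm (\<phi> x $ 2) < 1 \<and> \<phi> x $ 1 \<noteq> 0 \<and> \<phi> x $ 2 \<noteq> 0}"
  by (auto simp: unramified_interior_def compact_rep_def link_def bidisc_def coordinate_cross_def)

lemma unramified_interior_analytic:
  assumes "quasi_ordinary_morphism p \<epsilon> X \<phi>"
  shows "analytic_map_on (unramified_interior X \<phi>) \<phi>"
    "x \<in> unramified_interior X \<phi> \<Longrightarrow> local_analytic_iso_at X \<phi> x"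
proof -
  show "analytic_map_on (unramified_interior X \<phi>) \<phi>"
    using assms unfolding quasi_ordinary_morphism_def
    by (auto intro: analytic_map_on_subset simp: unramified_interior_eq)
  assume x: "x \<in> unramified_interior X \<phi>"
  show "local_analytic_iso_at X \<phi> x"
  proof (rule ccontr)
    assume "\<not> local_analytic_iso_at X \<phi> x"
    then have "\<phi> x \<in> discriminant X \<phi>" using x by (auto simp: discriminant_def unramified_interior_eq)
    then show False
      using assms x unfolding quasi_ordinary_morphism_def by (auto simp: coordinate_cross_def unramified_interior_eq)
  qed
qed

text \<open>Off the axes both maps to the bidisc are local analytic isomorphisms, so
  \<open>f\<close> and its inverse are continuous lifts of analytic maps, hence analytic
  themselves.\<close>

lemma analytic_iso_unramified_interior:
  assumes qo: "quasi_ordinary_morphism p1 \<epsilon>1 X1 \<phi>1" "quasi_ordinary_morphism p2 \<epsilon>2 X2 \<phi>2"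
    and hom: "homeomorphism (compact_rep X1 \<phi>1) (compact_rep X2 \<phi>2) f g"
    and eq: "\<And>x. x \<in> compact_rep X1 \<phi>1 \<Longrightarrow> \<phi>1 x = \<phi>2 (f x)"
  shows "analytic_iso (unramified_interior X1 \<phi>1) (unramified_interior X2 \<phi>2) f"
proof -
  let ?W1 = "unramified_interior X1 \<phi>1" and ?W2 = "unramified_interior X2 \<phi>2"
  have WK: "?W1 \<subseteq> compact_rep X1 \<phi>1" "?W2 \<subseteq> compact_rep X2 \<phi>2" by (auto simp: unramified_interior_def)
  have KX: "compact_rep X1 \<phi>1 \<subseteq> X1" "compact_rep X2 \<phi>2 \<subseteq> X2" by (auto simp: compact_rep_def)
  have gf: "g (f x) = x" if "x \<in> ?W1" for x using homeomorphism_apply1[OF hom] WK(1) that by blast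
  have fg: "f (g y) = y" if "y \<in> ?W2" for y using homeomorphism_apply2[OF hom] WK(2) that by blast
  have gK: "g y \<in> compact_rep X1 \<phi>1" if "y \<in> ?W2" for y using homeomorphism_image2[OF hom] WK(2) that by blast
  have fK: "f x \<in> compact_rep X2 \<phi>2" if "x \<in> ?W1" for x using homeomorphism_image1[OF hom] WK(1) that by blast
  have eqf: "\<phi>1 x = \<phi>2 (f x)" if "x \<in> ?W1" for x using eq WK(1) that by blast
  have eqg: "\<phi>2 y = \<phi>1 (g y)" if "y \<in> ?W2" for y using eq[OF gK[OF that]] fg[OF that] by simp
  have fW: "f x \<in> ?W2" if "x \<in> ?W1" for x
    using fK[OF that] KX(2) eqf[OF that] that by (auto simp: unramified_interior_eq)
  have gW: "g y \<in> ?W1" if "y \<in> ?W2" for y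
    using gK[OF that] KX(1) eqg[OF that] that by (auto simp: unramified_interior_eq)
  have bij: "bij_betw f ?W1 ?W2"
    by (rule bij_betw_byWitness[of _ g]) (use gf fg fW gW in auto)
  have "analytic_map_on ?W1 f"
  proof (rule analytic_map_on_lift[OF unramified_interior_analytic(1)[OF qo(1)]])
    show "continuous_on ?W1 f" by (rule continuous_on_subset[OF homeomorphism_cont1[OF hom] WK(1)])
    show "f ` ?W1 \<subseteq> X2" using fK KX(2) by blast
  qed (use eqf fW unramified_interior_analytic(2)[OF qo(2)] in auto)
  moreover have "analytic_map_on ?W2 g"
  proof (rule analytic_map_on_lift[OF unramified_interior_analytic(1)[OF qo(2)]])
    show "continuous_on ?W2 g" by (rule continuous_on_subset[OF homeomorphism_cont2[OF hom] WK(2)])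
    show "g ` ?W2 \<subseteq> X1" using gK KX(1) by blast
  qed (use eqg gW unramified_interior_analytic(2)[OF qo(1)] in auto)
  moreover have "inv_into ?W1 f y = g y" if "y \<in> ?W2" for y
    using inv_into_f_eq[OF bij_betw_imp_inj_on[OF bij] gW[OF that] fg[OF that]] .
  ultimately show ?thesis
    using bij analytic_map_on_cong[of ?W2 "inv_into ?W1 f" g] unfolding analytic_iso_def by blast
qed

theorem proposition5p0p1:
  fixes n q a b :: nat
    and p1 :: "complex^'n1" and \<epsilon>1 :: real and X1 :: "(complex^'n1) set"
    and \<phi>1 :: "complex^'n1 \<Rightarrow> complex^2"
    and p2 :: "complex^'n2" and \<epsilon>2 :: real and X2 :: "(complex^'n2) set"
    and \<phi>2 :: "complex^'n2 \<Rightarrow> complex^2"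
  assumes "q < n" and "coprime q n"
    and "good_compact_rep p1 \<epsilon>1 X1 \<phi>1" and "good_compact_rep p2 \<epsilon>2 X2 \<phi>2"
    and "lens_space n q (link X1 \<phi>1)
           (X1 \<inter> \<phi>1 -` bidisc \<S> \<D>) (X1 \<inter> \<phi>1 -` bidisc \<D> \<S>) (link_orientation X1 \<phi>1)"
    and "lens_space n q (link X2 \<phi>2)
           (X2 \<inter> \<phi>2 -` bidisc \<S> \<D>) (X2 \<inter> \<phi>2 -` bidisc \<D> \<S>) (link_orientation X2 \<phi>2)"
    and "has_covering_degree \<phi>1 (X1 \<inter> \<phi>1 -` bidisc \<S> {0}) (bidisc \<S> {0}) a"
    and "has_covering_degree \<phi>2 (X2 \<inter> \<phi>2 -` bidisc \<S> {0}) (bidisc \<S> {0}) a"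
    and "has_covering_degree \<phi>1 (X1 \<inter> \<phi>1 -` bidisc {0} \<S>) (bidisc {0} \<S>) b"
    and "has_covering_degree \<phi>2 (X2 \<inter> \<phi>2 -` bidisc {0} \<S>) (bidisc {0} \<S>) b"
  shows "\<exists>f g. homeomorphism (compact_rep X1 \<phi>1) (compact_rep X2 \<phi>2) f g \<and> f p1 = p2 \<and>
           (\<forall>x\<in>compact_rep X1 \<phi>1. \<phi>1 x = \<phi>2 (f x)) \<and>
           analytic_iso (unramified_interior X1 \<phi>1) (unramified_interior X2 \<phi>2) f"
proof -
  let ?H = "lens_lattice (int n) (int q) (int a) (int b)"
  let ?K1 = "compact_rep X1 \<phi>1" and ?u1 = "\<lambda>x. \<phi>1 x $ 1" and ?v1 = "\<lambda>x. \<phi>1 x $ 2"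
  let ?K2 = "compact_rep X2 \<phi>2" and ?u2 = "\<lambda>x. \<phi>2 x $ 1" and ?v2 = "\<lambda>x. \<phi>2 x $ 2"
  obtain \<Psi>1 where 1: "bidisc_cover ?K1 ?u1 ?v1 \<Psi>1 ?H" "separated_branches ?K1 ?u1 ?v1 \<Psi>1 ?H"
    "separated_branches ?K1 ?v1 ?u1 (\<lambda>t s. \<Psi>1 s t) (prod.swap ` ?H)"
    using lens_germ_cover[OF assms(1,2,3,5,7,9)] by blast
  obtain \<Psi>2 where 2: "bidisc_cover ?K2 ?u2 ?v2 \<Psi>2 ?H" "separated_branches ?K2 ?u2 ?v2 \<Psi>2 ?H"
    "separated_branches ?K2 ?v2 ?u2 (\<lambda>t s. \<Psi>2 s t) (prod.swap ` ?H)"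
    using lens_germ_cover[OF assms(1,2,4,6,8,10)] by blast
  have qo: "quasi_ordinary_morphism p1 \<epsilon>1 X1 \<phi>1" "quasi_ordinary_morphism p2 \<epsilon>2 X2 \<phi>2"
    using assms(3,4) unfolding good_compact_rep_def by auto
  \<comment> \<open>The vertex is the only point over the origin; so the graph is single valued
    there, and \<open>f\<close> sends \<open>p1\<close> to \<open>p2\<close>.\<close>
  have vertex: "{x \<in> compact_rep X \<phi>. \<phi> x $ 1 = 0 \<and> \<phi> x $ 2 = 0} = {p}"
    if "quasi_ordinary_morphism p \<epsilon> X \<phi>" for p :: "complex^'k" and \<epsilon> X and \<phi> :: "complex^'k \<Rightarrow> complex^2"
  proof -
    have "{x \<in> compact_rep X \<phi>. \<phi> x $ 1 = 0 \<and> \<phi> x $ 2 = 0} = {x \<in> X. \<phi> x = 0}"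
      by (auto simp: compact_rep_def bidisc_def vec_eq_iff forall_2)
    then show ?thesis using that unfolding quasi_ordinary_morphism_def by simp
  qed
  interpret bidisc_cover_pair ?K1 ?u1 ?v1 \<Psi>1 ?K2 ?u2 ?v2 \<Psi>2 ?H
    by (intro bidisc_cover_pair.intro 1 2)
  obtain f g where fg: "homeomorphism ?K1 ?K2 f g" "f p1 = p2"
    "\<And>x. x \<in> ?K1 \<Longrightarrow> ?u1 x = ?u2 (f x) \<and> ?v1 x = ?v2 (f x)"
    using bidisc_covers_homeomorphic[OF 1(2,3) 2(2,3) vertex[OF qo(1)] vertex[OF qo(2)]] by blast
  have eq: "\<phi>1 x = \<phi>2 (f x)" if "x \<in> ?K1" for x
    using fg(3)[OF that] by (simp add: vec_eq_iff forall_2)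
  show ?thesis
    using fg(1,2) eq analytic_iso_unramified_interior[OF qo fg(1) eq] by blast
qed

end
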